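(* Let $(J,\rho)\in\mathcal J_G^{wc}$ with associated $(\tilde J,\tilde\rho)$ and $\pi=\mathrm{ind}_{\tilde J}^G\tilde\rho$, and let ${}^\flat\tilde\pi=\mathrm{ind}_{\tilde J}^{{}^\flat G\tilde J}(\tilde\rho)$. Then $$m_{{}^\flat G}(\pi)=m_{{}^\flat G}({}^\flat\tilde\pi)=m_J(\tilde\rho).$$
   Context: Setting: $F$ is a non-archimedean local field, $\mathbf G$ a connected reductive $F$-group with center $\mathbf Z$, $G=\mathbf G(F)$, $Z=\mathbf Z(F)$. Representations are smooth and complex; $\mathrm{ind}$ is compact induction. For $g\in G$: $H^g=gHg^{-1}$ and $\sigma^g(x)=\sigma(g^{-1}xg)$. ${}^0G$ is the intersection of the kernels of all unramified characters $g\mapsto|\chi(g)|_F^s$ of $G$ ($\chi$ an $F$-rational character of $\mathbf G$, $s\in\mathbb C$). Fix an open normal subgroup ${}^\flat G$ of $G$, contained in ${}^0G$ with finite index and containing the commutator subgroup of $G$. $\Omega(G)$ is the set of open compact subgroups of $G$; $\Omega(G/Z)$ the set of open subgroups of $G$ containing $Z$ and compact modulo $Z$. For a representation $\sigma$ of $H\subset G$, $\mathcal I_G(\sigma)=\{g\in G:\mathrm{Hom}_{H\cap H^g}(\sigma,\sigma^g)\neq0\}$. $\mathcal J_G$ is the set of pairs $(J,\rho)$, $J\in\Omega(G)$, $\rho\in\mathrm{Irr}(J)$, such that there exist $\tilde J\in\Omega(G/Z)$ with $J=\tilde J\cap{}^\flat G$ and $\tilde\rho\in\mathrm{Irr}(\tilde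 J)$ containing $\rho$ with $\mathcal I_G(\tilde\rho)=\tilde J$ (equivalently $\pi:=\mathrm{ind}_{\tilde J}^G\tilde\rho$ is irreducible, hence supercuspidal). For each $(J,\rho)\in\mathcal J_G$ such a $(\tilde J,\tilde\rho)$ is fixed. $\mathcal J_G^{wc}\subset\mathcal J_G$ is the subset of weakly cuspidal pairs, i.e. those with $\mathcal I_G(\rho)\subset\tilde J$. Multiplicity: for an open subgroup $\tilde H\subset G$, $H=\tilde H\cap{}^\flat G$, and $\tilde\sigma\in\mathrm{Irr}(\tilde H)$ (with $\tilde H=G$, ${}^\flat G\tilde J$ or $\tilde J$ here), $\tilde\sigma|_H$ is semisimple of finite length and all its irreducible constituents occur with the same multiplicity, denoted $m_H(\tilde\sigma)$. *)

theory Defs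
  imports
    "HOL-Analysis.Analysis"
    "HOL-Algebra.Generated_Groups"
    "HOL-Algebra.Algebraic_Closure_Type"
    "HOL-Library.Function_Algebras"
begin

section \<open>Non-archimedean local fields\<close>

text \<open>
  The absolute value is the normalised one: complete, with finite residue field of
  cardinality \<open>q\<close> and value group generated by \<open>q\<close>. Since \<open>q \<ge> 2\<close>,
  it is discrete and nontrivial.
\<close>

definition residue_field :: "('f::field \<Rightarrow> real) \<Rightarrow> 'f set set" where
  "residue_field v = {x. v x \<le> 1} // {(x, y). v x \<le> 1 \<and> v y \<le> 1 \<and> v (x - y) < 1}"

locale nonarch_local_field =
  fixes v :: "'f::field \<Rightarrow> real"
  assumes nonneg: "v x \<ge> 0"
    and eq_0_iff: "v x = 0 \<longleftrightarrow> x = 0"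
    and mult: "v (x * y) = v x * v y"
    and ultrametric: "v (x + y) \<le> max (v x) (v y)"
    and complete: "Metric_space.mcomplete UNIV (\<lambda>x y. v (x - y))"
    and finite_residue_field: "finite (residue_field v)"
    and value_group: "v ` {x. x \<noteq> 0} = range (\<lambda>k::int. real (card (residue_field v)) powi k)"
begin

lemma v_minus: "v (- x) = v x"
proof -
  have "v (-1) * v (-1) = v 1" "v 1 * v 1 = v 1"
    by (simp_all flip: mult)
  moreover have "v 1 \<noteq> 0" by (simp add: eq_0_iff)
  ultimately have "v (-1) * v (-1) = 1" by simp
  then have "v (-1) = 1"
    using nonneg[of "-1"] by (simp add: square_eq_1_iff)
  then show ?thesis using mult[of "-1" x] by simp
qed

sublocale metric: Metric_space UNIV "\<lambda>x y. v (x - y)"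
proof
  fix x y z :: 'f
  show "0 \<le> v (x - y)" by (rule nonneg)
  show "v (x - y) = v (y - x)" using v_minus[of "x - y"] by simp
  show "(v (x - y) = 0) = (x = y)" by (simp add: eq_0_iff)
  show "v (x - z) \<le> v (x - y) + v (y - z)"
    using ultrametric[of "x - y" "y - z"] nonneg[of "x - y"] nonneg[of "y - z"] by simp
qed

end

definition field_topology :: "('f::field \<Rightarrow> real) \<Rightarrow> 'f topology" where
  "field_topology v = Metric_space.mtopology UNIV (\<lambda>x y. v (x - y))"

definition matrix_topology :: "('f::field \<Rightarrow> real) \<Rightarrow> ('f ^ 'n ^ 'n) topology" where
  "matrix_topology v =
     pullback_topology UNIV (\<lambda>A (i, j). A $ i $ j) (product_topology (\<lambda>_. field_topology v) UNIV)"


section \<open>Linear algebraic groups over a field\<close>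

text \<open>
  An algebraic group is identified with its set of points over the algebraic closure, as a
  Zariski closed subgroup of the general linear group. Algebraically closed fields are
  infinite, so polynomials may be identified with polynomial functions.
\<close>

definition GL :: "('a::field ^ 'n ^ 'n) monoid" where
  "GL = \<lparr>carrier = {A. invertible A}, mult = (**), one = mat 1\<rparr>"

lemma group_GL: "group GL"
proof (rule groupI)
  fix x :: "'a::field ^ 'n ^ 'n"
  assume "x \<in> carrier GL"
  then show "\<exists>y\<in>carrier GL. y \<otimes>\<^bsub>GL\<^esub> x = \<one>\<^bsub>GL\<^esub>"
    unfolding GL_def invertible_def by auto
qed (auto simp: GL_def matrix_mul_assoc invertible_mult, auto simp: invertible_def)

inductive_set poly_fun :: "'a::comm_ring_1 set \<Rightarrow> ('a ^ 'n ^ 'n \<Rightarrow> 'a) set" for K where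
  const: "c \<in> K \<Longrightarrow> (\<lambda>_. c) \<in> poly_fun K"
| coord: "(\<lambda>A. A $ i $ j) \<in> poly_fun K"
| add: "p \<in> poly_fun K \<Longrightarrow> q \<in> poly_fun K \<Longrightarrow> (\<lambda>A. p A + q A) \<in> poly_fun K"
| mult: "p \<in> poly_fun K \<Longrightarrow> q \<in> poly_fun K \<Longrightarrow> (\<lambda>A. p A * q A) \<in> poly_fun K"

definition zariski_topology :: "('a::field ^ 'n ^ 'n) topology" where
  "zariski_topology =
     topology_generated_by {{A \<in> carrier GL. p A \<noteq> 0} | p. p \<in> poly_fun UNIV}"

definition vanishing_ideal ::
    "'a::comm_ring_1 set \<Rightarrow> ('a ^ 'n ^ 'n) set \<Rightarrow> ('a ^ 'n ^ 'n \<Rightarrow> 'a) set" where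
  "vanishing_ideal K \<G> = {p \<in> poly_fun K. \<forall>A\<in>\<G>. p A = 0}"

text \<open>
  A closed set is defined over the base field if its ideal is generated by polynomials with
  coefficients there (this is stronger than being the zero set of such polynomials when
  the base field is not perfect).
\<close>

definition defined_over_base :: "('f::field alg_closure ^ 'n ^ 'n) set \<Rightarrow> bool" where
  "defined_over_base \<G> \<longleftrightarrow>
     (\<forall>p\<in>vanishing_ideal UNIV \<G>.
        \<exists>Q c. finite Q \<and> Q \<subseteq> vanishing_ideal (range to_ac) \<G> \<and> c ` Q \<subseteq> poly_fun UNIV \<and>
              p = (\<lambda>A. \<Sum>q\<in>Q. c q A * q A))"

definition closed_subgroup :: "('a::field ^ 'n ^ 'n) set \<Rightarrow> bool" where
  "closed_subgroup \<G> \<longleftrightarrow> subgroup \<G> GL \<and> closedin zariski_topology \<G>"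

definition unipotent :: "'a::field ^ 'n ^ 'n \<Rightarrow> bool" where
  "unipotent A \<longleftrightarrow> (\<exists>k::nat. (((**) (A - mat 1)) ^^ k) (mat 1) = 0)"

text \<open>Connectedness and the unipotent radical are taken over the algebraic closure.\<close>

definition connected_reductive_group :: "('f::field alg_closure ^ 'n ^ 'n) set \<Rightarrow> bool" where
  "connected_reductive_group \<G> \<longleftrightarrow>
     closed_subgroup \<G> \<and> defined_over_base \<G> \<and> connectedin zariski_topology \<G> \<and>
     (\<forall>U. closed_subgroup U \<and> connectedin zariski_topology U \<and> U \<lhd> GL\<lparr>carrier := \<G>\<rparr> \<and>
          (\<forall>A\<in>U. unipotent A) \<longrightarrow> U = {mat 1})"

definition algebraic_center :: "('a::field ^ 'n ^ 'n) set \<Rightarrow> ('a ^ 'n ^ 'n) set" where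
  "algebraic_center \<G> = {z \<in> \<G>. \<forall>x\<in>\<G>. z ** x = x ** z}"

definition rational_points :: "('f::field alg_closure ^ 'n ^ 'n) set \<Rightarrow> ('f ^ 'n ^ 'n) set" where
  "rational_points \<G> = {A. map_matrix to_ac A \<in> \<G>}"

definition rational_group :: "('f::field alg_closure ^ 'n ^ 'n) set \<Rightarrow> ('f ^ 'n ^ 'n) monoid" where
  "rational_group \<G> = GL\<lparr>carrier := rational_points \<G>\<rparr>"

definition rational_topology ::
    "('f::field \<Rightarrow> real) \<Rightarrow> ('f alg_closure ^ 'n ^ 'n) set \<Rightarrow> ('f ^ 'n ^ 'n) topology" where
  "rational_topology v \<G> = subtopology (matrix_topology v) (rational_points \<G>)"

text \<open>
  Regular functions over the base field on a closed subgroup of the general linear group are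
  restrictions of elements of the polynomial ring localised at the determinant.
\<close>

definition rational_character ::
    "('f::field alg_closure ^ 'n ^ 'n) set \<Rightarrow> ('f alg_closure ^ 'n ^ 'n \<Rightarrow> 'f alg_closure) \<Rightarrow> bool" where
  "rational_character \<G> \<psi> \<longleftrightarrow>
     (\<exists>p\<in>poly_fun (range to_ac). \<exists>k::nat. \<forall>A\<in>\<G>. \<psi> A = p A / det A ^ k) \<and>
     (\<forall>A\<in>\<G>. \<psi> A \<noteq> 0) \<and> (\<forall>A\<in>\<G>. \<forall>B\<in>\<G>. \<psi> (A ** B) = \<psi> A * \<psi> B)"

definition unramified_character ::
    "('f::field \<Rightarrow> real) \<Rightarrow> ('f alg_closure ^ 'n ^ 'n \<Rightarrow> 'f alg_closure) \<Rightarrow> complex \<Rightarrow>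
     'f ^ 'n ^ 'n \<Rightarrow> complex" where
  "unramified_character v \<psi> s g = complex_of_real (v (of_ac (\<psi> (map_matrix to_ac g)))) powr s"

definition zero_subgroup ::
    "('f::field \<Rightarrow> real) \<Rightarrow> ('f alg_closure ^ 'n ^ 'n) set \<Rightarrow> ('f ^ 'n ^ 'n) set" where
  "zero_subgroup v \<G> =
     {g \<in> rational_points \<G>. \<forall>\<psi> s. rational_character \<G> \<psi> \<longrightarrow> unramified_character v \<psi> s g = 1}"


section \<open>Topological groups\<close>

definition coset_topology :: "('g, 'm) monoid_scheme \<Rightarrow> 'g topology \<Rightarrow> 'g set \<Rightarrow> 'g set topology" where
  "coset_topology G T H = topology (\<lambda>C. C \<subseteq> rcosets\<^bsub>G\<^esub> H \<and> openin T (\<Union>C))"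

lemma openin_coset_topology:
  assumes "group G" "subgroup H G"
  shows "openin (coset_topology G T H) C \<longleftrightarrow> C \<subseteq> rcosets\<^bsub>G\<^esub> H \<and> openin T (\<Union>C)"
proof -
  interpret group G by fact
  have *: "\<Union>(C \<inter> D) = \<Union>C \<inter> \<Union>D" if "C \<subseteq> rcosets\<^bsub>G\<^esub> H" "D \<subseteq> rcosets\<^bsub>G\<^esub> H" for C D
  proof (intro equalityI subsetI)
    fix x assume "x \<in> \<Union>C \<inter> \<Union>D"
    then obtain c d where cd: "c \<in> C" "d \<in> D" "x \<in> c" "x \<in> d" by blast
    then have "c = d"
      using that rcos_disjoint[OF assms(2)] by (meson disjnt_iff pairwiseD subsetD)
    with cd show "x \<in> \<Union>(C \<inter> D)" by blast
  qed blast
  have "istopology (\<lambda>C. C \<subseteq> rcosets\<^bsub>G\<^esub> H \<and> openin T (\<Union>C))"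
    unfolding istopology_def
  proof (intro conjI allI impI)
    fix \<K> assume "\<forall>K\<in>\<K>. K \<subseteq> rcosets\<^bsub>G\<^esub> H \<and> openin T (\<Union>K)"
    moreover have "\<Union>(\<Union>\<K>) = \<Union>(Union ` \<K>)" by blast
    ultimately show "\<Union>\<K> \<subseteq> rcosets\<^bsub>G\<^esub> H" "openin T (\<Union>(\<Union>\<K>))"
      using openin_Union[of "Union ` \<K>" T] by auto
  qed (auto simp: * openin_Int)
  then show ?thesis by (simp add: coset_topology_def)
qed

definition compact_mod :: "('g, 'm) monoid_scheme \<Rightarrow> 'g topology \<Rightarrow> 'g set \<Rightarrow> 'g set \<Rightarrow> bool" where
  "compact_mod G T H S \<longleftrightarrow> compactin (coset_topology G T H) ((\<lambda>x. H #>\<^bsub>G\<^esub> x) ` S)"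

definition open_compact_subgroup :: "('g, 'm) monoid_scheme \<Rightarrow> 'g topology \<Rightarrow> 'g set \<Rightarrow> bool" where
  "open_compact_subgroup G T H \<longleftrightarrow> subgroup H G \<and> openin T H \<and> compactin T H"

definition open_compact_mod_subgroup ::
    "('g, 'm) monoid_scheme \<Rightarrow> 'g topology \<Rightarrow> 'g set \<Rightarrow> 'g set \<Rightarrow> bool" where
  "open_compact_mod_subgroup G T Z H \<longleftrightarrow>
     subgroup H G \<and> openin T H \<and> Z \<subseteq> H \<and> compact_mod G T Z H"

definition flat_subgroup ::
    "('g, 'm) monoid_scheme \<Rightarrow> 'g topology \<Rightarrow> 'g set \<Rightarrow> 'g set \<Rightarrow> bool" where
  "flat_subgroup G T G0 Gb \<longleftrightarrow>
     Gb \<lhd> G \<and> openin T Gb \<and>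
     Gb \<subseteq> G0 \<and> finite (rcosets\<^bsub>G\<lparr>carrier := G0\<rparr>\<^esub> Gb) \<and>
     derived G (carrier G) \<subseteq> Gb"


section \<open>Smooth complex representations\<close>

text \<open>
  The representation space is a subspace of an ambient complex vector space; this allows
  subrepresentations and spaces of functions to be treated on the same footing. The subgroup
  that acts is an argument of the predicates, so restriction leaves the record unchanged.
\<close>

record ('g, 'v) rep =
  rspace :: "'v set"
  rscale :: "complex \<Rightarrow> 'v \<Rightarrow> 'v"
  ract :: "'g \<Rightarrow> 'v \<Rightarrow> 'v"

definition smooth_rep ::
    "('g, 'm) monoid_scheme \<Rightarrow> 'g topology \<Rightarrow> 'g set \<Rightarrow> ('g, 'v::ab_group_add) rep \<Rightarrow> bool" where
  "smooth_rep G T H R \<longleftrightarrow>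
     vector_space (rscale R) \<and> module.subspace (rscale R) (rspace R) \<and>
     (\<forall>h\<in>H. \<forall>x\<in>rspace R. ract R h x \<in> rspace R) \<and>
     (\<forall>h\<in>H. \<forall>x\<in>rspace R. \<forall>y\<in>rspace R. ract R h (x + y) = ract R h x + ract R h y) \<and>
     (\<forall>h\<in>H. \<forall>c. \<forall>x\<in>rspace R. ract R h (rscale R c x) = rscale R c (ract R h x)) \<and>
     (\<forall>x\<in>rspace R. ract R \<one>\<^bsub>G\<^esub> x = x) \<and>
     (\<forall>g\<in>H. \<forall>h\<in>H. \<forall>x\<in>rspace R. ract R (g \<otimes>\<^bsub>G\<^esub> h) x = ract R g (ract R h x)) \<and>
     (\<forall>x\<in>rspace R. openin (subtopology T H) {h \<in> H. ract R h x = x})"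

definition invariant_subspace :: "'g set \<Rightarrow> ('g, 'v::ab_group_add) rep \<Rightarrow> 'v set \<Rightarrow> bool" where
  "invariant_subspace H R W \<longleftrightarrow>
     module.subspace (rscale R) W \<and> W \<subseteq> rspace R \<and> (\<forall>h\<in>H. \<forall>x\<in>W. ract R h x \<in> W)"

definition irreducible_rep ::
    "('g, 'm) monoid_scheme \<Rightarrow> 'g topology \<Rightarrow> 'g set \<Rightarrow> ('g, 'v::ab_group_add) rep \<Rightarrow> bool" where
  "irreducible_rep G T H R \<longleftrightarrow>
     smooth_rep G T H R \<and> rspace R \<noteq> {0} \<and>
     (\<forall>W. invariant_subspace H R W \<longrightarrow> W = {0} \<or> W = rspace R)"

definition rep_hom ::
    "'g set \<Rightarrow> ('g, 'v::ab_group_add) rep \<Rightarrow> ('g, 'w::ab_group_add) rep \<Rightarrow> ('v \<Rightarrow> 'w) set" where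
  "rep_hom H R S =
     {f. (\<forall>x\<in>rspace R. f x \<in> rspace S) \<and>
         (\<forall>x\<in>rspace R. \<forall>y\<in>rspace R. f (x + y) = f x + f y) \<and>
         (\<forall>c. \<forall>x\<in>rspace R. f (rscale R c x) = rscale S c (f x)) \<and>
         (\<forall>h\<in>H. \<forall>x\<in>rspace R. f (ract R h x) = ract S h (f x))}"

definition rep_iso ::
    "'g set \<Rightarrow> ('g, 'v::ab_group_add) rep \<Rightarrow> ('g, 'w::ab_group_add) rep \<Rightarrow> bool" where
  "rep_iso H R S \<longleftrightarrow> (\<exists>f\<in>rep_hom H R S. bij_betw f (rspace R) (rspace S))"

definition subrep :: "('g, 'v) rep \<Rightarrow> 'v set \<Rightarrow> ('g, 'v) rep" where
  "subrep R W = R\<lparr>rspace := W\<rparr>"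

definition rep_contains ::
    "'g set \<Rightarrow> ('g, 'v::ab_group_add) rep \<Rightarrow> ('g, 'w::ab_group_add) rep \<Rightarrow> bool" where
  "rep_contains H R S \<longleftrightarrow> (\<exists>W. invariant_subspace H R W \<and> rep_iso H S (subrep R W))"

definition conj_set :: "('g, 'm) monoid_scheme \<Rightarrow> 'g \<Rightarrow> 'g set \<Rightarrow> 'g set" where
  "conj_set G g H = (\<lambda>h. g \<otimes>\<^bsub>G\<^esub> h \<otimes>\<^bsub>G\<^esub> inv\<^bsub>G\<^esub> g) ` H"

definition conj_rep :: "('g, 'm) monoid_scheme \<Rightarrow> 'g \<Rightarrow> ('g, 'v) rep \<Rightarrow> ('g, 'v) rep" where
  "conj_rep G g R = R\<lparr>ract := \<lambda>x. ract R (inv\<^bsub>G\<^esub> g \<otimes>\<^bsub>G\<^esub> x \<otimes>\<^bsub>G\<^esub> g)\<rparr>"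

definition intertwining_set ::
    "('g, 'm) monoid_scheme \<Rightarrow> 'g set \<Rightarrow> ('g, 'v::ab_group_add) rep \<Rightarrow> 'g set" where
  "intertwining_set G H R =
     {g \<in> carrier G. \<exists>f\<in>rep_hom (H \<inter> conj_set G g H) R (conj_rep G g R). \<exists>x\<in>rspace R. f x \<noteq> 0}"

text \<open>
  Compact induction from \<open>H\<close> to \<open>K\<close>. Functions on \<open>K\<close> are extended by zero to the whole type,
  so that the zero function is the only representative of zero.
\<close>

definition compact_ind ::
    "('g, 'm) monoid_scheme \<Rightarrow> 'g topology \<Rightarrow> 'g set \<Rightarrow> 'g set \<Rightarrow> ('g, 'v::ab_group_add) rep \<Rightarrow>
     ('g, 'g \<Rightarrow> 'v) rep" where
  "compact_ind G T H K R =
     \<lparr>rspace = {f.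
        (\<forall>x. x \<notin> K \<longrightarrow> f x = 0) \<and>
        (\<forall>x\<in>K. f x \<in> rspace R) \<and>
        (\<forall>h\<in>H. \<forall>x\<in>K. f (h \<otimes>\<^bsub>G\<^esub> x) = ract R h (f x)) \<and>
        (\<exists>U. subgroup U G \<and> U \<subseteq> K \<and> openin (subtopology T K) U \<and>
             (\<forall>u\<in>U. \<forall>x\<in>K. f (x \<otimes>\<^bsub>G\<^esub> u) = f x)) \<and>
        compact_mod G T H {x \<in> K. f x \<noteq> 0}},
      rscale = (\<lambda>c f x. rscale R c (f x)),
      ract = (\<lambda>k f x. if x \<in> K then f (x \<otimes>\<^bsub>G\<^esub> k) else 0)\<rparr>"

definition irreducible_decomposition ::
    "('g, 'm) monoid_scheme \<Rightarrow> 'g topology \<Rightarrow> 'g set \<Rightarrow> ('g, 'v::ab_group_add) rep \<Rightarrow> 'v set set \<Rightarrow> bool" where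
  "irreducible_decomposition G T H R \<W> \<longleftrightarrow>
     (\<forall>W\<in>\<W>. invariant_subspace H R W \<and> irreducible_rep G T H (subrep R W)) \<and>
     module.span (rscale R) (\<Union>\<W>) = rspace R \<and>
     (\<forall>W\<in>\<W>. W \<inter> module.span (rscale R) (\<Union>(\<W> - {W})) = {0})"

text \<open>
  For a representation whose restriction to \<open>H\<close> is semisimple with all irreducible constituents
  of the same multiplicity, this is that common multiplicity.
\<close>

definition multiplicity_on ::
    "('g, 'm) monoid_scheme \<Rightarrow> 'g topology \<Rightarrow> 'g set \<Rightarrow> ('g, 'v::ab_group_add) rep \<Rightarrow> nat" where
  "multiplicity_on G T H R =
     (THE m. \<exists>\<W>. irreducible_decomposition G T H R \<W> \<and>
        (\<forall>W\<in>\<W>. finite {W' \<in> \<W>. rep_iso H (subrep R W') (subrep R W)} \<and>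
                 card {W' \<in> \<W>. rep_iso H (subrep R W') (subrep R W)} = m))"


section \<open>Weakly cuspidal pairs\<close>

definition cuspidal_datum ::
    "('g, 'm) monoid_scheme \<Rightarrow> 'g topology \<Rightarrow> 'g set \<Rightarrow> 'g set \<Rightarrow>
     'g set \<Rightarrow> ('g, 'v::ab_group_add) rep \<Rightarrow> 'g set \<Rightarrow> ('g, 'w::ab_group_add) rep \<Rightarrow> bool" where
  "cuspidal_datum G T Z Gb J \<rho> Jt \<rho>t \<longleftrightarrow>
     open_compact_subgroup G T J \<and> irreducible_rep G T J \<rho> \<and>
     open_compact_mod_subgroup G T Z Jt \<and> J = Jt \<inter> Gb \<and>
     irreducible_rep G T Jt \<rho>t \<and> rep_contains J \<rho>t \<rho> \<and>
     intertwining_set G Jt \<rho>t = Jt"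

definition weakly_cuspidal_datum ::
    "('g, 'm) monoid_scheme \<Rightarrow> 'g topology \<Rightarrow> 'g set \<Rightarrow> 'g set \<Rightarrow>
     'g set \<Rightarrow> ('g, 'v::ab_group_add) rep \<Rightarrow> 'g set \<Rightarrow> ('g, 'w::ab_group_add) rep \<Rightarrow> bool" where
  "weakly_cuspidal_datum G T Z Gb J \<rho> Jt \<rho>t \<longleftrightarrow>
     cuspidal_datum G T Z Gb J \<rho> Jt \<rho>t \<and> intertwining_set G J \<rho> \<subseteq> Jt"

end

theory Submission
  imports Defs "HOL-Algebra.Zassenhaus"
begin

text \<open>
  Write \<open>N\<close> for the open normal subgroup \<open>Gb\<close> and \<open>\<sigma>\<close> for \<open>\<rho>t\<close>, so that \<open>J = Jt \<inter> N\<close>, and let \<open>K\<close>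
  be any subgroup containing \<open>N\<close> and \<open>Jt\<close>; the two cases of interest are \<open>K = G\<close> and
  \<open>K = N Jt\<close>. The point is that the restriction to \<open>N\<close> of \<open>V = ind\<^bsub>Jt\<^esub>\<^bsup>K\<^esup> \<sigma>\<close> always has the same
  multiplicity as the restriction of \<open>\<sigma>\<close> to \<open>J\<close>, whatever \<open>K\<close> is.

  By Mackey, restricting \<open>V\<close> to \<open>N\<close> splits it along the double cosets \<open>Jt N x\<close> in \<open>K\<close>. If
  \<open>\<sigma>\<close> restricted to \<open>J\<close> is the direct sum of irreducible subspaces \<open>W \<in> \<W>\<close>, then \<open>V\<close> is the
  direct sum of the spaces \<open>component x W\<close>, consisting of the functions supported on \<open>Jt N x\<close> with
  values in \<open>W\<close> along \<open>N x\<close>; this is the conjugate by \<open>x\<close> of \<open>ind\<^bsub>J\<^esub>\<^bsup>N\<^esup> W\<close>.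

  Since \<open>\<sigma>\<close> is irreducible and contains \<open>\<rho>\<close>, the family \<open>\<W>\<close> can be taken among the translates of
  a copy of \<open>\<rho>\<close>, so every member is a \<open>Jt\<close>-conjugate of \<open>\<rho>\<close>. Weak cuspidality then says that an
  element of \<open>G\<close> that intertwines two members of \<open>\<W>\<close> lies in \<open>Jt\<close>
  (\<open>translates_cuspidal\<close>). Evaluating a homomorphism into a component at a point of \<open>N y\<close> produces
  such intertwining operators (\<open>evaluation_intertwines\<close>), and this has two consequences.
  First, each component is irreducible (\<open>irreducible_component\<close>): averaging over the compact
  group \<open>J\<close> finds inside a nonzero subrepresentation a \<open>J\<close>-equivariant copy of \<open>W\<close>, whose
  elements must be supported on the single coset \<open>Jt x\<close> and hence generate the component. Second,
  \<open>component x W\<close> and \<open>component y W'\<close> are isomorphic exactly when \<open>x\<close> and \<open>y\<close> represent the same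
  double coset and \<open>W\<close>, \<open>W'\<close> are isomorphic as representations of \<open>J\<close>. So the constituents of
  \<open>V\<close> isomorphic to \<open>component x W\<close> correspond one to one to the members of \<open>\<W>\<close> isomorphic to \<open>W\<close>.

  A multiplicity is defined through an arbitrary decomposition into irreducible subspaces. That any
  two decompositions give the same answer (\<open>uniform_multiplicity_transfer\<close>) is a Steinitz exchange
  argument for irreducible subspaces, carried out within one isotypic part. It covers infinite
  isotypic parts as well: all classes of constituents are finite of size \<open>m\<close> in one decomposition
  if and only if they are so in every other. Hence the equality of multiplicities reduces to the
  bijection between constituents for the two decompositions just described.
\<close>


section \<open>The topological group of rational points\<close>

lemma map_matrix_to_ac_mult:
  "map_matrix to_ac (A ** B) = map_matrix to_ac A ** map_matrix to_ac (B :: 'f::field ^ 'n ^ 'n)"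
  by (simp add: vec_eq_iff matrix_matrix_mult_def to_ac_sum)

lemma map_matrix_to_ac_mat_1: "map_matrix to_ac (mat 1 :: 'f::field ^ 'n ^ 'n) = mat 1"
  by (simp add: vec_eq_iff mat_def)

lemma det_map_matrix_to_ac: "det (map_matrix to_ac A) = to_ac (det (A :: 'f::field ^ 'n ^ 'n))"
  by (simp add: det_def to_ac_sum to_ac_prod)

text \<open>
  This makes the rational points invertible over the base field, so that the inverse of a
  rational point can be computed there and then extended.
\<close>
lemma invertible_map_matrix_to_ac_iff:
  "invertible (map_matrix to_ac A) \<longleftrightarrow> invertible (A :: 'f::field ^ 'n ^ 'n)"
  by (simp add: invertible_det_nz det_map_matrix_to_ac)

lemma inv_GL:
  assumes "A ** B = mat 1" "B ** A = mat 1"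
  shows "inv\<^bsub>GL\<^esub> A = (B :: 'a::field ^ 'n ^ 'n)"
proof -
  interpret group GL by (rule group_GL)
  show ?thesis
    by (rule inv_equality) (use assms in \<open>auto simp: GL_def invertible_def\<close>)
qed

lemma subgroup_rational_points:
  assumes "subgroup \<G> GL"
  shows "subgroup (rational_points \<G>) (GL :: ('f::field ^ 'n ^ 'n) monoid)"
proof -
  interpret H: subgroup \<G> GL by fact
  interpret GL: group "GL :: ('f ^ 'n ^ 'n) monoid" by (rule group_GL)
  have carrier: "A \<in> carrier GL" if "A \<in> rational_points \<G>" for A
    using that H.subset by (auto simp: rational_points_def GL_def invertible_map_matrix_to_ac_iff)
  show ?thesis
  proof (rule GL.subgroupI)
    show "rational_points \<G> \<noteq> {}"
      using H.one_closed
      by (auto simp: rational_points_def GL_def intro!: exI[of _ "mat 1"] simp: map_matrix_to_ac_mat_1)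
    show "inv\<^bsub>GL\<^esub> A \<in> rational_points \<G>" if A: "A \<in> rational_points \<G>" for A
    proof -
      obtain B where B: "A ** B = mat 1" "B ** A = mat 1"
        using carrier[OF A] by (auto simp: GL_def invertible_def)
      then have "inv\<^bsub>GL\<^esub> (map_matrix to_ac A) = map_matrix to_ac B"
        by (intro inv_GL) (simp_all flip: map_matrix_to_ac_mult add: map_matrix_to_ac_mat_1)
      moreover have "inv\<^bsub>GL\<^esub> A = B"
        using B by (rule inv_GL)
      ultimately show ?thesis
        using A H.m_inv_closed by (fastforce simp: rational_points_def)
    qed
    show "A \<otimes>\<^bsub>GL\<^esub> B \<in> rational_points \<G>" if "A \<in> rational_points \<G>" "B \<in> rational_points \<G>" for A B
      using that H.m_closed by (auto simp: rational_points_def GL_def map_matrix_to_ac_mult)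
  qed (use carrier in auto)
qed

text \<open>
  The compatibility of group and topology that smooth representations rest on: translates of
  open sets are open.
\<close>
locale translation_group = group G for G (structure) +
  fixes T :: "'a topology"
  assumes topspace_eq: "topspace T = carrier G"
    and open_left_translate: "openin T U \<Longrightarrow> g \<in> carrier G \<Longrightarrow> openin T ((\<lambda>x. g \<otimes> x) ` U)"
    and open_right_translate: "openin T U \<Longrightarrow> g \<in> carrier G \<Longrightarrow> openin T ((\<lambda>x. x \<otimes> g) ` U)"

context nonarch_local_field
begin

lemma topspace_field_topology: "topspace (field_topology v) = UNIV"
  by (simp add: field_topology_def)

lemma continuous_map_field_iff:
  "continuous_map S (field_topology v) f \<longleftrightarrow>
     (\<forall>x\<in>topspace S. \<forall>e>0. \<exists>U. openin S U \<and> x \<in> U \<and> (\<forall>y\<in>U. v (f x - f y) < e))"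
  by (simp add: field_topology_def metric.continuous_map_to_metric)

lemma continuous_map_field_add:
  assumes "continuous_map S (field_topology v) f" "continuous_map S (field_topology v) g"
  shows "continuous_map S (field_topology v) (\<lambda>x. f x + g x)"
  unfolding continuous_map_field_iff
proof (intro ballI allI impI)
  fix x and e :: real
  assume x: "x \<in> topspace S" "e > 0"
  obtain U where U: "openin S U" "x \<in> U" "\<forall>y\<in>U. v (f x - f y) < e"
    using assms(1) x unfolding continuous_map_field_iff by blast
  obtain V where V: "openin S V" "x \<in> V" "\<forall>y\<in>V. v (g x - g y) < e"
    using assms(2) x unfolding continuous_map_field_iff by blast
  have "v (f x + g x - (f y + g y)) < e" if "y \<in> U \<inter> V" for y
    using ultrametric[of "f x - f y" "g x - g y"] U(3) V(3) that
    by (smt (verit) IntD1 IntD2 add_diff_add)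
  then show "\<exists>U. openin S U \<and> x \<in> U \<and> (\<forall>y\<in>U. v (f x + g x - (f y + g y)) < e)"
    using U V by (intro exI[of _ "U \<inter> V"]) auto
qed

lemma continuous_map_field_mult_const:
  assumes "continuous_map S (field_topology v) f"
  shows "continuous_map S (field_topology v) (\<lambda>x. c * f x)"
proof (cases "c = 0")
  case False
  then have c: "v c > 0"
    using nonneg[of c] eq_0_iff[of c] by simp
  show ?thesis
    unfolding continuous_map_field_iff
  proof (intro ballI allI impI)
    fix x and e :: real
    assume x: "x \<in> topspace S" "e > 0"
    then obtain U where U: "openin S U" "x \<in> U" "\<forall>y\<in>U. v (f x - f y) < e / v c"
      using assms c unfolding continuous_map_field_iff by (meson divide_pos_pos)
    have "v (c * f x - c * f y) < e" if "y \<in> U" for y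
    proof -
      have "v (c * f x - c * f y) = v c * v (f x - f y)"
        by (simp flip: mult add: right_diff_distrib)
      also have "\<dots> < v c * (e / v c)"
        using U(3) that c by (intro mult_strict_left_mono) auto
      finally show ?thesis using c by simp
    qed
    then show "\<exists>U. openin S U \<and> x \<in> U \<and> (\<forall>y\<in>U. v (c * f x - c * f y) < e)"
      using U by blast
  qed
qed (simp add: topspace_field_topology)

lemma continuous_map_field_sum:
  assumes "\<And>i. i \<in> I \<Longrightarrow> continuous_map S (field_topology v) (f i)"
  shows "continuous_map S (field_topology v) (\<lambda>x. \<Sum>i\<in>I. f i x)"
  using assms
  by (induction I rule: infinite_finite_induct)
     (auto simp: topspace_field_topology intro!: continuous_map_field_add)

lemma topspace_matrix_topology: "topspace (matrix_topology v) = UNIV"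
  by (auto simp: matrix_topology_def topspace_pullback_topology topspace_field_topology)

lemma continuous_map_matrix_entry:
  "continuous_map (matrix_topology v) (field_topology v) (\<lambda>A :: 'f ^ 'n ^ 'n. A $ i $ j)"
proof -
  have "continuous_map (matrix_topology v) (field_topology v)
          ((\<lambda>h. h (i, j)) \<circ> (\<lambda>A. \<lambda>(i, j). (A :: 'f ^ 'n ^ 'n) $ i $ j))"
    unfolding matrix_topology_def
    by (rule continuous_map_pullback) (rule continuous_map_product_projection, simp)
  then show ?thesis by (simp add: o_def)
qed

lemma continuous_map_matrix:
  assumes "\<And>i j. continuous_map S (field_topology v) (\<lambda>x. (f x :: 'f ^ 'n ^ 'n) $ i $ j)"
  shows "continuous_map S (matrix_topology v) f"
  unfolding matrix_topology_def
proof (rule continuous_map_pullback')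
  show "continuous_map S (product_topology (\<lambda>_. field_topology v) UNIV)
          ((\<lambda>A. \<lambda>(i, j). (A :: 'f ^ 'n ^ 'n) $ i $ j) \<circ> f)"
    using assms by (auto simp: continuous_map_componentwise_UNIV)
qed simp

lemma continuous_map_matrix_mult:
  "continuous_map (matrix_topology v) (matrix_topology v) (\<lambda>A. B ** A :: 'f ^ 'n ^ 'n)"
  "continuous_map (matrix_topology v) (matrix_topology v) (\<lambda>A. A ** B :: 'f ^ 'n ^ 'n)"
proof -
  show "continuous_map (matrix_topology v) (matrix_topology v) (\<lambda>A. B ** A :: 'f ^ 'n ^ 'n)"
    by (rule continuous_map_matrix, simp add: matrix_matrix_mult_def)
       (intro continuous_map_field_sum continuous_map_field_mult_const continuous_map_matrix_entry)
  show "continuous_map (matrix_topology v) (matrix_topology v) (\<lambda>A. A ** B :: 'f ^ 'n ^ 'n)"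
    by (rule continuous_map_matrix, simp add: matrix_matrix_mult_def, subst mult.commute)
       (intro continuous_map_field_sum continuous_map_field_mult_const continuous_map_matrix_entry)
qed

text \<open>
  The entries of a product with a fixed matrix are linear combinations of entries, and the
  ultrametric inequality makes those continuous.
\<close>
theorem translation_group_rational_group:
  assumes "closed_subgroup (\<G> :: ('f alg_closure ^ 'n ^ 'n) set)"
  shows "translation_group (rational_group \<G>) (rational_topology v \<G>)"
proof -
  have sub: "subgroup (rational_points \<G>) (GL :: ('f ^ 'n ^ 'n) monoid)"
    using assms by (simp add: closed_subgroup_def subgroup_rational_points)
  interpret group "rational_group \<G>"
    unfolding rational_group_def using group.subgroup_imp_group[OF group_GL sub] .
  let ?G = "rational_group \<G>" and ?T = "rational_topology v \<G>"
  have carrier: "carrier ?G = rational_points \<G>" and mult: "x \<otimes>\<^bsub>?G\<^esub> y = x ** y" for x y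
    by (simp_all add: rational_group_def GL_def)
  have topspace: "topspace ?T = carrier ?G"
    by (simp add: rational_topology_def topspace_matrix_topology carrier)
  have cont: "continuous_map ?T ?T (\<lambda>x. g \<otimes>\<^bsub>?G\<^esub> x)" "continuous_map ?T ?T (\<lambda>x. x \<otimes>\<^bsub>?G\<^esub> g)"
    if "g \<in> carrier ?G" for g
    using that m_closed[unfolded mult carrier]
      continuous_map_from_subtopology[OF continuous_map_matrix_mult(1), of "rational_points \<G>" g]
      continuous_map_from_subtopology[OF continuous_map_matrix_mult(2), of "rational_points \<G>" g]
    by (simp_all add: rational_topology_def continuous_map_in_subtopology mult carrier
        topspace_matrix_topology image_subset_iff Pi_iff)
  \<comment> \<open>A translate of \<open>U\<close> is the preimage of \<open>U\<close> under the translation by the inverse.\<close>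
  show ?thesis
  proof
    show "topspace ?T = carrier ?G" by (rule topspace)
  next
    fix U g assume U: "openin ?T U" and g: "g \<in> carrier ?G"
    then have sub: "U \<subseteq> carrier ?G"
      using openin_subset topspace by blast
    have "(\<lambda>x. g \<otimes>\<^bsub>?G\<^esub> x) ` U = {x \<in> topspace ?T. inv\<^bsub>?G\<^esub> g \<otimes>\<^bsub>?G\<^esub> x \<in> U}"
    proof (intro equalityI subsetI)
      fix y assume "y \<in> {x \<in> topspace ?T. inv\<^bsub>?G\<^esub> g \<otimes>\<^bsub>?G\<^esub> x \<in> U}"
      then show "y \<in> (\<lambda>x. g \<otimes>\<^bsub>?G\<^esub> x) ` U"
        using g by (intro image_eqI[of _ _ "inv\<^bsub>?G\<^esub> g \<otimes>\<^bsub>?G\<^esub> y"]) (auto simp: topspace m_assoc[symmetric])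
    qed (use g sub in \<open>auto simp: topspace m_assoc[symmetric] subset_iff\<close>)
    then show "openin ?T ((\<lambda>x. g \<otimes>\<^bsub>?G\<^esub> x) ` U)"
      using openin_continuous_map_preimage[OF cont(1) U] g by simp
    have "(\<lambda>x. x \<otimes>\<^bsub>?G\<^esub> g) ` U = {x \<in> topspace ?T. x \<otimes>\<^bsub>?G\<^esub> inv\<^bsub>?G\<^esub> g \<in> U}"
    proof (intro equalityI subsetI)
      fix y assume "y \<in> {x \<in> topspace ?T. x \<otimes>\<^bsub>?G\<^esub> inv\<^bsub>?G\<^esub> g \<in> U}"
      then show "y \<in> (\<lambda>x. x \<otimes>\<^bsub>?G\<^esub> g) ` U"
        using g by (intro image_eqI[of _ _ "y \<otimes>\<^bsub>?G\<^esub> inv\<^bsub>?G\<^esub> g"]) (auto simp: topspace m_assoc)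
    qed (use g sub in \<open>auto simp: topspace m_assoc subset_iff\<close>)
    then show "openin ?T ((\<lambda>x. x \<otimes>\<^bsub>?G\<^esub> g) ` U)"
      using openin_continuous_map_preimage[OF cont(2) U] g by simp
  qed
qed

end

section \<open>Representations and homomorphisms\<close>

lemma rspace_subrep [simp]: "rspace (subrep R W) = W"
  and rscale_subrep [simp]: "rscale (subrep R W) = rscale R"
  and ract_subrep [simp]: "ract (subrep R W) = ract R"
  by (simp_all add: subrep_def)

lemma rep_homI:
  assumes "\<And>x. x \<in> rspace R \<Longrightarrow> f x \<in> rspace S"
    and "\<And>x y. x \<in> rspace R \<Longrightarrow> y \<in> rspace R \<Longrightarrow> f (x + y) = f x + f y"
    and "\<And>c x. x \<in> rspace R \<Longrightarrow> f (rscale R c x) = rscale S c (f x)"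
    and "\<And>h x. h \<in> H \<Longrightarrow> x \<in> rspace R \<Longrightarrow> f (ract R h x) = ract S h (f x)"
  shows "f \<in> rep_hom H R S"
  using assms by (simp add: rep_hom_def)

lemma rep_homD:
  assumes "f \<in> rep_hom H R S"
  shows "x \<in> rspace R \<Longrightarrow> f x \<in> rspace S"
    and "x \<in> rspace R \<Longrightarrow> y \<in> rspace R \<Longrightarrow> f (x + y) = f x + f y"
    and "x \<in> rspace R \<Longrightarrow> f (rscale R c x) = rscale S c (f x)"
    and "h \<in> H \<Longrightarrow> x \<in> rspace R \<Longrightarrow> f (ract R h x) = ract S h (f x)"
  using assms by (auto simp: rep_hom_def)

lemma rep_hom_compose:
  "f \<in> rep_hom H R S \<Longrightarrow> g \<in> rep_hom H S P \<Longrightarrow> (\<lambda>x. g (f x)) \<in> rep_hom H R P"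
  by (auto simp: rep_hom_def)

lemma rep_iso_refl: "rep_iso H R R"
  unfolding rep_iso_def by (rule bexI[of _ "\<lambda>x. x"]) (auto simp: rep_hom_def bij_betw_def)

lemma rep_iso_trans: "rep_iso H R S \<Longrightarrow> rep_iso H S P \<Longrightarrow> rep_iso H R P"
proof -
  assume "rep_iso H R S" "rep_iso H S P"
  then obtain f g where "f \<in> rep_hom H R S" "bij_betw f (rspace R) (rspace S)"
    "g \<in> rep_hom H S P" "bij_betw g (rspace S) (rspace P)"
    by (auto simp: rep_iso_def)
  then show ?thesis
    unfolding rep_iso_def
    using rep_hom_compose[of f H R S g P] bij_betw_trans[of f _ _ g] by (auto simp: o_def)
qed

text \<open>
  A smooth representation of the subset \<open>H\<close> of \<open>G\<close> brings the linear algebra of its ambient vector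
  space into scope; subrepresentations are then handled as subspaces.
\<close>
locale smooth_representation =
  fixes G :: "('g, 'm) monoid_scheme" and T :: "'g topology" and H :: "'g set"
    and R :: "('g, 'v::ab_group_add) rep"
  assumes smooth: "smooth_rep G T H R"
begin

sublocale vector_space "rscale R"
  using smooth by (simp add: smooth_rep_def)

lemma subspace_rspace: "subspace (rspace R)"
  and act_closed: "h \<in> H \<Longrightarrow> x \<in> rspace R \<Longrightarrow> ract R h x \<in> rspace R"
  and act_add: "h \<in> H \<Longrightarrow> x \<in> rspace R \<Longrightarrow> y \<in> rspace R \<Longrightarrow>
    ract R h (x + y) = ract R h x + ract R h y"
  and act_scale: "h \<in> H \<Longrightarrow> x \<in> rspace R \<Longrightarrow> ract R h (rscale R c x) = rscale R c (ract R h x)"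
  and act_one: "x \<in> rspace R \<Longrightarrow> ract R \<one>\<^bsub>G\<^esub> x = x"
  and act_mult: "g \<in> H \<Longrightarrow> h \<in> H \<Longrightarrow> x \<in> rspace R \<Longrightarrow>
    ract R (g \<otimes>\<^bsub>G\<^esub> h) x = ract R g (ract R h x)"
  and stabilizer_open: "x \<in> rspace R \<Longrightarrow> openin (subtopology T H) {h \<in> H. ract R h x = x}"
  using smooth by (auto simp: smooth_rep_def)

lemma act_zero: "h \<in> H \<Longrightarrow> ract R h 0 = 0"
  using act_scale[of h 0 0] subspace_0[OF subspace_rspace] by simp

lemma act_sum:
  assumes "h \<in> H" "\<And>i. i \<in> I \<Longrightarrow> f i \<in> rspace R"
  shows "ract R h (\<Sum>i\<in>I. f i) = (\<Sum>i\<in>I. ract R h (f i))"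
  using assms(2)
proof (induction I rule: infinite_finite_induct)
  case (insert i I)
  then have "(\<Sum>i\<in>I. f i) \<in> rspace R"
    by (intro subspace_sum subspace_rspace) auto
  then show ?case using insert assms(1) by (simp add: act_add)
qed (simp_all add: act_zero assms(1))

definition irred :: "'v set \<Rightarrow> bool" where
  "irred W \<longleftrightarrow> invariant_subspace H R W \<and> irreducible_rep G T H (subrep R W)"

lemma invariantD:
  assumes "invariant_subspace H R W"
  shows "subspace W" "W \<subseteq> rspace R" "h \<in> H \<Longrightarrow> x \<in> W \<Longrightarrow> ract R h x \<in> W"
  using assms by (auto simp: invariant_subspace_def)

lemma smooth_rep_subrep:
  assumes "invariant_subspace H R W"
  shows "smooth_rep G T H (subrep R W)"
proof -
  have W: "subspace W" "W \<subseteq> rspace R" "\<And>h x. h \<in> H \<Longrightarrow> x \<in> W \<Longrightarrow> ract R h x \<in> W"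
    using assms by (auto simp: invariant_subspace_def)
  show ?thesis
    unfolding smooth_rep_def
    using W vector_space_axioms
    by (auto simp: act_add act_scale act_one act_mult stabilizer_open subset_iff)
qed

lemma irred_iff:
  "irred W \<longleftrightarrow> invariant_subspace H R W \<and> W \<noteq> {0} \<and>
     (\<forall>W'. invariant_subspace H R W' \<longrightarrow> W' \<subseteq> W \<longrightarrow> W' = {0} \<or> W' = W)"
proof -
  have "invariant_subspace H (subrep R W) W' \<longleftrightarrow> invariant_subspace H R W' \<and> W' \<subseteq> W"
    if "invariant_subspace H R W" for W'
    using that by (auto simp: invariant_subspace_def)
  then show ?thesis
    unfolding irred_def irreducible_rep_def using smooth_rep_subrep by auto
qed

lemma irredD: "irred W \<Longrightarrow> invariant_subspace H R W" "irred W \<Longrightarrow> W \<noteq> {0}"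
  by (auto simp: irred_iff)

lemma invariant_inter:
  "invariant_subspace H R A \<Longrightarrow> invariant_subspace H R B \<Longrightarrow> invariant_subspace H R (A \<inter> B)"
  by (auto simp: invariant_subspace_def subspace_inter)

lemma invariant_span:
  assumes "\<And>S. S \<in> \<S> \<Longrightarrow> invariant_subspace H R S"
  shows "invariant_subspace H R (span (\<Union>\<S>))"
  unfolding invariant_subspace_def
proof (intro conjI ballI)
  show sub: "span (\<Union>\<S>) \<subseteq> rspace R"
    using assms by (intro span_minimal subspace_rspace) (auto simp: invariant_subspace_def)
  fix h x assume h: "h \<in> H" and x: "x \<in> span (\<Union>\<S>)"
  let ?P = "{x \<in> rspace R. ract R h x \<in> span (\<Union>\<S>)}"
  have "subspace ?P"
    using subspace_rspace h
    by (auto simp: subspace_def act_zero act_add act_scale span_zero span_add span_scale)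
  moreover have "\<Union>\<S> \<subseteq> ?P"
    using assms h unfolding invariant_subspace_def by (blast intro: span_base)
  ultimately have "span (\<Union>\<S>) \<subseteq> ?P"
    by (intro span_minimal)
  with x show "ract R h x \<in> span (\<Union>\<S>)" by auto
qed simp

lemma irred_dichotomy:
  "irred A \<Longrightarrow> invariant_subspace H R N \<Longrightarrow> A \<subseteq> N \<or> A \<inter> N = {0}"
  using invariant_inter[of A N] by (auto simp: irred_iff)

lemma irred_subset_of_common_vector:
  "irred A \<Longrightarrow> invariant_subspace H R N \<Longrightarrow> a \<in> A \<Longrightarrow> a \<in> N \<Longrightarrow> a \<noteq> 0 \<Longrightarrow> A \<subseteq> N"
  using irred_dichotomy by blast

lemma irred_nonzero:
  assumes "irred A"
  obtains a where "a \<in> A" "a \<noteq> 0"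
  using irredD[OF assms] subspace_0 invariantD(1) by blast

lemma irred_not_subset_iff:
  assumes "irred A" "invariant_subspace H R N"
  shows "\<not> A \<subseteq> N \<longleftrightarrow> A \<inter> N = {0}"
proof -
  obtain a where "a \<in> A" "a \<noteq> 0" using irred_nonzero[OF assms(1)] .
  with irred_dichotomy[OF assms] show ?thesis by blast
qed

lemma rep_iso_sym:
  assumes "rep_iso H R S"
  shows "rep_iso H S R"
proof -
  obtain f where f: "f \<in> rep_hom H R S" "bij_betw f (rspace R) (rspace S)"
    using assms by (auto simp: rep_iso_def)
  let ?g = "inv_into (rspace R) f"
  note fD = rep_homD[OF f(1)]
  have gf: "?g (f x) = x" if "x \<in> rspace R" for x
    using f(2) that by (simp add: bij_betw_def)
  have *: "\<exists>x\<in>rspace R. y = f x" if "y \<in> rspace S" for y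
    using f(2) that by (auto simp: bij_betw_def)
  have "?g \<in> rep_hom H S R"
  proof (rule rep_homI)
    fix x y assume xy: "x \<in> rspace S" "y \<in> rspace S"
    then show "?g x \<in> rspace R" using * gf by metis
    show "?g (x + y) = ?g x + ?g y"
      using *[OF xy(1)] *[OF xy(2)] fD(2) gf subspace_add[OF subspace_rspace] by metis
  next
    fix c x assume x: "x \<in> rspace S"
    show "?g (rscale S c x) = rscale R c (?g x)"
      using *[OF x] fD(3) gf subspace_scale[OF subspace_rspace] by metis
  next
    fix h x assume "h \<in> H" "x \<in> rspace S"
    then show "?g (ract S h x) = ract R h (?g x)"
      using * fD(4) gf act_closed by metis
  qed
  with bij_betw_inv_into[OF f(2)] show ?thesis
    by (auto simp: rep_iso_def)
qed

end

text \<open>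
  One half of Schur's lemma, since the image is invariant; the next lemma adds the half that
  concerns the kernel.
\<close>
lemma surjective_of_nonzero_hom:
  assumes R: "smooth_rep G T H R" and S: "irreducible_rep G T H S"
    and f: "f \<in> rep_hom H R S" and x: "x \<in> rspace R" "f x \<noteq> 0"
  shows "f ` rspace R = rspace S"
proof -
  interpret R: smooth_representation G T H R
    by unfold_locales (rule R)
  interpret S: smooth_representation G T H S
    using S by unfold_locales (simp add: irreducible_rep_def)
  note fD = rep_homD[OF f]
  have f0: "f 0 = 0"
    using fD(3)[of 0 0] R.subspace_0[OF R.subspace_rspace] by simp
  have "S.subspace (f ` rspace R)"
    unfolding S.subspace_def
  proof (intro conjI ballI allI)
    show "0 \<in> f ` rspace R"
      using f0 R.subspace_0[OF R.subspace_rspace] by force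
    fix a b assume "a \<in> f ` rspace R" "b \<in> f ` rspace R"
    then show "a + b \<in> f ` rspace R"
      using R.subspace_add[OF R.subspace_rspace] by (auto simp flip: fD(2))
  next
    fix c a assume "a \<in> f ` rspace R"
    then show "rscale S c a \<in> f ` rspace R"
      using R.subspace_scale[OF R.subspace_rspace] by (auto simp flip: fD(3))
  qed
  then have "invariant_subspace H S (f ` rspace R)"
    unfolding invariant_subspace_def
    using fD(1) R.act_closed by (auto simp flip: fD(4))
  then show ?thesis
    using S x unfolding irreducible_rep_def by blast
qed

lemma rep_iso_of_nonzero_hom:
  assumes R: "irreducible_rep G T H R" and S: "irreducible_rep G T H S"
    and f: "f \<in> rep_hom H R S" and x: "x \<in> rspace R" "f x \<noteq> 0"
  shows "rep_iso H R S"
proof -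
  interpret R: smooth_representation G T H R
    using R by unfold_locales (simp add: irreducible_rep_def)
  interpret S: smooth_representation G T H S
    using S by unfold_locales (simp add: irreducible_rep_def)
  note fD = rep_homD[OF f]
  have f0: "f 0 = 0"
    using fD(3)[of 0 0] R.subspace_0[OF R.subspace_rspace] by simp
  have diff: "f (a - b) = f a - f b" if "a \<in> rspace R" "b \<in> rspace R" for a b
    using fD(2)[of "a - b" b] R.subspace_diff[OF R.subspace_rspace that] that by simp
  have "invariant_subspace H R {a \<in> rspace R. f a = 0}"
    unfolding invariant_subspace_def
    using R.subspace_rspace by (auto simp: R.subspace_def f0 fD S.act_zero R.act_closed)
  then have "{a \<in> rspace R. f a = 0} = {0}"
    using R x unfolding irreducible_rep_def by fastforce
  then have ker: "a = 0" if "a \<in> rspace R" "f a = 0" for a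
    using that by blast
  have "inj_on f (rspace R)"
  proof (rule inj_onI)
    fix a b assume "a \<in> rspace R" "b \<in> rspace R" "f a = f b"
    then show "a = b"
      using ker[of "a - b"] diff[of a b] R.subspace_diff[OF R.subspace_rspace] by simp
  qed
  then show ?thesis
    using f surjective_of_nonzero_hom[OF R.smooth S f x] by (auto simp: rep_iso_def bij_betw_def)
qed

lemma irreducible_rep_iso:
  assumes R: "irreducible_rep G T H R" and S: "smooth_rep G T H S" and iso: "rep_iso H R S"
  shows "irreducible_rep G T H S"
proof -
  interpret R: smooth_representation G T H R
    using R by unfold_locales (simp add: irreducible_rep_def)
  interpret S: smooth_representation G T H S
    by unfold_locales (rule S)
  obtain f where f: "f \<in> rep_hom H R S" and bij: "bij_betw f (rspace R) (rspace S)"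
    using iso by (auto simp: rep_iso_def)
  note fD = rep_homD[OF f] and inj = inj_onD[OF bij_betw_imp_inj_on[OF bij]]
  have R0: "0 \<in> rspace R" using R.subspace_0[OF R.subspace_rspace] .
  have f0: "f 0 = 0" using fD(2)[OF R0 R0] by simp
  have "W = {0} \<or> W = rspace S" if W: "invariant_subspace H S W" for W
  proof -
    note iW = S.invariantD[OF W]
    let ?P = "{x \<in> rspace R. f x \<in> W}"
    have img: "f ` ?P = W"
    proof
      show "W \<subseteq> f ` ?P"
      proof
        fix y assume y: "y \<in> W"
        then have "y \<in> f ` rspace R" using iW(2) bij_betw_imp_surj_on[OF bij] by blast
        then show "y \<in> f ` ?P" using y by blast
      qed
    qed auto
    have "R.subspace ?P"
      using R.subspace_rspace iW(1) by (auto simp: R.subspace_def S.subspace_def f0 fD(2,3))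
    then have "invariant_subspace H R ?P"
      using iW(3) R.act_closed by (auto simp: invariant_subspace_def fD(4))
    then have "?P = {0} \<or> ?P = rspace R"
      using R unfolding irreducible_rep_def by blast
    then have "f ` ?P = {f 0} \<or> f ` ?P = rspace S"
      using bij_betw_imp_surj_on[OF bij] by (elim disjE) simp_all
    then have "f ` ?P = {0} \<or> f ` ?P = rspace S"
      by (simp only: f0)
    then show ?thesis unfolding img .
  qed
  moreover have "rspace S \<noteq> {0}"
  proof
    assume S0: "rspace S = {0}"
    have "x = 0" if "x \<in> rspace R" for x
      using inj[of x 0] fD(1)[OF that] that R0 f0 S0 by simp
    then show False using R R0 unfolding irreducible_rep_def by blast
  qed
  ultimately show ?thesis using S by (simp add: irreducible_rep_def)
qed

section \<open>Uniqueness and existence of irreducible decompositions\<close>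

context smooth_representation
begin

text \<open>
  The exchange property of a matroid, with irreducible subspaces in the role of points: if \<open>a \<in> A\<close>
  is the sum of \<open>b \<in> B\<close> and an element \<open>n\<close> of the span of \<open>\<S>\<close> and is not itself in that span, then
  \<open>b = a - n\<close> is a nonzero vector of \<open>B\<close> in the span of \<open>A\<close> and \<open>\<S>\<close>, so all of \<open>B\<close> lies there.
\<close>
lemma exchange:
  assumes inv: "\<And>S. S \<in> \<S> \<Longrightarrow> invariant_subspace H R S" and A: "irred A" and B: "irred B"
    and sub: "A \<subseteq> span (\<Union>(insert B \<S>))" and nsub: "\<not> A \<subseteq> span (\<Union>\<S>)"
  shows "B \<subseteq> span (\<Union>(insert A \<S>))"
proof -
  obtain a where a: "a \<in> A" "a \<notin> span (\<Union>\<S>)"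
    using nsub by blast
  have "a \<in> span (B \<union> \<Union>\<S>)"
    using a(1) sub by auto
  then obtain b n where bn: "b \<in> span B" "n \<in> span (\<Union>\<S>)" "a = b + n"
    by (auto simp: span_Un)
  have "b \<in> B"
    using bn(1) invariantD(1)[OF irredD(1)[OF B]] by (metis span_eq_iff)
  moreover have "b \<noteq> 0"
    using a(2) bn by auto
  moreover have "b \<in> span (\<Union>(insert A \<S>))"
  proof -
    have "n \<in> span (\<Union>(insert A \<S>))"
      using bn(2) span_mono[of "\<Union>\<S>" "\<Union>(insert A \<S>)"] by auto
    then show ?thesis
      using span_diff[OF span_base[of a "\<Union>(insert A \<S>)"]] a(1) bn(3) by fastforce
  qed
  moreover have "invariant_subspace H R (span (\<Union>(insert A \<S>)))"
    using inv irredD(1)[OF A] by (intro invariant_span) auto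
  ultimately show ?thesis
    using irred_subset_of_common_vector[OF B] by blast
qed

text \<open>
  For irreducible subspaces this says that their sum is direct. It is phrased by inclusions, which
  is the form in which the exchange property applies.
\<close>
definition independent_family :: "'v set set \<Rightarrow> bool" where
  "independent_family \<S> \<longleftrightarrow> (\<forall>A\<in>\<S>. \<not> A \<subseteq> span (\<Union>(\<S> - {A})))"

lemma independent_family_mono:
  assumes "independent_family \<B>" "\<A> \<subseteq> \<B>"
  shows "independent_family \<A>"
proof -
  have "span (\<Union>(\<A> - {A})) \<subseteq> span (\<Union>(\<B> - {A}))" for A
    using assms(2) by (intro span_mono) auto
  with assms show ?thesis
    unfolding independent_family_def by blast
qed

lemma independent_family_insert:
  assumes \<C>: "independent_family \<C>" "\<And>C. C \<in> \<C> \<Longrightarrow> irred C"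
    and B: "irred B" "\<not> B \<subseteq> span (\<Union>\<C>)"
  shows "independent_family (insert B \<C>)"
  unfolding independent_family_def
proof
  have BC: "B \<notin> \<C>"
    using B(2) span_superset[of "\<Union>\<C>"] by blast
  fix C assume C: "C \<in> insert B \<C>"
  show "\<not> C \<subseteq> span (\<Union>(insert B \<C> - {C}))"
  proof (cases "C = B")
    case True
    with B(2) BC show ?thesis by simp
  next
    case False
    then have CC: "C \<in> \<C>" using C by blast
    then have "\<not> C \<subseteq> span (\<Union>(\<C> - {C}))"
      using \<C>(1) by (auto simp: independent_family_def)
    moreover have "\<And>Y. Y \<in> \<C> - {C} \<Longrightarrow> invariant_subspace H R Y"
      using \<C>(2) irredD(1) by blast
    moreover have "insert C (\<C> - {C}) = \<C>" "insert B \<C> - {C} = insert B (\<C> - {C})"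
      using CC False by auto
    ultimately show ?thesis
      using exchange[of "\<C> - {C}" C B] \<C>(2)[OF CC] B by auto
  qed
qed

text \<open>
  Steinitz: as long as \<open>\<A>\<close> is not contained in \<open>\<B>\<close>, one of its members outside \<open>\<B>\<close> can be replaced
  by a member of \<open>\<B>\<close> without losing independence.
\<close>
lemma card_le_of_span:
  assumes "finite \<A>" "finite \<B>" "\<forall>A\<in>\<A>. irred A" "\<forall>B\<in>\<B>. irred B" "independent_family \<A>"
    and "\<forall>A\<in>\<A>. A \<subseteq> span (\<Union>\<B>)"
  shows "card \<A> \<le> card \<B>"
  using assms
proof (induction "card (\<A> - \<B>)" arbitrary: \<A> rule: less_induct)
  case less
  show ?case
  proof (cases "\<A> \<subseteq> \<B>")
    case True
    then show ?thesis using less.prems by (simp add: card_mono)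
  next
    case False
    then obtain A where A: "A \<in> \<A>" "A \<notin> \<B>" by blast
    define \<C> where "\<C> = \<A> - {A}"
    have nA: "\<not> A \<subseteq> span (\<Union>\<C>)"
      using less.prems(5) A(1) by (auto simp: independent_family_def \<C>_def)
    have "\<exists>B\<in>\<B>. \<not> B \<subseteq> span (\<Union>\<C>)"
    proof (rule ccontr)
      assume "\<not> (\<exists>B\<in>\<B>. \<not> B \<subseteq> span (\<Union>\<C>))"
      then have "span (\<Union>\<B>) \<subseteq> span (\<Union>\<C>)"
        by (intro span_minimal) auto
      with nA A(1) less.prems(6) show False by blast
    qed
    \<comment> \<open>\<open>B\<close> takes the place of \<open>A\<close>, which brings \<open>\<A>\<close> closer to \<open>\<B>\<close>.\<close>
    then obtain B where B: "B \<in> \<B>" "\<not> B \<subseteq> span (\<Union>\<C>)" by blast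
    have BC: "B \<notin> \<C>"
      using B(2) span_superset[of "\<Union>\<C>"] by blast
    let ?A = "insert B \<C>"
    have irr: "\<forall>A\<in>?A. irred A"
      using less.prems B(1) by (auto simp: \<C>_def)
    have "independent_family \<C>"
      using independent_family_mono[OF less.prems(5)] by (simp add: \<C>_def)
    then have "independent_family ?A"
      using irr B(2) by (intro independent_family_insert) auto
    moreover have "?A - \<B> \<subset> \<A> - \<B>"
      using A B(1) by (auto simp: \<C>_def)
    then have "card (?A - \<B>) < card (\<A> - \<B>)"
      using less.prems(1) by (intro psubset_card_mono) auto
    moreover have "\<forall>A\<in>?A. A \<subseteq> span (\<Union>\<B>)"
      using less.prems(6) B(1) span_superset[of "\<Union>\<B>"] by (auto simp: \<C>_def)
    ultimately have "card ?A \<le> card \<B>"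
      using less irr by (intro less.hyps) (auto simp: \<C>_def)
    moreover have "card ?A = card \<A>"
      using BC A(1) less.prems(1) by (simp add: \<C>_def card_Suc_Diff1 del: card_Diff_insert)
    ultimately show ?thesis by simp
  qed
qed

lemma span_Union_finite_support:
  assumes "x \<in> span (\<Union>\<S>)"
  obtains \<F> where "finite \<F>" "\<F> \<subseteq> \<S>" "x \<in> span (\<Union>\<F>)"
proof -
  obtain t r where t: "finite t" "t \<subseteq> \<Union>\<S>" "x = (\<Sum>a\<in>t. rscale R (r a) a)"
    using assms by (auto simp: span_explicit)
  then obtain \<F> where \<F>: "finite \<F>" "\<F> \<subseteq> \<S>" "t \<subseteq> \<Union>\<F>"
    using finite_subset_Union by metis
  have "x \<in> span t"
    unfolding t(3) by (intro span_sum span_scale span_base)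
  then show ?thesis
    using that[OF \<F>(1,2)] span_mono[OF \<F>(3)] by blast
qed

text \<open>
  Both \<open>A\<close> and \<open>B\<close> project isomorphically to the quotient of \<open>B + N\<close> by \<open>N\<close>. The homomorphism
  sends \<open>a\<close> to its component in \<open>B\<close>; it is not zero because \<open>A\<close> meets \<open>N\<close> trivially.
\<close>
lemma rep_iso_of_common_complement:
  assumes A: "irred A" and B: "irred B" and N: "invariant_subspace H R N"
    and AN: "A \<inter> N = {0}" and BN: "B \<inter> N = {0}" and sub: "A \<subseteq> span (B \<union> N)"
  shows "rep_iso H (subrep R A) (subrep R B)"
proof -
  note iA = invariantD[OF irredD(1)[OF A]] and iB = invariantD[OF irredD(1)[OF B]]
    and iN = invariantD[OF N]
  have ex: "\<exists>b\<in>B. a - b \<in> N" if "a \<in> A" for a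
  proof -
    have "a \<in> span (B \<union> N)" using sub that by blast
    then obtain b n where "b \<in> span B" "n \<in> span N" "a = b + n"
      by (auto simp: span_Un)
    moreover have "span B = B" "span N = N"
      using iB(1) iN(1) by (simp_all add: span_eq_iff)
    ultimately show ?thesis by (intro bexI[of _ b]) auto
  qed
  have uniq: "b = b'" if "b \<in> B" "b' \<in> B" "a - b \<in> N" "a - b' \<in> N" for a b b'
  proof -
    have "b - b' \<in> B \<inter> N"
      using subspace_diff[OF iB(1) that(1,2)] subspace_diff[OF iN(1) that(4,3)] by simp
    with BN show ?thesis by simp
  qed
  define f where "f a = (SOME b. b \<in> B \<and> a - b \<in> N)" for a
  have f: "f a \<in> B" "a - f a \<in> N" if "a \<in> A" for a
    using someI_ex[of "\<lambda>b. b \<in> B \<and> a - b \<in> N"] ex[OF that] by (auto simp: f_def)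
  have feq: "f a = b" if "a \<in> A" "b \<in> B" "a - b \<in> N" for a b
    using uniq[OF f(1)[OF that(1)] that(2) f(2)[OF that(1)] that(3)] .
  have "f \<in> rep_hom H (subrep R A) (subrep R B)"
  proof (rule rep_homI)
    fix x assume "x \<in> rspace (subrep R A)"
    then show "f x \<in> rspace (subrep R B)" using f by simp
  next
    fix x y assume "x \<in> rspace (subrep R A)" "y \<in> rspace (subrep R A)"
    then have xy: "x \<in> A" "y \<in> A" by simp_all
    have "x + y - (f x + f y) = (x - f x) + (y - f y)" by simp
    also have "\<dots> \<in> N" using f xy by (intro subspace_add[OF iN(1)]) auto
    finally show "f (x + y) = f x + f y"
      using f xy by (intro feq subspace_add[OF iA(1)] subspace_add[OF iB(1)])
  next
    fix c x assume "x \<in> rspace (subrep R A)"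
    then have x: "x \<in> A" by simp
    have "rscale R c x - rscale R c (f x) = rscale R c (x - f x)"
      by (simp add: scale_right_diff_distrib)
    also have "\<dots> \<in> N" using f x by (intro subspace_scale[OF iN(1)]) auto
    finally show "f (rscale (subrep R A) c x) = rscale (subrep R B) c (f x)"
      using f x by (auto intro!: feq subspace_scale[OF iA(1)] subspace_scale[OF iB(1)])
  next
    fix h x assume h: "h \<in> H" and "x \<in> rspace (subrep R A)"
    then have x: "x \<in> A" by simp
    have "ract R h x = ract R h ((x - f x) + f x)" by simp
    also have "\<dots> = ract R h (x - f x) + ract R h (f x)"
      using f[OF x] iN(2) iB(2) h by (intro act_add) auto
    finally have "ract R h x - ract R h (f x) \<in> N"
      using iN(3)[OF h] f(2)[OF x] by simp
    then show "f (ract (subrep R A) h x) = ract (subrep R B) h (f x)"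
      using f[OF x] h x iA(3) iB(3) by (auto intro!: feq)
  qed
  moreover obtain a where a: "a \<in> A" "a \<noteq> 0" using irred_nonzero[OF A] .
  moreover have "f a \<noteq> 0"
  proof
    assume "f a = 0"
    then have "a \<in> A \<inter> N" using f(2)[OF a(1)] a(1) by simp
    with AN a(2) show False by simp
  qed
  ultimately show ?thesis
    using A B by (intro rep_iso_of_nonzero_hom[where f = f and x = a and T = T and G = G]) (auto simp: irred_def)
qed

lemma irreducible_decomposition_iff:
  "irreducible_decomposition G T H R \<W> \<longleftrightarrow>
     (\<forall>W\<in>\<W>. irred W) \<and> span (\<Union>\<W>) = rspace R \<and> independent_family \<W>"
proof -
  have "\<not> W \<subseteq> span (\<Union>(\<W> - {W})) \<longleftrightarrow> W \<inter> span (\<Union>(\<W> - {W})) = {0}"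
    if "\<forall>W\<in>\<W>. irred W" "W \<in> \<W>" for W
    using that irredD(1) by (intro irred_not_subset_iff invariant_span) auto
  then show ?thesis
    unfolding irreducible_decomposition_def independent_family_def irred_def[symmetric]
    by (cases "\<forall>W\<in>\<W>. irred W") (simp, blast)
qed

text \<open>
  Choose a smallest finite subfamily whose sum contains \<open>A\<close>. For each of its members \<open>B\<close>,
  minimality makes the sum of the others a common complement of \<open>A\<close> and \<open>B\<close>, so \<open>B\<close> is isomorphic
  to \<open>A\<close>.
\<close>
lemma irred_subset_isotypic_part:
  assumes \<B>: "irreducible_decomposition G T H R \<B>" and A: "irred A"
  shows "A \<subseteq> span (\<Union>{B \<in> \<B>. rep_iso H (subrep R B) (subrep R A)})"
proof -
  have irr: "\<And>B. B \<in> \<B> \<Longrightarrow> irred B" and sp: "span (\<Union>\<B>) = rspace R"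
    and ind: "independent_family \<B>"
    using \<B> by (auto simp: irreducible_decomposition_iff)
  have inv: "invariant_subspace H R (span (\<Union>\<F>))" if "\<F> \<subseteq> \<B>" for \<F>
    using irr irredD(1) that by (intro invariant_span) auto
  let ?P = "\<lambda>\<F>. finite \<F> \<and> \<F> \<subseteq> \<B> \<and> A \<subseteq> span (\<Union>\<F>)"
  obtain a where a: "a \<in> A" "a \<noteq> 0" using irred_nonzero[OF A] .
  then have "a \<in> span (\<Union>\<B>)"
    using invariantD(2)[OF irredD(1)[OF A]] sp by auto
  then obtain \<F> where "finite \<F>" "\<F> \<subseteq> \<B>" "a \<in> span (\<Union>\<F>)"
    by (rule span_Union_finite_support)
  then have "?P \<F>"
    using irred_subset_of_common_vector[OF A inv] a by blast
  then obtain \<C> where \<C>: "?P \<C>" and min: "\<And>\<F>. ?P \<F> \<Longrightarrow> card \<C> \<le> card \<F>"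
    using ex_has_least_nat[of ?P \<F> card] by blast
  have "rep_iso H (subrep R B) (subrep R A)" if B: "B \<in> \<C>" for B
  proof -
    let ?N = "span (\<Union>(\<C> - {B}))"
    have N: "invariant_subspace H R ?N" using inv \<C> by blast
    have "\<not> A \<subseteq> ?N"
      using min[of "\<C> - {B}"] \<C> B card_Diff1_less[of \<C> B] by auto
    then have AN: "A \<inter> ?N = {0}" using irred_not_subset_iff[OF A N] by blast
    have "?N \<subseteq> span (\<Union>(\<B> - {B}))"
      using \<C> by (intro span_mono) auto
    moreover have "\<not> B \<subseteq> span (\<Union>(\<B> - {B}))"
      using ind \<C> B by (auto simp: independent_family_def)
    ultimately have BN: "B \<inter> ?N = {0}"
      using irred_not_subset_iff[OF irr N, of B] \<C> B by blast
    have "\<Union>\<C> \<subseteq> B \<union> ?N"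
      using span_superset[of "\<Union>(\<C> - {B})"] by blast
    then have "A \<subseteq> span (B \<union> ?N)"
      using \<C> span_mono by blast
    then have "rep_iso H (subrep R A) (subrep R B)"
      using rep_iso_of_common_complement[OF A irr N AN BN] \<C> B by blast
    moreover have "smooth_representation G T H (subrep R A)"
      using A by unfold_locales (simp add: irreducible_rep_def irred_def)
    ultimately show ?thesis
      using smooth_representation.rep_iso_sym by blast
  qed
  then have "\<Union>\<C> \<subseteq> \<Union>{B \<in> \<B>. rep_iso H (subrep R B) (subrep R A)}"
    using \<C> by blast
  then show ?thesis
    using \<C> span_mono by blast
qed

end

definition constituent_class ::
    "'g set \<Rightarrow> ('g, 'v::ab_group_add) rep \<Rightarrow> 'v set set \<Rightarrow> 'v set \<Rightarrow> 'v set set" where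
  "constituent_class H R \<W> W = {W' \<in> \<W>. rep_iso H (subrep R W') (subrep R W)}"

definition uniform_multiplicity ::
    "'g set \<Rightarrow> ('g, 'v::ab_group_add) rep \<Rightarrow> 'v set set \<Rightarrow> nat \<Rightarrow> bool" where
  "uniform_multiplicity H R \<W> m \<longleftrightarrow>
     (\<forall>W\<in>\<W>. finite (constituent_class H R \<W> W) \<and> card (constituent_class H R \<W> W) = m)"

context smooth_representation
begin

text \<open>
  The members isomorphic to \<open>A\<close> in the two decompositions span each other, so Steinitz bounds the
  size of each class by that of the other.
\<close>
lemma uniform_multiplicity_transfer:
  assumes \<A>: "irreducible_decomposition G T H R \<A>" and \<B>: "irreducible_decomposition G T H R \<B>"
    and m: "uniform_multiplicity H R \<B> m"
  shows "uniform_multiplicity H R \<A> m"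
  unfolding uniform_multiplicity_def
proof
  fix A assume "A \<in> \<A>"
  have irrA: "\<And>A. A \<in> \<A> \<Longrightarrow> irred A" and irrB: "\<And>B. B \<in> \<B> \<Longrightarrow> irred B"
    and ind: "independent_family \<A>" "independent_family \<B>"
    using \<A> \<B> by (auto simp: irreducible_decomposition_iff)
  have A: "irred A" using irrA \<open>A \<in> \<A>\<close> .
  have sym: "rep_iso H (subrep R C) (subrep R Y) \<Longrightarrow> rep_iso H (subrep R Y) (subrep R C)"
    if "irred C" for C Y
    using that smooth_representation.rep_iso_sym[of G T H "subrep R C" "subrep R Y"]
    by (auto simp: smooth_representation_def irred_def irreducible_rep_def)
  let ?a = "constituent_class H R \<A> A" and ?b = "constituent_class H R \<B> A"
  have in_part: "C \<subseteq> span (\<Union>(constituent_class H R \<D> A))"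
    if "irreducible_decomposition G T H R \<D>" "irred C" "rep_iso H (subrep R C) (subrep R A)" for C \<D>
  proof -
    have "{B \<in> \<D>. rep_iso H (subrep R B) (subrep R C)} \<subseteq> constituent_class H R \<D> A"
      using that(3) rep_iso_trans by (auto simp: constituent_class_def)
    then show ?thesis
      using irred_subset_isotypic_part[OF that(1,2)] span_mono Union_mono by blast
  qed
  have "?b \<noteq> {}"
  proof
    assume "?b = {}"
    then have "A \<subseteq> {0}" using in_part[OF \<B> A rep_iso_refl] by simp
    moreover obtain a where "a \<in> A" "a \<noteq> 0" using irred_nonzero[OF A] .
    ultimately show False by blast
  qed
  then obtain B where B: "B \<in> \<B>" "rep_iso H (subrep R B) (subrep R A)"
    by (auto simp: constituent_class_def)
  have "?b = constituent_class H R \<B> B"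
    using B irrB sym rep_iso_trans unfolding constituent_class_def by blast
  then have b: "finite ?b" "card ?b = m"
    using m B(1) by (auto simp: uniform_multiplicity_def)
  \<comment> \<open>Bounding the finite subsets also shows that the class in \<open>\<A>\<close> is finite.\<close>
  have le: "card F \<le> m" if "F \<subseteq> ?a" "finite F" for F
  proof -
    have "card F \<le> card ?b"
    proof (rule card_le_of_span[OF that(2) b(1)])
      show "independent_family F"
        using independent_family_mono[OF ind(1), of F] that(1) by (auto simp: constituent_class_def)
      show "\<forall>C\<in>F. C \<subseteq> span (\<Union>?b)"
        using in_part[OF \<B>] that(1) irrA by (auto simp: constituent_class_def)
    qed (use that irrA irrB in \<open>auto simp: constituent_class_def\<close>)
    with b show ?thesis by simp
  qed
  then have a: "finite ?a" "card ?a \<le> m"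
    using finite_if_finite_subsets_card_bdd[of ?a m] by auto
  have "card ?b \<le> card ?a"
  proof (rule card_le_of_span[OF b(1) a(1)])
    show "independent_family ?b"
      using independent_family_mono[OF ind(2), of ?b] by (auto simp: constituent_class_def)
    show "\<forall>C\<in>?b. C \<subseteq> span (\<Union>?a)"
      using in_part[OF \<A>] irrB by (auto simp: constituent_class_def)
  qed (use irrA irrB in \<open>auto simp: constituent_class_def\<close>)
  with a b show "finite ?a \<and> card ?a = m" by simp
qed

text \<open>
  The condition on \<open>m\<close> in the definition of the multiplicity can therefore be tested on any one
  decomposition. This holds also when no \<open>m\<close>, or more than one, satisfies it.
\<close>
theorem multiplicity_on_eq:
  assumes "irreducible_decomposition G T H R \<A>"
  shows "multiplicity_on G T H R = (THE m. uniform_multiplicity H R \<A> m)"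
proof -
  have "(\<exists>\<W>. irreducible_decomposition G T H R \<W> \<and> uniform_multiplicity H R \<W> m)
          \<longleftrightarrow> uniform_multiplicity H R \<A> m" for m
    using uniform_multiplicity_transfer[OF assms] assms by blast
  then show ?thesis
    by (simp add: multiplicity_on_def uniform_multiplicity_def constituent_class_def)
qed

text \<open>
  By Zorn there is a maximal independent subfamily of \<open>\<S>\<close>; an irreducible member of \<open>\<S>\<close> outside its
  span could be added to it.
\<close>
theorem irreducible_decomposition_exists:
  assumes irr: "\<And>S. S \<in> \<S> \<Longrightarrow> irred S" and sp: "span (\<Union>\<S>) = rspace R"
  obtains \<W> where "\<W> \<subseteq> \<S>" "irreducible_decomposition G T H R \<W>"
proof -
  have inv: "invariant_subspace H R (span (\<Union>\<F>))" if "\<F> \<subseteq> \<S>" for \<F>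
    using irr irredD(1) that by (intro invariant_span) auto
  let ?Z = "{\<W>. \<W> \<subseteq> \<S> \<and> independent_family \<W>}"
  have "\<exists>M\<in>?Z. \<forall>Y\<in>?Z. M \<subseteq> Y \<longrightarrow> Y = M"
  proof (rule subset_Zorn_nonempty)
    show "?Z \<noteq> {}"
      by (auto simp: independent_family_def)
    fix \<C> assume ne: "\<C> \<noteq> {}" and ch: "subset.chain ?Z \<C>"
    have "independent_family (\<Union>\<C>)"
      unfolding independent_family_def
    proof (intro ballI notI)
      fix A assume A: "A \<in> \<Union>\<C>" and sub: "A \<subseteq> span (\<Union>(\<Union>\<C> - {A}))"
      have AS: "irred A"
        using A ch irr by (auto simp: subset.chain_def)
      obtain a where a: "a \<in> A" "a \<noteq> 0" using irred_nonzero[OF AS] .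
      then obtain \<F> where \<F>: "finite \<F>" "\<F> \<subseteq> \<Union>\<C> - {A}" "a \<in> span (\<Union>\<F>)"
        using span_Union_finite_support sub by (metis subsetD)
      have "finite (insert A \<F>)" "insert A \<F> \<subseteq> \<Union>\<C>"
        using \<F> A by auto
      then obtain \<D> where \<D>: "\<D> \<in> \<C>" "insert A \<F> \<subseteq> \<D>"
        using finite_subset_Union_chain[OF _ _ ne ch] by metis
      then have ZD: "\<D> \<subseteq> \<S>" "independent_family \<D>"
        using ch by (auto simp: subset.chain_def)
      have "\<F> \<subseteq> \<D> - {A}"
        using \<D>(2) \<F>(2) by blast
      then have "a \<in> span (\<Union>(\<D> - {A}))"
        using \<F>(3) span_mono Union_mono by blast
      then have "A \<subseteq> span (\<Union>(\<D> - {A}))"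
        using irred_subset_of_common_vector[OF AS inv a(1) _ a(2)] ZD(1) by blast
      with ZD(2) \<D>(2) show False
        by (auto simp: independent_family_def)
    qed
    then show "\<Union>\<C> \<in> ?Z"
      using ch by (auto simp: subset.chain_def)
  qed
  then obtain M where M: "M \<subseteq> \<S>" "independent_family M"
    and max: "\<And>Y. Y \<subseteq> \<S> \<Longrightarrow> independent_family Y \<Longrightarrow> M \<subseteq> Y \<Longrightarrow> Y = M"
    by auto
  have "S \<subseteq> span (\<Union>M)" if S: "S \<in> \<S>" for S
  proof (rule ccontr)
    assume n: "\<not> S \<subseteq> span (\<Union>M)"
    then have SM: "S \<notin> M" using span_superset[of "\<Union>M"] by blast
    have "independent_family (insert S M)"
      using M irr S n by (intro independent_family_insert) auto
    then have "insert S M = M"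
      using max[of "insert S M"] M(1) S by blast
    with SM show False by blast
  qed
  then have "span (\<Union>\<S>) \<subseteq> span (\<Union>M)"
    by (intro span_minimal) auto
  moreover have "span (\<Union>M) \<subseteq> span (\<Union>\<S>)"
    using M(1) by (intro span_mono) auto
  ultimately have "irreducible_decomposition G T H R M"
    using M irr sp by (auto simp: irreducible_decomposition_iff)
  with M(1) show ?thesis by (rule that)
qed

end

section \<open>Averaging over an open compact subgroup\<close>

context translation_group
begin

lemma open_subset_carrier: "openin T U \<Longrightarrow> U \<subseteq> carrier G"
  using openin_subset topspace_eq by blast

lemma open_conj:
  assumes "openin T U" "g \<in> carrier G"
  shows "openin T ((\<lambda>x. g \<otimes> x \<otimes> inv g) ` U)"
  using open_right_translate[OF open_left_translate[OF assms], of "inv g"] assms(2)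
  by (simp add: image_image)

text \<open>
  Every openness claim about a stabilizer or a subgroup below is reduced to exhibiting an open
  neighbourhood of the identity inside it.
\<close>
lemma open_of_translates:
  assumes "S \<subseteq> carrier G"
    and "\<And>s. s \<in> S \<Longrightarrow> \<exists>U. openin T U \<and> \<one> \<in> U \<and> (\<lambda>x. s \<otimes> x) ` U \<subseteq> S"
  shows "openin T S"
proof (subst openin_subopen, intro ballI)
  fix s assume s: "s \<in> S"
  then obtain U where U: "openin T U" "\<one> \<in> U" "(\<lambda>x. s \<otimes> x) ` U \<subseteq> S"
    using assms(2) by blast
  moreover have "s \<in> (\<lambda>x. s \<otimes> x) ` U"
    using U(2) s assms(1) by (intro image_eqI[of _ _ \<one>]) auto
  ultimately show "\<exists>V. openin T V \<and> s \<in> V \<and> V \<subseteq> S"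
    using open_left_translate[OF U(1), of s] s assms(1) by blast
qed

text \<open>
  A function on a compact set that is invariant under right multiplication by an open neighbourhood
  of the identity is locally constant, hence takes finitely many values.
\<close>
lemma finite_image_of_compact:
  assumes J: "compactin T J" and N: "openin T N" "\<one> \<in> N"
    and t: "\<And>j n. j \<in> J \<Longrightarrow> n \<in> N \<Longrightarrow> t (j \<otimes> n) = t j"
  shows "finite (t ` J)"
proof -
  have JG: "J \<subseteq> carrier G"
    using compactin_subset_topspace[OF J] topspace_eq by simp
  let ?U = "(\<lambda>j. (\<lambda>x. j \<otimes> x) ` N) ` J"
  have "openin T U" if "U \<in> ?U" for U
    using that open_left_translate[OF N(1)] JG by auto
  moreover have "J \<subseteq> \<Union>?U"
  proof
    fix j assume "j \<in> J"
    then show "j \<in> \<Union>?U"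
      using N(2) JG by (auto intro!: bexI[of _ j] image_eqI[of _ _ \<one>])
  qed
  ultimately obtain \<F> where \<F>: "finite \<F>" "\<F> \<subseteq> ?U" "J \<subseteq> \<Union>\<F>"
    using J unfolding compactin_def by meson
  have "t ` J \<subseteq> (\<Union>C\<in>\<F>. t ` C)"
    using \<F>(3) by blast
  moreover have "finite (t ` C)" if "C \<in> \<F>" for C
  proof -
    obtain j where j: "j \<in> J" "C = (\<lambda>x. j \<otimes> x) ` N"
      using \<F>(2) \<open>C \<in> \<F>\<close> by blast
    then have "t ` C \<subseteq> {t j}"
      using t by auto
    then show ?thesis
      using finite_subset by blast
  qed
  ultimately show ?thesis
    using \<F>(1) by (meson finite_UN_I finite_subset)
qed

lemma stabilizer_open:
  assumes "smooth_rep G T J R" "openin T J" "x \<in> rspace R"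
  shows "openin T {j \<in> J. ract R j x = x}"
  using assms by (auto simp: smooth_rep_def openin_open_subtopology)

lemma finite_orbit:
  assumes R: "smooth_rep G T J R" and J: "subgroup J G" "openin T J" "compactin T J"
    and x: "x \<in> rspace R"
  shows "finite ((\<lambda>j. ract R j x) ` J)"
proof (rule finite_image_of_compact[OF J(3) stabilizer_open[OF R J(2) x]])
  show "\<one> \<in> {j \<in> J. ract R j x = x}"
    using J(1) R x by (simp add: subgroup.one_closed smooth_rep_def)
qed (use R x in \<open>auto simp: smooth_rep_def\<close>)

text \<open>The finite orbit of a nonzero vector spans an invariant subspace.\<close>
lemma irreducible_finite_basis:
  assumes R: "irreducible_rep G T J R" and J: "subgroup J G" "openin T J" "compactin T J"
  obtains B where "finite B" "\<not> module.dependent (rscale R) B" "module.span (rscale R) B = rspace R"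
proof -
  interpret R: smooth_representation G T J R
    using R by unfold_locales (simp add: irreducible_rep_def)
  interpret J: subgroup J G by fact
  obtain w where w: "w \<in> rspace R" "w \<noteq> 0"
    using R R.subspace_0[OF R.subspace_rspace] by (auto simp: irreducible_rep_def)
  let ?O = "(\<lambda>j. ract R j w) ` J"
  have O: "?O \<subseteq> rspace R" "w \<in> ?O"
    using R.act_closed w R.act_one[OF w(1)] by (auto intro!: image_eqI[of _ _ \<one>])
  have sub: "R.span ?O \<subseteq> rspace R"
    using O(1) by (intro R.span_minimal R.subspace_rspace)
  have "ract R h x \<in> R.span ?O" if h: "h \<in> J" and x: "x \<in> R.span ?O" for h x
  proof -
    let ?P = "{x \<in> rspace R. ract R h x \<in> R.span ?O}"
    have "R.subspace ?P"
      using R.subspace_rspace h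
      by (auto simp: R.subspace_def R.act_zero R.act_add R.act_scale R.span_zero R.span_add R.span_scale)
    moreover have "?O \<subseteq> ?P"
    proof
      fix y assume "y \<in> ?O"
      then obtain j where j: "j \<in> J" "y = ract R j w" by blast
      then have "ract R h y = ract R (h \<otimes> j) w"
        using R.act_mult[of h j w] h w by simp
      then show "y \<in> ?P"
        using j h O(1) by (auto intro!: R.span_base)
    qed
    ultimately have "R.span ?O \<subseteq> ?P" by (intro R.span_minimal)
    with x show ?thesis by blast
  qed
  then have "invariant_subspace J R (R.span ?O)"
    using sub by (auto simp: invariant_subspace_def)
  moreover have "R.span ?O \<noteq> {0}"
    using R.span_base[OF O(2)] w(2) by blast
  ultimately have sp: "R.span ?O = rspace R"
    using R by (auto simp: irreducible_rep_def)
  obtain B where B: "B \<subseteq> ?O" "R.independent B" "?O \<subseteq> R.span B"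
    using R.maximal_independent_subset[of ?O] .
  have "R.span B = R.span ?O"
    using B R.span_mono[OF B(1)] R.span_minimal[OF B(3)] by auto
  moreover have "finite B"
    using B(1) finite_orbit[OF R.smooth J w(1)] finite_subset by blast
  ultimately show ?thesis
    using that B(2) sp by blast
qed

text \<open>
  Maschke's argument for the compact group \<open>J\<close>: a linear section \<open>s0\<close> of \<open>p\<close> has only
  finitely many conjugates \<open>t j = j \<circ> s0 \<circ> j\<inverse>\<close>, because \<open>j \<mapsto> t j\<close> is locally constant. Their
  sum is equivariant, since \<open>J\<close> permutes the set of conjugates, and it is a section of \<open>p\<close> up to the
  number of conjugates.
\<close>
theorem averaged_section:
  assumes J: "subgroup J G" "openin T J" "compactin T J"
    and R: "smooth_rep G T J R" and S: "irreducible_rep G T J S"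
    and p: "p \<in> rep_hom J R S" "x \<in> rspace R" "p x \<noteq> 0"
  obtains s c where "s \<in> rep_hom J S R" "c \<noteq> 0"
    "\<And>w. w \<in> rspace S \<Longrightarrow> p (s w) = rscale S c w"
proof -
  interpret R: smooth_representation G T J R
    by unfold_locales (rule R)
  interpret S: smooth_representation G T J S
    using S by unfold_locales (simp add: irreducible_rep_def)
  interpret J: subgroup J G by fact
  interpret RS: vector_space_pair "rscale S" "rscale R" ..
  note pD = rep_homD[OF p(1)]
  obtain B where B: "finite B" "S.independent B" "S.span B = rspace S"
    using irreducible_finite_basis[OF S J] .
  have "\<forall>b\<in>B. \<exists>u. u \<in> rspace R \<and> p u = b"
    using surjective_of_nonzero_hom[OF R S p] S.span_base[of _ B] B(3) by (metis imageE)
  then obtain u where u: "\<And>b. b \<in> B \<Longrightarrow> u b \<in> rspace R" "\<And>b. b \<in> B \<Longrightarrow> p (u b) = b"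
    by metis
  obtain s0 where s0: "Vector_Spaces.linear (rscale S) (rscale R) s0" "\<And>b. b \<in> B \<Longrightarrow> s0 b = u b"
    "range s0 = R.span (u ` B)"
    using RS.linear_independent_extend_subspace[OF B(2), of u] by blast
  have s0_add: "s0 (x + y) = s0 x + s0 y" and s0_scale: "s0 (rscale S c x) = rscale R c (s0 x)" for x y c
    using s0(1) by (simp_all add: RS.linear_add RS.linear_scale)
  have s0_0: "s0 0 = 0" using s0_scale[of 0 0] by simp
  have "R.span (u ` B) \<subseteq> rspace R"
    using u(1) by (intro R.span_minimal R.subspace_rspace) auto
  then have s0_in: "s0 w \<in> rspace R" for w
    using s0(3) by blast
  have p0: "p 0 = 0"
    using pD(3)[of 0 0] R.subspace_0[OF R.subspace_rspace] by simp
  have on_span: "w \<in> rspace S \<Longrightarrow> w \<in> P" if "S.subspace P" "B \<subseteq> P" for P w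
    using S.span_minimal[OF that(2,1)] B(3) by blast
  have ps0: "p (s0 w) = w" if w: "w \<in> rspace S" for w
  proof -
    have "S.subspace {w. p (s0 w) = w}"
      using s0_in pD by (auto simp: S.subspace_def s0_add s0_scale s0_0 p0)
    moreover have "B \<subseteq> {w. p (s0 w) = w}" using s0(2) u(2) by auto
    ultimately show ?thesis using on_span w by blast
  qed
  \<comment> \<open>The elements fixing a basis of \<open>S\<close> and its image under \<open>s0\<close>; they do not affect the conjugates.\<close>
  define N where "N = J \<inter> ((\<Inter>b\<in>B. {j \<in> J. ract S j b = b} \<inter> {j \<in> J. ract R j (u b) = u b}) \<inter> topspace T)"
  have BS: "b \<in> rspace S" if "b \<in> B" for b
    using S.span_base[OF that] B(3) by simp
  have "openin T N"
    unfolding N_def using B(1) J(2) BS u(1)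
    by (intro openin_Int openin_INT stabilizer_open[OF R] stabilizer_open[OF S.smooth]) auto
  moreover have "\<one> \<in> N"
    using J.one_closed BS u(1) by (auto simp: N_def S.act_one R.act_one topspace_eq)
  moreover have N: "ract S n w = w" "ract R n (s0 w) = s0 w" "ract S (inv n) w = w"
    if n: "n \<in> N" and w: "w \<in> rspace S" for n w
  proof -
    have nJ: "n \<in> J" "inv n \<in> J" using n by (auto simp: N_def)
    have "S.subspace {w \<in> rspace S. ract S n w = w}"
      using nJ S.subspace_rspace by (auto simp: S.subspace_def S.act_add S.act_scale S.act_zero)
    moreover have "B \<subseteq> {w \<in> rspace S. ract S n w = w}"
      using n BS by (auto simp: N_def)
    ultimately show 1: "ract S n w = w" using on_span w by blast
    have "S.subspace {w \<in> rspace S. ract R n (s0 w) = s0 w}"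
      using nJ S.subspace_rspace s0_in
      by (auto simp: S.subspace_def s0_add s0_scale s0_0 R.act_add R.act_scale R.act_zero)
    moreover have "B \<subseteq> {w \<in> rspace S. ract R n (s0 w) = s0 w}"
      using n BS s0(2) by (auto simp: N_def)
    ultimately show "ract R n (s0 w) = s0 w" using on_span w by blast
    show "ract S (inv n) w = w"
      using S.act_mult[OF nJ(2,1) w] 1 nJ S.act_one[OF w] by simp
  qed
  \<comment> \<open>Restricting to the space of \<open>S\<close> lets equal operators be equal as functions, so that the set
    of conjugates is finite.\<close>
  define t where "t j = restrict (\<lambda>w. ract R j (s0 (ract S (inv j) w))) (rspace S)" for j
  have "t (j \<otimes> n) = t j" if jn: "j \<in> J" "n \<in> N" for j n
  proof -
    have n: "n \<in> J" using jn(2) by (simp add: N_def)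
    have "ract R (j \<otimes> n) (s0 (ract S (inv (j \<otimes> n)) w)) = ract R j (s0 (ract S (inv j) w))"
      if w: "w \<in> rspace S" for w
    proof -
      have w': "ract S (inv j) w \<in> rspace S" using jn w S.act_closed by simp
      have "ract S (inv (j \<otimes> n)) w = ract S (inv j) w"
        using S.act_mult[of "inv n" "inv j" w] jn n w N(3)[OF jn(2) w']
        by (simp add: inv_mult_group J.mem_carrier)
      then show ?thesis
        using R.act_mult[OF jn(1) n s0_in] N(2)[OF jn(2) w'] by simp
    qed
    then show ?thesis
      unfolding t_def by (intro restrict_ext) auto
  qed
  ultimately have fin: "finite (t ` J)"
    by (intro finite_image_of_compact[OF J(3), of N]) auto
  let ?S = "t ` J"
  define s where "s w = (\<Sum>\<tau>\<in>?S. \<tau> w)" for w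
  have \<tau>: "\<tau> w \<in> rspace R" "p (\<tau> w) = w" "\<tau> (rscale S c w) = rscale R c (\<tau> w)"
    if "\<tau> \<in> ?S" "w \<in> rspace S" for \<tau> w c
  proof -
    obtain j where j: "j \<in> J" "\<tau> = t j" using \<open>\<tau> \<in> ?S\<close> by blast
    have ij: "inv j \<in> J" using j by simp
    show "\<tau> w \<in> rspace R"
      using j that s0_in R.act_closed by (simp add: t_def)
    show "\<tau> (rscale S c w) = rscale R c (\<tau> w)"
      using j ij that s0_in S.subspace_scale[OF S.subspace_rspace]
      by (simp add: t_def S.act_scale R.act_scale s0_scale)
    have "p (\<tau> w) = ract S j (p (s0 (ract S (inv j) w)))"
      using j that s0_in pD(4) by (simp add: t_def)
    also have "\<dots> = ract S j (ract S (inv j) w)"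
      using ps0 S.act_closed[OF ij] that by simp
    also have "\<dots> = w"
      using S.act_mult[OF j(1) ij] that j S.act_one by simp
    finally show "p (\<tau> w) = w" .
  qed
  have \<tau>_add: "\<tau> (w + w') = \<tau> w + \<tau> w'"
    if "\<tau> \<in> ?S" "w \<in> rspace S" "w' \<in> rspace S" for \<tau> w w'
  proof -
    obtain j where j: "j \<in> J" "\<tau> = t j" using \<open>\<tau> \<in> ?S\<close> by blast
    then show ?thesis
      using that s0_in S.subspace_add[OF S.subspace_rspace]
      by (simp add: t_def S.act_add R.act_add s0_add)
  qed
  have psum: "p (\<Sum>\<tau>\<in>F. \<tau> w) = (\<Sum>\<tau>\<in>F. p (\<tau> w))" if "F \<subseteq> ?S" "w \<in> rspace S" for F w
    using finite_subset[OF that(1) fin] that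
  proof (induction F)
    case (insert \<tau> F)
    then have "(\<Sum>\<tau>\<in>F. \<tau> w) \<in> rspace R"
      by (intro R.subspace_sum R.subspace_rspace) (auto intro: \<tau>)
    then show ?case
      using insert pD(2) \<tau>(1) by simp
  qed (simp add: p0)
  have equiv: "s (ract S k w) = ract R k (s w)" if k: "k \<in> J" and w: "w \<in> rspace S" for k w
  proof -
    \<comment> \<open>Conjugation by \<open>k\<close> sends \<open>t j\<close> to \<open>t (k \<otimes> j)\<close>, so it permutes the conjugates.\<close>
    let ?\<Phi> = "\<lambda>\<tau>. restrict (\<lambda>w. ract R k (\<tau> (ract S (inv k) w))) (rspace S)"
    have \<Phi>t: "?\<Phi> (t j) = t (k \<otimes> j)" if "j \<in> J" for j
      unfolding t_def
    proof (rule restrict_ext)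
      fix w assume w: "w \<in> rspace S"
      then show "ract R k (restrict (\<lambda>w. ract R j (s0 (ract S (inv j) w))) (rspace S) (ract S (inv k) w)) =
        ract R (k \<otimes> j) (s0 (ract S (inv (k \<otimes> j)) w))"
        using S.act_mult[of "inv j" "inv k" w] that k S.act_closed[of "inv k" w]
          R.act_mult[OF k that s0_in]
        by (simp add: inv_mult_group J.mem_carrier)
    qed
    have img: "?\<Phi> ` ?S = ?S"
    proof (intro equalityI subsetI)
      fix \<tau> assume "\<tau> \<in> ?\<Phi> ` ?S"
      then show "\<tau> \<in> ?S" using \<Phi>t k by auto
    next
      fix \<tau> assume "\<tau> \<in> ?S"
      then obtain j where j: "j \<in> J" "\<tau> = t j" by blast
      then have "\<tau> = ?\<Phi> (t (inv k \<otimes> j))"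
        using \<Phi>t[of "inv k \<otimes> j"] k J.mem_carrier by (simp flip: m_assoc)
      then show "\<tau> \<in> ?\<Phi> ` ?S"
        using j k by (intro image_eqI[of _ _ "t (inv k \<otimes> j)"]) auto
    qed
    then have "bij_betw ?\<Phi> ?S ?S"
      using eq_card_imp_inj_on[OF fin] unfolding bij_betw_def by metis
    then have "s (ract S k w) = (\<Sum>\<tau>\<in>?S. ?\<Phi> \<tau> (ract S k w))"
      unfolding s_def by (rule sum.reindex_bij_betw[symmetric])
    also have "\<dots> = (\<Sum>\<tau>\<in>?S. ract R k (\<tau> w))"
      using S.act_closed[OF k w] S.act_mult[of "inv k" k w] k w S.act_one[OF w]
      by (intro sum.cong) (simp_all add: J.mem_carrier)
    also have "\<dots> = ract R k (s w)"
      unfolding s_def using \<tau>(1) w k by (intro R.act_sum[symmetric]) auto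
    finally show ?thesis .
  qed
  show ?thesis
  proof (rule that)
    show "s \<in> rep_hom J S R"
    proof (rule rep_homI)
      fix w assume "w \<in> rspace S"
      then show "s w \<in> rspace R"
        unfolding s_def by (intro R.subspace_sum R.subspace_rspace \<tau>)
    next
      fix w w' assume "w \<in> rspace S" "w' \<in> rspace S"
      then show "s (w + w') = s w + s w'"
        unfolding s_def by (simp add: \<tau>_add sum.distrib cong: sum.cong)
    next
      fix c w assume "w \<in> rspace S"
      then show "s (rscale S c w) = rscale R c (s w)"
        unfolding s_def by (simp add: \<tau>(3) R.scale_sum_right cong: sum.cong)
    qed (rule equiv)
    have "?S \<noteq> {}" using J.one_closed by blast
    then show "(of_nat (card ?S) :: complex) \<noteq> 0"
      using fin by simp
    show "p (s w) = rscale S (of_nat (card ?S)) w" if "w \<in> rspace S" for w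
      using psum[OF order_refl that] \<tau>(2)[OF _ that] by (simp add: s_def S.sum_constant_scale)
  qed
qed

lemma smooth_rep_conj:
  assumes R: "smooth_rep G T N R" and N: "openin T N" and J: "J \<subseteq> N" "openin T J"
    and norm: "\<And>j. j \<in> J \<Longrightarrow> inv g \<otimes> j \<otimes> g \<in> N" and g: "g \<in> carrier G"
  shows "smooth_rep G T J (conj_rep G g R)"
proof -
  interpret R: smooth_representation G T N R
    by unfold_locales (rule R)
  have JG: "J \<subseteq> carrier G" using J(2) by (rule open_subset_carrier)
  have mult: "inv g \<otimes> (h \<otimes> k) \<otimes> g = (inv g \<otimes> h \<otimes> g) \<otimes> (inv g \<otimes> k \<otimes> g)"
    if "h \<in> J" "k \<in> J" for h k
  proof -
    have "h \<in> carrier G" "k \<in> carrier G" using that JG by auto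
    then have "(inv g \<otimes> h \<otimes> g) \<otimes> (inv g \<otimes> k \<otimes> g) = inv g \<otimes> h \<otimes> (g \<otimes> inv g) \<otimes> k \<otimes> g"
      using g by (simp only: m_assoc inv_closed m_closed)
    then show ?thesis
      using g \<open>h \<in> carrier G\<close> \<open>k \<in> carrier G\<close> by (simp add: m_assoc)
  qed
  have op: "openin (subtopology T J) {h \<in> J. ract R (inv g \<otimes> h \<otimes> g) x = x}" if x: "x \<in> rspace R" for x
  proof -
    let ?A = "{n \<in> N. ract R n x = x}"
    have "{h \<in> J. ract R (inv g \<otimes> h \<otimes> g) x = x} = J \<inter> (\<lambda>n. g \<otimes> n \<otimes> inv g) ` ?A"
    proof (intro equalityI subsetI)
      fix h assume h: "h \<in> {h \<in> J. ract R (inv g \<otimes> h \<otimes> g) x = x}"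
      then have "h = g \<otimes> (inv g \<otimes> h \<otimes> g) \<otimes> inv g"
        using g JG by (auto simp: m_assoc inv_solve_left' subset_iff)
          (metis g inv_closed m_assoc m_closed r_inv l_one r_one subsetD)
      with h norm show "h \<in> J \<inter> (\<lambda>n. g \<otimes> n \<otimes> inv g) ` ?A" by blast
    next
      fix h assume "h \<in> J \<inter> (\<lambda>n. g \<otimes> n \<otimes> inv g) ` ?A"
      then obtain n where n: "h \<in> J" "n \<in> N" "ract R n x = x" "h = g \<otimes> n \<otimes> inv g" by blast
      moreover have "n \<in> carrier G" using n(2) open_subset_carrier[OF N] by blast
      then have "inv g \<otimes> h \<otimes> g = (inv g \<otimes> g) \<otimes> n \<otimes> (inv g \<otimes> g)"
        unfolding n(4) using g by (simp only: m_assoc inv_closed m_closed)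
      then have "inv g \<otimes> h \<otimes> g = n"
        using g \<open>n \<in> carrier G\<close> by simp
      ultimately show "h \<in> {h \<in> J. ract R (inv g \<otimes> h \<otimes> g) x = x}" by simp
    qed
    moreover have "openin T (J \<inter> (\<lambda>n. g \<otimes> n \<otimes> inv g) ` ?A)"
      using stabilizer_open[OF R N x] by (intro openin_Int J open_conj g)
    ultimately show ?thesis
      using J(2) by (simp add: openin_open_subtopology)
  qed
  show ?thesis
    unfolding smooth_rep_def
    using R.vector_space_axioms R.subspace_rspace norm op g
    by (simp add: conj_rep_def R.act_closed R.act_add R.act_scale R.act_one mult R.act_mult)
qed

end

section \<open>The induced representation and its Mackey components\<close>

lemma sum_fun_apply: "(\<Sum>i\<in>I. f i) x = (\<Sum>i\<in>I. (f i :: 'b \<Rightarrow> 'c::ab_group_add) x)"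
  by (induction I rule: infinite_finite_induct) auto

context translation_group
begin

text \<open>For open \<open>H\<close> the coset space is discrete, so compactness modulo \<open>H\<close> is finiteness.\<close>
lemma compact_mod_iff_finite:
  assumes H: "subgroup H G" "openin T H" and S: "S \<subseteq> carrier G"
  shows "compact_mod G T H S \<longleftrightarrow> finite ((\<lambda>x. H #> x) ` S)"
proof -
  have HG: "H \<subseteq> carrier G" using H(1) by (rule subgroup.subset)
  have op: "openin (coset_topology G T H) {H #> x}" if x: "x \<in> carrier G" for x
  proof -
    have "H #> x = (\<lambda>h. h \<otimes> x) ` H" by (auto simp: r_coset_def)
    then have "openin T (H #> x)" using open_right_translate[OF H(2) x] by simp
    then show ?thesis
      using rcosetsI[OF HG x] by (simp add: openin_coset_topology[OF group_axioms H(1)])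
  qed
  let ?C = "(\<lambda>x. H #> x) ` S"
  show ?thesis
  proof
    assume "compact_mod G T H S"
    then have "compactin (coset_topology G T H) ?C" by (simp add: compact_mod_def)
    moreover have "\<And>U. U \<in> (\<lambda>c. {c}) ` ?C \<Longrightarrow> openin (coset_topology G T H) U"
      using op S by auto
    moreover have "?C \<subseteq> \<Union>((\<lambda>c. {c}) ` ?C)" by auto
    ultimately obtain \<F> where \<F>: "finite \<F>" "\<F> \<subseteq> (\<lambda>c. {c}) ` ?C" "?C \<subseteq> \<Union>\<F>"
      unfolding compactin_def by meson
    then have "finite (\<Union>\<F>)" by (intro finite_Union) auto
    with \<F>(3) show "finite ?C" by (rule finite_subset)
  next
    assume fin: "finite ?C"
    have "?C \<subseteq> topspace (coset_topology G T H)"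
      using openin_subset[OF op] S by auto
    with fin show "compact_mod G T H S"
      unfolding compact_mod_def by (intro finite_imp_compactin)
  qed
qed

lemma inv_mult_cancel [simp]:
  assumes "x \<in> carrier G" "y \<in> carrier G"
  shows "x \<otimes> (inv x \<otimes> y) = y" "inv x \<otimes> (x \<otimes> y) = y"
  using assms by (simp_all flip: m_assoc)

end

text \<open>
  The group \<open>K\<close> is arbitrary so that the whole group and \<open>N Jt\<close> are treated at once.
\<close>
locale mackey_setting = translation_group G T
  for G (structure) and T +
  fixes N Jt K :: "'a set" and \<sigma> :: "('a, 'v::ab_group_add) rep"
  assumes N: "N \<lhd> G" "openin T N"
    and Jt: "subgroup Jt G" "openin T Jt"
    and K: "subgroup K G" "N \<subseteq> K" "Jt \<subseteq> K"
    and compact_J: "compactin T (Jt \<inter> N)"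
    and \<sigma>: "smooth_rep G T Jt \<sigma>"
begin

sublocale S: smooth_representation G T Jt \<sigma>
  by unfold_locales (rule \<sigma>)

abbreviation J where "J \<equiv> Jt \<inter> N"

abbreviation V where "V \<equiv> compact_ind G T Jt K \<sigma>"

lemma subgroup_N: "subgroup N G"
  using N(1) by (simp add: normal_def)

lemma subgroup_J: "subgroup J G"
  using Jt(1) subgroup_N by (rule subgroups_Inter_pair)

lemma open_J: "openin T J"
  using Jt(2) N(2) by (rule openin_Int)

lemma in_carrier [simp]:
  "x \<in> Jt \<Longrightarrow> x \<in> carrier G" "x \<in> N \<Longrightarrow> x \<in> carrier G" "x \<in> K \<Longrightarrow> x \<in> carrier G"
  using Jt(1) subgroup_N K(1) by (auto dest: subgroup.mem_carrier)

lemma membership_closed [simp]: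
  "\<one> \<in> Jt" "\<one> \<in> N" "\<one> \<in> K"
  "x \<in> Jt \<Longrightarrow> y \<in> Jt \<Longrightarrow> x \<otimes> y \<in> Jt" "x \<in> Jt \<Longrightarrow> inv x \<in> Jt"
  "x \<in> N \<Longrightarrow> y \<in> N \<Longrightarrow> x \<otimes> y \<in> N" "x \<in> N \<Longrightarrow> inv x \<in> N"
  "x \<in> K \<Longrightarrow> y \<in> K \<Longrightarrow> x \<otimes> y \<in> K" "x \<in> K \<Longrightarrow> inv x \<in> K"
  "x \<in> N \<Longrightarrow> x \<in> K" "x \<in> Jt \<Longrightarrow> x \<in> K"
  using Jt(1) subgroup_N K by (auto intro: subgroup.one_closed subgroup.m_closed subgroup.m_inv_closed)

lemma conj_N [simp]:
  "x \<in> carrier G \<Longrightarrow> n \<in> N \<Longrightarrow> x \<otimes> n \<otimes> inv x \<in> N"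
  "x \<in> carrier G \<Longrightarrow> n \<in> N \<Longrightarrow> inv x \<otimes> n \<otimes> x \<in> N"
  using N(1) by (auto intro: normal.inv_op_closed1 normal.inv_op_closed2)

lemma open_K: "openin T K"
proof (rule open_of_translates)
  fix s assume "s \<in> K"
  then show "\<exists>U. openin T U \<and> \<one> \<in> U \<and> (\<lambda>x. s \<otimes> x) ` U \<subseteq> K"
    using N(2) by (intro exI[of _ N]) auto
qed auto

lemma smooth_rep_J: "smooth_rep G T J \<sigma>"
proof -
  have "openin (subtopology T J) {h \<in> J. ract \<sigma> h x = x}" if "x \<in> rspace \<sigma>" for x
  proof -
    have "{h \<in> J. ract \<sigma> h x = x} = J \<inter> {h \<in> Jt. ract \<sigma> h x = x}" by auto
    then show ?thesis
      using stabilizer_open[OF \<sigma> Jt(2) that] open_J by (auto simp: openin_open_subtopology)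
  qed
  then show ?thesis
    using \<sigma> unfolding smooth_rep_def by auto
qed

sublocale SJ: smooth_representation G T J \<sigma>
  by unfold_locales (rule smooth_rep_J)

lemma rscale_V [simp]: "rscale V = (\<lambda>c f x. rscale \<sigma> c (f x))"
  and ract_V [simp]: "ract V k f = (\<lambda>x. if x \<in> K then f (x \<otimes> k) else 0)"
  by (simp_all add: compact_ind_def)

text \<open>
  A function with finite support modulo \<open>Jt\<close> is right invariant under the elements \<open>u\<close> for which
  \<open>y u y\<inverse>\<close> fixes \<open>f y\<close>, where \<open>y\<close> runs through representatives \<open>Y\<close> of the finitely many cosets in
  the support.
\<close>
lemma stabilizer_of_induced_open:
  assumes f: "\<And>x. x \<in> K \<Longrightarrow> f x \<in> rspace \<sigma>"
      "\<And>h x. h \<in> Jt \<Longrightarrow> x \<in> K \<Longrightarrow> f (h \<otimes> x) = ract \<sigma> h (f x)"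
      "finite ((\<lambda>x. Jt #> x) ` {x \<in> K. f x \<noteq> 0})"
  shows "openin T {u \<in> K. \<forall>x\<in>K. f (x \<otimes> u) = f x}"
proof -
  obtain Y where Y: "Y \<subseteq> {x \<in> K. f x \<noteq> 0}" "finite Y"
    "(\<lambda>x. Jt #> x) ` {x \<in> K. f x \<noteq> 0} = (\<lambda>x. Jt #> x) ` Y"
    using finite_subset_image[OF f(3) order_refl] by auto
  define St where "St y = {h \<in> Jt. ract \<sigma> h (f y) = f y}" for y
  define U where "U = K \<inter> ((\<Inter>y\<in>Y. (\<lambda>h. inv y \<otimes> h \<otimes> inv (inv y)) ` St y) \<inter> topspace T)"
  have St_open: "openin T (St y)" if "y \<in> Y" for y
    unfolding St_def using Y(1) f(1) that by (intro stabilizer_open[OF \<sigma> Jt(2)]) auto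
  have "openin T U"
    unfolding U_def
    using Y(1) by (intro openin_Int[OF open_K] openin_INT[OF Y(2)] open_conj[OF St_open]) auto
  moreover have "\<one> \<in> U"
  proof -
    have "\<one> \<in> (\<lambda>h. inv y \<otimes> h \<otimes> inv (inv y)) ` St y" if "y \<in> Y" for y
      using that Y(1) f(1) by (intro image_eqI[of _ _ \<one>]) (auto simp: St_def S.act_one)
    then show ?thesis by (simp add: U_def topspace_eq)
  qed
  moreover have "f (z \<otimes> u) = f z" if u: "u \<in> U" and z: "z \<in> K" for u z
  proof -
    have uK: "u \<in> K" using u by (simp add: U_def)
    \<comment> \<open>The statement for \<open>inv u\<close> is what keeps \<open>u\<close> from moving points into the support.\<close>
    have fix1: "f (y \<otimes> u) = f y" "f (y \<otimes> inv u) = f y" if y: "y \<in> Y" for y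
    proof -
      have yK: "y \<in> K" using y Y(1) by blast
      obtain h where h: "h \<in> Jt" "ract \<sigma> h (f y) = f y" "u = inv y \<otimes> h \<otimes> y"
        using u y yK by (auto simp: U_def St_def)
      have "y \<otimes> u = h \<otimes> y" "y \<otimes> inv u = inv h \<otimes> y"
        using h yK by (simp_all add: m_assoc inv_mult_group)
      then show "f (y \<otimes> u) = f y" "f (y \<otimes> inv u) = f y"
        using f(2)[OF h(1) yK] f(2)[OF membership_closed(5)[OF h(1)] yK] h f(1)[OF yK]
          S.act_mult[of "inv h" h "f y"] S.act_one[of "f y"] by simp_all
    qed
    have coset: "\<exists>h\<in>Jt. \<exists>y\<in>Y. x = h \<otimes> y" if x: "x \<in> K" "f x \<noteq> 0" for x
    proof -
      obtain y where y: "y \<in> Y" "Jt #> x = Jt #> y" using x Y(3) by blast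
      then have "x \<in> Jt #> y" using rcos_self[of x Jt] x Jt(1) by simp
      with y show ?thesis by (auto simp: r_coset_def)
    qed
    show ?thesis
    proof (cases "f z = 0 \<and> f (z \<otimes> u) = 0")
      case False
      then consider "f z \<noteq> 0" | "f (z \<otimes> u) \<noteq> 0" by blast
      then show ?thesis
      proof cases
        case 1
        then obtain h y where hy: "h \<in> Jt" "y \<in> Y" "z = h \<otimes> y" using coset z by blast
        moreover have "y \<in> K" using hy Y(1) by blast
        ultimately show ?thesis
          using f(2) fix1(1) uK by (simp add: m_assoc)
      next
        case 2
        then obtain h y where hy: "h \<in> Jt" "y \<in> Y" "z \<otimes> u = h \<otimes> y" using coset z uK by (meson membership_closed)
        have yK: "y \<in> K" using hy Y(1) by blast
        have "z = z \<otimes> u \<otimes> inv u" using z uK by (simp add: m_assoc)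
        also have "\<dots> = h \<otimes> (y \<otimes> inv u)" using hy yK uK by (simp add: m_assoc)
        finally have "f z = f (h \<otimes> (y \<otimes> inv u))" by simp
        also have "\<dots> = f (h \<otimes> y)"
          using f(2) fix1(2) hy yK uK by simp
        finally show ?thesis using hy(3) by simp
      qed
    qed simp
  qed
  ultimately have *: "openin T U" "\<one> \<in> U" "\<And>u z. u \<in> U \<Longrightarrow> z \<in> K \<Longrightarrow> f (z \<otimes> u) = f z"
    and UK: "U \<subseteq> K"
    by (auto simp: U_def)
  show ?thesis
  proof (rule open_of_translates)
    fix s assume s: "s \<in> {u \<in> K. \<forall>x\<in>K. f (x \<otimes> u) = f x}"
    have "f (x \<otimes> (s \<otimes> u)) = f x" if "u \<in> U" "x \<in> K" for u x
      using *(3)[OF that(1), of "x \<otimes> s"] s that UK by (auto simp: m_assoc[symmetric])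
    then show "\<exists>U. openin T U \<and> \<one> \<in> U \<and> (\<lambda>x. s \<otimes> x) ` U \<subseteq> {u \<in> K. \<forall>x\<in>K. f (x \<otimes> u) = f x}"
      using * UK s by (intro exI[of _ U]) auto
  qed auto
qed

text \<open>
  Smoothness of an induced function is automatic once its support is finite modulo \<open>Jt\<close>. From here
  on, membership in \<open>V\<close> is a purely algebraic condition.
\<close>
theorem rspace_V_iff:
  "f \<in> rspace V \<longleftrightarrow>
     (\<forall>x. x \<notin> K \<longrightarrow> f x = 0) \<and> (\<forall>x\<in>K. f x \<in> rspace \<sigma>) \<and>
     (\<forall>h\<in>Jt. \<forall>x\<in>K. f (h \<otimes> x) = ract \<sigma> h (f x)) \<and>
     finite ((\<lambda>x. Jt #> x) ` {x \<in> K. f x \<noteq> 0})"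
    (is "_ \<longleftrightarrow> ?R")
proof -
  have cm: "compact_mod G T Jt {x \<in> K. f x \<noteq> 0} \<longleftrightarrow> finite ((\<lambda>x. Jt #> x) ` {x \<in> K. f x \<noteq> 0})"
    using Jt by (intro compact_mod_iff_finite) auto
  show ?thesis
  proof
    assume "f \<in> rspace V"
    then show ?R by (simp add: compact_ind_def cm)
  next
    assume R: ?R
    let ?U = "{u \<in> K. \<forall>x\<in>K. f (x \<otimes> u) = f x}"
    have "subgroup ?U G"
    proof (rule subgroupI)
      show "?U \<noteq> {}" by (auto intro!: exI[of _ \<one>])
      show "inv u \<in> ?U" if u: "u \<in> ?U" for u
      proof -
        have "f (x \<otimes> inv u) = f x" if x: "x \<in> K" for x
        proof -
          have "f (x \<otimes> inv u \<otimes> u) = f (x \<otimes> inv u)" using u x by auto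
          then show ?thesis using u x by (simp add: m_assoc)
        qed
        then show ?thesis using u by simp
      qed
      show "u \<otimes> w \<in> ?U" if "u \<in> ?U" "w \<in> ?U" for u w
        using that by (auto simp: m_assoc[symmetric])
    qed auto
    moreover have "openin (subtopology T K) ?U"
      using stabilizer_of_induced_open[of f] R open_K by (auto simp: openin_open_subtopology)
    ultimately show "f \<in> rspace V"
      using R cm by (auto simp: compact_ind_def intro!: exI[of _ ?U])
  qed
qed

lemma rspace_VD:
  assumes "f \<in> rspace V"
  shows "x \<notin> K \<Longrightarrow> f x = 0" "x \<in> K \<Longrightarrow> f x \<in> rspace \<sigma>"
    "h \<in> Jt \<Longrightarrow> x \<in> K \<Longrightarrow> f (h \<otimes> x) = ract \<sigma> h (f x)"
    "finite ((\<lambda>x. Jt #> x) ` {x \<in> K. f x \<noteq> 0})"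
  using assms by (simp_all add: rspace_V_iff)

lemma value_in_rspace: "f \<in> rspace V \<Longrightarrow> f x \<in> rspace \<sigma>"
  using rspace_VD(1,2)[of f x] S.subspace_0[OF S.subspace_rspace] by (cases "x \<in> K") auto

lemma value_on_coset:
  assumes "f \<in> rspace V" "x \<in> K" "z \<in> carrier G" "z \<otimes> inv x \<in> Jt"
  shows "f z = ract \<sigma> (z \<otimes> inv x) (f x)"
  using rspace_VD(3)[OF assms(1,4,2)] assms by (simp add: m_assoc)

lemma smooth_rep_V: "smooth_rep G T N V"
proof -
  have vs: "vector_space (rscale V)"
    by unfold_locales
      (auto simp: fun_eq_iff S.scale_right_distrib S.scale_left_distrib)
  then interpret V: vector_space "rscale V" .
  have sub: "V.subspace (rspace V)"
    unfolding V.subspace_def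
  proof (intro conjI ballI allI)
    show "0 \<in> rspace V"
      using S.subspace_0[OF S.subspace_rspace] by (auto simp: rspace_V_iff S.act_zero)
  next
    fix f g assume fg: "f \<in> rspace V" "g \<in> rspace V"
    have "finite ((\<lambda>x. Jt #> x) ` {x \<in> K. (f + g) x \<noteq> 0})"
    proof (rule finite_subset)
      show "(\<lambda>x. Jt #> x) ` {x \<in> K. (f + g) x \<noteq> 0} \<subseteq>
        (\<lambda>x. Jt #> x) ` {x \<in> K. f x \<noteq> 0} \<union> (\<lambda>x. Jt #> x) ` {x \<in> K. g x \<noteq> 0}"
        by auto
    qed (use fg rspace_VD(4) in auto)
    then show "f + g \<in> rspace V"
      using rspace_VD[OF fg(1)] rspace_VD[OF fg(2)] S.subspace_add[OF S.subspace_rspace]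
      by (simp add: rspace_V_iff S.act_add)
  next
    fix c f assume f: "f \<in> rspace V"
    have "finite ((\<lambda>x. Jt #> x) ` {x \<in> K. rscale \<sigma> c (f x) \<noteq> 0})"
      by (rule finite_subset[OF _ rspace_VD(4)[OF f]]) auto
    then show "rscale V c f \<in> rspace V"
      using rspace_VD[OF f] S.subspace_scale[OF S.subspace_rspace]
      by (simp add: rspace_V_iff S.act_scale)
  qed
  have act: "ract V k f \<in> rspace V" if k: "k \<in> N" and f: "f \<in> rspace V" for k f
  proof -
    have "(\<lambda>x. Jt #> x) ` {x \<in> K. f (x \<otimes> k) \<noteq> 0}
        \<subseteq> (\<lambda>C. C #> inv k) ` (\<lambda>x. Jt #> x) ` {x \<in> K. f x \<noteq> 0}"
    proof
      fix C assume "C \<in> (\<lambda>x. Jt #> x) ` {x \<in> K. f (x \<otimes> k) \<noteq> 0}"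
      then obtain x where x: "x \<in> K" "f (x \<otimes> k) \<noteq> 0" "C = Jt #> x" by blast
      have "C = (Jt #> (x \<otimes> k)) #> inv k"
        using x k Jt(1) by (simp add: coset_mult_assoc subgroup.subset m_assoc)
      moreover have "x \<otimes> k \<in> {x \<in> K. f x \<noteq> 0}"
        using x k by simp
      ultimately show "C \<in> (\<lambda>C. C #> inv k) ` (\<lambda>x. Jt #> x) ` {x \<in> K. f x \<noteq> 0}"
        by (rule image_eqI[OF _ imageI])
    qed
    then have "finite ((\<lambda>x. Jt #> x) ` {x \<in> K. f (x \<otimes> k) \<noteq> 0})"
      using rspace_VD(4)[OF f] by (meson finite_imageI finite_subset)
    then show ?thesis
      using rspace_VD[OF f] k by (auto simp: rspace_V_iff m_assoc cong: conj_cong)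
  qed
  have op: "openin (subtopology T N) {k \<in> N. ract V k f = f}" if f: "f \<in> rspace V" for f
  proof -
    have "{k \<in> N. ract V k f = f} = N \<inter> {u \<in> K. \<forall>x\<in>K. f (x \<otimes> u) = f x}"
      using rspace_VD(1)[OF f] by (auto simp: fun_eq_iff)
    then show ?thesis
      using stabilizer_of_induced_open[of f] rspace_VD[OF f] N(2) by (auto simp: openin_open_subtopology)
  qed
  have one: "ract V \<one> f = f" if "f \<in> rspace V" for f
    using rspace_VD(1)[OF that] by (auto simp: fun_eq_iff)
  have mult: "ract V (g \<otimes> h) f = ract V g (ract V h f)" if "g \<in> N" "h \<in> N" for g h f
    using that by (auto simp: fun_eq_iff m_assoc)
  show ?thesis
    unfolding smooth_rep_def
  proof (intro conjI ballI allI)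
    show "vector_space (rscale V)" by (rule vs)
    show "V.subspace (rspace V)" by (rule sub)
  qed (use act op one mult in \<open>auto simp: fun_eq_iff\<close>)
qed

sublocale V: smooth_representation G T N V
  by unfold_locales (rule smooth_rep_V)

text \<open>
  The element of \<open>V\<close> supported on the coset \<open>Jt y\<close> with value \<open>w\<close> at \<open>y\<close>.
\<close>
definition point :: "'a \<Rightarrow> 'v \<Rightarrow> 'a \<Rightarrow> 'v" where
  "point y w z = (if z \<in> carrier G \<and> z \<otimes> inv y \<in> Jt then ract \<sigma> (z \<otimes> inv y) w else 0)"

lemma point_self: "y \<in> K \<Longrightarrow> w \<in> rspace \<sigma> \<Longrightarrow> point y w y = w"
  by (simp add: point_def S.act_one)

lemma point_add:
  "w \<in> rspace \<sigma> \<Longrightarrow> w' \<in> rspace \<sigma> \<Longrightarrow> point y (w + w') = point y w + point y w'"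
  by (auto simp: point_def fun_eq_iff S.act_add)

lemma point_scale: "w \<in> rspace \<sigma> \<Longrightarrow> point y (rscale \<sigma> c w) = rscale V c (point y w)"
  by (auto simp: point_def fun_eq_iff S.act_scale)

lemma point_0: "point y 0 = 0"
  by (auto simp: point_def fun_eq_iff S.act_zero)

lemma point_mem:
  assumes y: "y \<in> K" and w: "w \<in> rspace \<sigma>"
  shows "point y w \<in> rspace V"
proof -
  have eq: "z = (z \<otimes> inv y) \<otimes> y" if "z \<in> carrier G" for z
    using that y by (simp add: m_assoc)
  have "(\<lambda>x. Jt #> x) ` {x \<in> K. point y w x \<noteq> 0} \<subseteq> {Jt #> y}"
  proof
    fix C assume "C \<in> (\<lambda>x. Jt #> x) ` {x \<in> K. point y w x \<noteq> 0}"
    then obtain x where x: "x \<in> K" "x \<otimes> inv y \<in> Jt" "C = Jt #> x"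
      by (auto simp: point_def split: if_splits)
    then have "x \<in> Jt #> y"
      using eq[of x] unfolding r_coset_def by auto
    then show "C \<in> {Jt #> y}"
      using repr_independence[of x Jt y] y Jt(1) x(3) by simp
  qed
  then have "finite ((\<lambda>x. Jt #> x) ` {x \<in> K. point y w x \<noteq> 0})"
    using finite_subset by blast
  moreover have "z \<in> K" if "z \<in> carrier G" "z \<otimes> inv y \<in> Jt" for z
    using eq[OF that(1)] that(2) y membership_closed by metis
  moreover have "point y w (h \<otimes> x) = ract \<sigma> h (point y w x)" if hx: "h \<in> Jt" "x \<in> K" for h x
  proof -
    have "h \<otimes> x \<otimes> inv y = h \<otimes> (x \<otimes> inv y)" using hx y by (simp add: m_assoc)
    moreover have "h \<otimes> (x \<otimes> inv y) \<in> Jt \<longleftrightarrow> x \<otimes> inv y \<in> Jt"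
      using hx y membership_closed(4)[of "inv h" "h \<otimes> (x \<otimes> inv y)"] by auto
    ultimately show ?thesis
      using hx w by (simp add: point_def S.act_mult S.act_zero)
  qed
  ultimately show ?thesis
    using w S.subspace_0[OF S.subspace_rspace] by (auto simp: rspace_V_iff point_def S.act_closed)
qed

lemma point_shift:
  assumes "h \<in> Jt" "y \<in> K" "w \<in> rspace \<sigma>"
  shows "point (h \<otimes> y) (ract \<sigma> h w) = point y w"
proof
  fix z
  show "point (h \<otimes> y) (ract \<sigma> h w) z = point y w z"
  proof (cases "z \<in> carrier G")
    case True
    have eq: "z \<otimes> inv (h \<otimes> y) = z \<otimes> inv y \<otimes> inv h"
      using True assms by (simp add: inv_mult_group m_assoc)
    have "z \<otimes> inv y \<otimes> inv h \<in> Jt \<longleftrightarrow> z \<otimes> inv y \<in> Jt"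
      using True assms membership_closed(4)[of "z \<otimes> inv y \<otimes> inv h" h]
        membership_closed(4)[of "z \<otimes> inv y" "inv h"] by (auto simp: m_assoc)
    moreover have "ract \<sigma> (z \<otimes> inv y \<otimes> inv h) (ract \<sigma> h w) = ract \<sigma> (z \<otimes> inv y) w"
      if "z \<otimes> inv y \<in> Jt"
      using S.act_mult[of "z \<otimes> inv y \<otimes> inv h" h w] membership_closed(4)[of "z \<otimes> inv y" "inv h"]
        that assms True by (simp add: m_assoc)
    ultimately show ?thesis by (simp add: point_def eq)
  qed (simp add: point_def)
qed

lemma point_translate:
  assumes "k \<in> K" "y \<in> K" "w \<in> rspace \<sigma>"
  shows "ract V k (point y w) = point (y \<otimes> inv k) w"
proof
  fix z
  have "z \<in> K" if "z \<in> carrier G" "z \<otimes> inv (y \<otimes> inv k) \<in> Jt"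
  proof -
    have "z = z \<otimes> inv (y \<otimes> inv k) \<otimes> (y \<otimes> inv k)"
      using that assms by (simp add: m_assoc)
    with that assms show ?thesis by (metis membership_closed)
  qed
  then show "ract V k (point y w) z = point (y \<otimes> inv k) w z"
    using assms by (auto simp: point_def inv_mult_group m_assoc)
qed

text \<open>
  An induced function is the sum of its restrictions to the finitely many cosets \<open>Jt y\<close> in its
  support, and such a restriction is determined by the value at \<open>y\<close>.
\<close>
lemma mem_subspace_of_points:
  assumes f: "f \<in> rspace V" and P: "V.subspace P" and points: "\<And>y. y \<in> K \<Longrightarrow> point y (f y) \<in> P"
  shows "f \<in> P"
proof -
  obtain Y where Y: "Y \<subseteq> {x \<in> K. f x \<noteq> 0}" "inj_on (\<lambda>x. Jt #> x) Y"
    "(\<lambda>x. Jt #> x) ` {x \<in> K. f x \<noteq> 0} = (\<lambda>x. Jt #> x) ` Y"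
    using subset_image_inj[of "(\<lambda>x. Jt #> x) ` {x \<in> K. f x \<noteq> 0}" "\<lambda>x. Jt #> x" "{x \<in> K. f x \<noteq> 0}"]
    by (simp only: order_refl simp_thms) (elim exE conjE)
  have fin: "finite Y"
    using rspace_VD(4)[OF f] Y by (metis finite_imageD)
  have YK: "\<And>y. y \<in> Y \<Longrightarrow> y \<in> K" using Y(1) by blast
  have coset: "z \<otimes> inv y \<in> Jt \<Longrightarrow> Jt #> z = Jt #> y" if "z \<in> carrier G" "y \<in> K" for z y
  proof -
    assume "z \<otimes> inv y \<in> Jt"
    moreover have "z = (z \<otimes> inv y) \<otimes> y" using that by (simp add: m_assoc)
    ultimately have "z \<in> Jt #> y" unfolding r_coset_def by blast
    then show ?thesis using repr_independence[of z Jt y] that Jt(1) by simp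
  qed
  have "f z = (\<Sum>y\<in>Y. point y (f y) z)" for z
  proof (cases "f z = 0")
    case True
    have "point y (f y) z = 0" if "y \<in> Y" for y
      using value_on_coset[OF f YK[OF that]] True by (auto simp: point_def)
    with True show ?thesis by simp
  next
    case False
    then have z: "z \<in> K" using rspace_VD(1)[OF f] by blast
    then obtain y where y: "y \<in> Y" "Jt #> z = Jt #> y" using Y(3) False by blast
    have "point x (f x) z = 0" if x: "x \<in> Y - {y}" for x
      using coset[of z x] z YK[of x] x y inj_onD[OF Y(2), of x y] by (auto simp: point_def)
    then have "(\<Sum>y\<in>Y. point y (f y) z) = point y (f y) z"
      using fin y(1) by (simp add: sum.remove)
    also have "\<dots> = f z"
    proof -
      have "z \<in> Jt #> y" using rcos_self[of z Jt] z Jt(1) y(2) by simp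
      then obtain h where h: "h \<in> Jt" "z = h \<otimes> y" by (auto simp: r_coset_def)
      then have "z \<otimes> inv y = h" using YK[OF y(1)] by (simp add: m_assoc)
      then show ?thesis
        using value_on_coset[OF f YK[OF y(1)], of z] z h(1) by (simp add: point_def)
    qed
    finally show ?thesis by simp
  qed
  then have "f = (\<Sum>y\<in>Y. point y (f y))"
    unfolding fun_eq_iff sum_fun_apply by (rule allI)
  also have "\<dots> \<in> P"
    using YK by (intro V.subspace_sum[OF P] points)
  finally show ?thesis .
qed

text \<open>
  The Mackey summand of \<open>V\<close> attached to the double coset \<open>Jt N x\<close> and the \<open>J\<close>-subspace \<open>W\<close>:
  the conjugate by \<open>x\<close> of the representation induced from \<open>W\<close> to \<open>N\<close>.
\<close>
definition component :: "'a \<Rightarrow> 'v set \<Rightarrow> ('a \<Rightarrow> 'v) set" where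
  "component x W = {f \<in> rspace V.
     (\<forall>z. f z \<noteq> 0 \<longrightarrow> (\<exists>h\<in>Jt. \<exists>g\<in>N. z = h \<otimes> (g \<otimes> x))) \<and> (\<forall>g\<in>N. f (g \<otimes> x) \<in> W)}"

lemma componentD:
  assumes "f \<in> component x W"
  shows "f \<in> rspace V" "g \<in> N \<Longrightarrow> f (g \<otimes> x) \<in> W"
  using assms by (auto simp: component_def)

lemma component_nonzero_value:
  assumes "f \<in> component x W" "x \<in> K" "f z \<noteq> 0"
  obtains h g where "h \<in> Jt" "g \<in> N" "z = h \<otimes> (g \<otimes> x)" "f (g \<otimes> x) \<noteq> 0"
proof -
  obtain h g where hg: "h \<in> Jt" "g \<in> N" "z = h \<otimes> (g \<otimes> x)"
    using assms by (auto simp: component_def)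
  then have "f z = ract \<sigma> h (f (g \<otimes> x))"
    using rspace_VD(3)[OF componentD(1)[OF assms(1)]] assms(2) by simp
  with assms(3) hg that show ?thesis
    using S.act_zero by metis
qed

text \<open>Normality of \<open>N\<close> gives \<open>N x n = N x\<close>, so right translation respects support and values.\<close>
lemma component_invariant:
  assumes x: "x \<in> K" and W: "invariant_subspace J \<sigma> W"
  shows "invariant_subspace N V (component x W)"
  unfolding invariant_subspace_def
proof (intro conjI ballI)
  have W': "S.subspace W" using W by (simp add: invariant_subspace_def)
  have supp: "\<exists>h\<in>Jt. \<exists>g\<in>N. z = h \<otimes> (g \<otimes> x)" if "f \<in> component x W" "f z \<noteq> 0" for f z
    using that by (auto simp: component_def)
  show "V.subspace (component x W)"
    unfolding V.subspace_def
  proof (intro conjI ballI allI)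
    show "0 \<in> component x W"
      using V.subspace_0[OF V.subspace_rspace] S.subspace_0[OF W'] by (simp add: component_def)
    fix f g assume fg: "f \<in> component x W" "g \<in> component x W"
    have "\<exists>h\<in>Jt. \<exists>g\<in>N. z = h \<otimes> (g \<otimes> x)" if "f z + g z \<noteq> 0" for z
      using that supp[OF fg(1), of z] supp[OF fg(2), of z] by (cases "f z = 0") auto
    then show "f + g \<in> component x W"
      using componentD[OF fg(1)] componentD[OF fg(2)]
        V.subspace_add[OF V.subspace_rspace, of f g] S.subspace_add[OF W']
      unfolding component_def by simp
  next
    fix c f assume f: "f \<in> component x W"
    then show "rscale V c f \<in> component x W"
      using V.subspace_scale[OF V.subspace_rspace, of f c] S.subspace_scale[OF W'] 
      by (auto simp: component_def)
  qed
  show "component x W \<subseteq> rspace V"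
    by (auto simp: component_def)
  fix n f assume n: "n \<in> N" and f: "f \<in> component x W"
  have "\<exists>h\<in>Jt. \<exists>g\<in>N. z = h \<otimes> (g \<otimes> x)" if z: "z \<in> K" "f (z \<otimes> n) \<noteq> 0" for z
  proof -
    obtain h g where hg: "h \<in> Jt" "g \<in> N" "z \<otimes> n = h \<otimes> (g \<otimes> x)"
      using supp[OF f z(2)] by blast
    have "z = z \<otimes> n \<otimes> inv n" using n z by (simp add: m_assoc)
    also have "\<dots> = h \<otimes> ((g \<otimes> (x \<otimes> inv n \<otimes> inv x)) \<otimes> x)"
      unfolding hg(3) using hg x n by (simp add: m_assoc)
    finally have "z = h \<otimes> ((g \<otimes> (x \<otimes> inv n \<otimes> inv x)) \<otimes> x)" .
    moreover have "g \<otimes> (x \<otimes> inv n \<otimes> inv x) \<in> N"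
      using hg x n by simp
    ultimately show ?thesis
      using hg(1) by blast
  qed
  moreover have "f (g \<otimes> x \<otimes> n) \<in> W" if "g \<in> N" for g
  proof -
    have "g \<otimes> x \<otimes> n = (g \<otimes> (x \<otimes> n \<otimes> inv x)) \<otimes> x"
      using that x n by (simp add: m_assoc)
    then show ?thesis using componentD(2)[OF f] that x n by simp
  qed
  ultimately show "ract V n f \<in> component x W"
    using V.act_closed[OF n componentD(1)[OF f]] x unfolding component_def by simp
qed

lemma point_in_component:
  assumes x: "x \<in> K" and g: "g \<in> N" and W: "invariant_subspace J \<sigma> W" and w: "w \<in> W"
  shows "point (g \<otimes> x) w \<in> component x W"
proof -
  note iW = SJ.invariantD[OF W]
  have "\<exists>h\<in>Jt. \<exists>g'\<in>N. z = h \<otimes> (g' \<otimes> x)" if "point (g \<otimes> x) w z \<noteq> 0" for z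
  proof -
    have z: "z \<in> carrier G" "z \<otimes> inv (g \<otimes> x) \<in> Jt"
      using that by (auto simp: point_def split: if_splits)
    then have "z = (z \<otimes> inv (g \<otimes> x)) \<otimes> (g \<otimes> x)" using g x by (simp add: m_assoc)
    with z(2) g show ?thesis by blast
  qed
  moreover have "point (g \<otimes> x) w (g' \<otimes> x) \<in> W" if g': "g' \<in> N" for g'
  proof -
    have "g' \<otimes> x \<otimes> inv (g \<otimes> x) = g' \<otimes> inv g"
      using g g' x by (simp add: inv_mult_group m_assoc)
    then show ?thesis
      using g g' x w iW(3) S.subspace_0[OF iW(1)] by (simp add: point_def)
  qed
  ultimately show ?thesis
    using point_mem[of "g \<otimes> x" w] g x w iW(2) by (auto simp: component_def)
qed

lemma point_from_base:
  assumes "x \<in> K" "g \<in> N" "w \<in> rspace \<sigma>"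
  shows "point (g \<otimes> x) w = ract V (inv x \<otimes> inv g \<otimes> x) (point x w)"
  using assms by (subst point_translate) (simp_all add: inv_mult_group m_assoc)

lemma component_subset_of_points:
  assumes x: "x \<in> K" and P: "V.subspace P" and points: "\<And>g w. g \<in> N \<Longrightarrow> w \<in> W \<Longrightarrow> point (g \<otimes> x) w \<in> P"
  shows "component x W \<subseteq> P"
proof
  fix f assume f: "f \<in> component x W"
  show "f \<in> P"
  proof (rule mem_subspace_of_points[OF componentD(1)[OF f] P])
    fix y assume y: "y \<in> K"
    show "point y (f y) \<in> P"
    proof (cases "f y = 0")
      case True
      then show ?thesis using V.subspace_0[OF P] by (simp add: point_0)
    next
      case False
      obtain h g where hg: "h \<in> Jt" "g \<in> N" "y = h \<otimes> (g \<otimes> x)"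
        using component_nonzero_value[OF f x False] .
      then have "point y (f y) = point (g \<otimes> x) (f (g \<otimes> x))"
        using rspace_VD(3)[OF componentD(1)[OF f]] x value_in_rspace[OF componentD(1)[OF f]]
        by (simp add: point_shift)
      then show ?thesis
        using points hg(2) componentD(2)[OF f] by simp
    qed
  qed
qed

text \<open>
  The homomorphisms from \<open>W\<close> to the conjugate of \<open>W'\<close> by \<open>inv h\<close>, over the intersection of \<open>J\<close>
  with the corresponding conjugate of \<open>J\<close>.
\<close>
definition intertwines :: "'a \<Rightarrow> 'v set \<Rightarrow> 'v set \<Rightarrow> ('v \<Rightarrow> 'v) \<Rightarrow> bool" where
  "intertwines h W W' \<mu> \<longleftrightarrow>
     \<mu> \<in> rep_hom {} (subrep \<sigma> W) (subrep \<sigma> W') \<and>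
     (\<forall>j\<in>J. h \<otimes> j \<otimes> inv h \<in> J \<longrightarrow> (\<forall>w\<in>W. \<mu> (ract \<sigma> j w) = ract \<sigma> (h \<otimes> j \<otimes> inv h) (\<mu> w)))"

text \<open>
  The operator \<open>w \<mapsto> s w (g y)\<close> sees the action of \<open>j\<close> through \<open>x\<inverse> j x\<close> on the source and through left
  equivariance on the target; the element that compares the two is \<open>g y x\<inverse>\<close>.
\<close>
lemma evaluation_intertwines:
  assumes x: "x \<in> K" and y: "y \<in> K" and g: "g \<in> N"
    and s: "s \<in> rep_hom J (subrep \<sigma> W) (conj_rep G x (subrep V (component y W')))"
  shows "intertwines (g \<otimes> y \<otimes> inv x) W W' (\<lambda>w. s w (g \<otimes> y))"
proof -
  have s1: "s w \<in> component y W'" if "w \<in> W" for w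
    using rep_homD(1)[OF s] that by (simp add: conj_rep_def)
  have s4: "s (ract \<sigma> j w) = ract V (inv x \<otimes> j \<otimes> x) (s w)" if "j \<in> J" "w \<in> W" for j w
    using rep_homD(4)[OF s] that by (simp add: conj_rep_def)
  have "(\<lambda>w. s w (g \<otimes> y)) \<in> rep_hom {} (subrep \<sigma> W) (subrep \<sigma> W')"
    using rep_homD[OF s] s1 componentD(2) g by (intro rep_homI) (auto simp: conj_rep_def)
  moreover have "s (ract \<sigma> j w) (g \<otimes> y) =
      ract \<sigma> (g \<otimes> y \<otimes> inv x \<otimes> j \<otimes> inv (g \<otimes> y \<otimes> inv x)) (s w (g \<otimes> y))"
    if j: "j \<in> J" "g \<otimes> y \<otimes> inv x \<otimes> j \<otimes> inv (g \<otimes> y \<otimes> inv x) \<in> J" and w: "w \<in> W" for j w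
  proof -
    let ?k = "g \<otimes> y \<otimes> inv x \<otimes> j \<otimes> inv (g \<otimes> y \<otimes> inv x)"
    have "s (ract \<sigma> j w) (g \<otimes> y) = s w (g \<otimes> y \<otimes> (inv x \<otimes> j \<otimes> x))"
      using s4[OF j(1) w] g y by simp
    also have "g \<otimes> y \<otimes> (inv x \<otimes> j \<otimes> x) = ?k \<otimes> (g \<otimes> y)"
      using g x y j by (simp add: m_assoc inv_mult_group)
    also have "s w (?k \<otimes> (g \<otimes> y)) = ract \<sigma> ?k (s w (g \<otimes> y))"
      using rspace_VD(3)[OF componentD(1)[OF s1[OF w]]] j(2) g y by simp
    finally show ?thesis .
  qed
  ultimately show ?thesis
    unfolding intertwines_def by simp
qed

end

section \<open>Decomposition of the induced representation\<close>

text \<open>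
  A decomposition of \<open>\<sigma>\<close> over \<open>J\<close> whose members intertwine each other only within \<open>Jt\<close>.
\<close>
locale cuspidal_family = mackey_setting +
  fixes \<W>
  assumes decomposition: "irreducible_decomposition G T J \<sigma> \<W>"
    and cuspidal: "W \<in> \<W> \<Longrightarrow> W' \<in> \<W> \<Longrightarrow> h \<in> carrier G \<Longrightarrow> intertwines h W W' \<mu> \<Longrightarrow>
      w \<in> W \<Longrightarrow> \<mu> w \<noteq> 0 \<Longrightarrow> h \<in> Jt"
begin

lemma irred_member: "W \<in> \<W> \<Longrightarrow> SJ.irred W"
  and span_family: "S.span (\<Union>\<W>) = rspace \<sigma>"
  and independent_family: "SJ.independent_family \<W>"
  using decomposition by (auto simp: SJ.irreducible_decomposition_iff)

lemma family_member:
  assumes "W \<in> \<W>"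
  shows "invariant_subspace J \<sigma> W" "S.subspace W" "W \<subseteq> rspace \<sigma>"
    "j \<in> J \<Longrightarrow> w \<in> W \<Longrightarrow> ract \<sigma> j w \<in> W"
  using SJ.irredD(1)[OF irred_member[OF assms]] by (auto simp: invariant_subspace_def)

text \<open>
  A nonzero subrepresentation \<open>U\<close> contains a function not vanishing at \<open>x\<close>, so evaluation at \<open>x\<close>
  maps \<open>U\<close> onto \<open>W\<close>, equivariantly for \<open>J\<close> acting through conjugation by \<open>x\<close>. An averaged section
  puts a copy of \<open>W\<close> into \<open>U\<close>, and by cuspidality this copy consists of the functions \<open>point x w\<close>,
  whose translates span the component.
\<close>
lemma irreducible_component:
  assumes x: "x \<in> K" and W: "W \<in> \<W>"
  shows "V.irred (component x W)"
  unfolding V.irred_iff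
proof (intro conjI allI impI)
  note inv = family_member(1)[OF W]
  show comp: "invariant_subspace N V (component x W)"
    using component_invariant[OF x inv] .
  have base: "point x w \<in> component x W" if "w \<in> W" for w
    using point_in_component[OF x membership_closed(2) inv that] x by simp
  obtain w where w: "w \<in> W" "w \<noteq> 0" using SJ.irred_nonzero[OF irred_member[OF W]] .
  then have "point x w \<noteq> 0"
    using point_self[OF x, of w] family_member(3)[OF W] by auto
  then show "component x W \<noteq> {0}" using base[OF w(1)] by blast
  fix U assume U: "invariant_subspace N V U" and sub: "U \<subseteq> component x W"
  note iU = V.invariantD[OF U]
  show "U = {0} \<or> U = component x W"
  proof (cases "U = {0}")
    case False
    then obtain f where f: "f \<in> U" "f \<noteq> 0" using V.subspace_0[OF iU(1)] by blast
    then obtain z where "f z \<noteq> 0" by (auto simp: fun_eq_iff)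
    then obtain h g where hg: "h \<in> Jt" "g \<in> N" "f (g \<otimes> x) \<noteq> 0"
      using component_nonzero_value[of f x W z] f(1) sub x by blast
    let ?f = "ract V (inv x \<otimes> g \<otimes> x) f"
    have "inv x \<otimes> g \<otimes> x \<in> N" using hg x by simp
    from iU(3)[OF this f(1)] have f': "?f \<in> U" "?f x \<noteq> 0"
      using hg x by (simp_all add: m_assoc)
    \<comment> \<open>\<open>J\<close> acts on \<open>U\<close> through \<open>x\<inverse> J x\<close>, for which evaluation at \<open>x\<close> is equivariant.\<close>
    let ?R = "conj_rep G x (subrep V U)" and ?S = "subrep \<sigma> W"
    have R: "smooth_rep G T J ?R"
    proof (rule smooth_rep_conj[OF V.smooth_rep_subrep[OF U] N(2)])
      show "inv x \<otimes> j \<otimes> x \<in> N" if "j \<in> J" for j using that x by simp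
    qed (use open_J x in auto)
    have val: "u (g \<otimes> x) \<in> W" if "u \<in> U" "g \<in> N" for u g
      using componentD(2) sub that by blast
    have p: "(\<lambda>u. u x) \<in> rep_hom J ?R ?S"
    proof (rule rep_homI)
      show "u x \<in> rspace ?S" if "u \<in> rspace ?R" for u
        using val[of u \<one>] that x by (simp add: conj_rep_def)
      show "ract ?R j u x = ract ?S j (u x)" if "j \<in> J" "u \<in> rspace ?R" for j u
      proof -
        have "u \<in> rspace V" using that iU(2) by (auto simp: conj_rep_def)
        then show ?thesis
          using that x rspace_VD(3)[of u j x] by (simp add: conj_rep_def m_assoc)
      qed
    qed (auto simp: conj_rep_def)
    obtain s c where s: "s \<in> rep_hom J ?S ?R" "c \<noteq> 0"
      and ev: "\<And>w. w \<in> rspace ?S \<Longrightarrow> s w x = rscale ?S c w"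
      using averaged_section[OF subgroup_J open_J compact_J R _ p, of ?f] f' irred_member[OF W]
      by (auto simp: SJ.irred_def conj_rep_def)
    have sU: "s w \<in> U" if "w \<in> W" for w
      using rep_homD(1)[OF s(1)] that by (simp add: conj_rep_def)
    have s': "s \<in> rep_hom J ?S (conj_rep G x (subrep V (component x W)))"
      using s(1) sub by (auto simp: rep_hom_def conj_rep_def)
    \<comment> \<open>Values of \<open>s w\<close> away from the coset of \<open>x\<close> would intertwine \<open>W\<close> with itself outside \<open>Jt\<close>.\<close>
    have "s w = point x (rscale \<sigma> c w)" if w: "w \<in> W" for w
    proof
      fix z
      have swV: "s w \<in> rspace V" using sU[OF w] iU(2) by blast
      have swc: "s w \<in> component x W" using sU[OF w] sub by blast
      show "s w z = point x (rscale \<sigma> c w) z"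
      proof (cases "z \<in> carrier G \<and> z \<otimes> inv x \<in> Jt")
        case True
        then show ?thesis
          using value_on_coset[OF swV x] ev[of w] w by (simp add: point_def)
      next
        case False
        have "s w z = 0"
        proof (rule ccontr)
          assume "s w z \<noteq> 0"
          then obtain h g where hg: "h \<in> Jt" "g \<in> N" "z = h \<otimes> (g \<otimes> x)" "s w (g \<otimes> x) \<noteq> 0"
            using component_nonzero_value[OF swc x] by blast
          have "g \<otimes> x \<otimes> inv x \<in> Jt"
            using cuspidal[OF W W _ evaluation_intertwines[OF x x hg(2) s'] w hg(4)] x hg(2) by simp
          then have "g \<in> Jt" using x hg(2) by (simp add: m_assoc)
          then have "z \<in> carrier G" "z \<otimes> inv x \<in> Jt"
            using hg x by (simp_all add: m_assoc)
          with False show False by blast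
        qed
        with False show ?thesis by (auto simp: point_def)
      qed
    qed
    then have cU: "point x (rscale \<sigma> c w) \<in> U" if "w \<in> W" for w
      using sU that by metis
    have "component x W \<subseteq> U"
    proof (rule component_subset_of_points[OF x iU(1)])
      fix g w assume g: "g \<in> N" and w: "w \<in> W"
      have "point x (rscale \<sigma> c (rscale \<sigma> (1 / c) w)) \<in> U"
        using cU S.subspace_scale[OF family_member(2)[OF W] w] by blast
      then have "point x w \<in> U" using s(2) by simp
      then show "point (g \<otimes> x) w \<in> U"
        using point_from_base[OF x g, of w] iU(3) g w x family_member(3)[OF W] by (metis membership_closed(7) conj_N(2) in_carrier(3) subsetD)
    qed
    with sub show ?thesis by blast
  qed simp
qed

lemma point_in_base_component: "x \<in> K \<Longrightarrow> W \<in> \<W> \<Longrightarrow> w \<in> W \<Longrightarrow> point x w \<in> component x W"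
  using point_in_component[of x \<one> W w] family_member(1) by simp

text \<open>
  Applying an isomorphism \<open>F\<close> to the functions \<open>point x w\<close> and evaluating at \<open>g y\<close> gives a nonzero
  operator from \<open>W\<close> to \<open>W'\<close> intertwined by \<open>g y x\<inverse>\<close>, which cuspidality forces into \<open>Jt\<close>. If \<open>x = y\<close>,
  this element is \<open>g\<close> itself and lies in \<open>J\<close>, so the operator is an isomorphism up to the action
  of \<open>g\<close>.
\<close>
lemma rep_iso_components_imp:
  assumes x: "x \<in> K" and y: "y \<in> K" and W: "W \<in> \<W>" and W': "W' \<in> \<W>"
    and iso: "rep_iso N (subrep V (component x W)) (subrep V (component y W'))"
  shows "\<exists>g\<in>N. g \<otimes> y \<otimes> inv x \<in> Jt" and "x = y \<Longrightarrow> rep_iso J (subrep \<sigma> W) (subrep \<sigma> W')"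
proof -
  obtain F where F: "F \<in> rep_hom N (subrep V (component x W)) (subrep V (component y W'))"
    and bij: "bij_betw F (component x W) (component y W')"
    using iso by (auto simp: rep_iso_def)
  note FD = rep_homD[OF F, unfolded rspace_subrep rscale_subrep ract_subrep]
  note Wr = subsetD[OF family_member(3)[OF W]]
  have base: "point x w \<in> component x W" if "w \<in> W" for w
    using point_in_base_component[OF x W that] .
  have s: "(\<lambda>w. F (point x w)) \<in> rep_hom J (subrep \<sigma> W) (conj_rep G x (subrep V (component y W')))"
  proof (rule rep_homI)
    fix j w assume "j \<in> J" "w \<in> rspace (subrep \<sigma> W)"
    then have j: "j \<in> Jt" "j \<in> N" and w: "w \<in> W" by auto
    have "point x (ract \<sigma> j w) = point (j \<otimes> (inv j \<otimes> x)) (ract \<sigma> j w)"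
      using j x by simp
    also have "\<dots> = point (inv j \<otimes> x) w"
      using j x Wr[OF w] by (intro point_shift) auto
    also have "\<dots> = ract V (inv x \<otimes> j \<otimes> x) (point x w)"
      using point_from_base[OF x, of "inv j" w] j Wr[OF w] by simp
    finally show "F (point x (ract (subrep \<sigma> W) j w)) =
        ract (conj_rep G x (subrep V (component y W'))) j (F (point x w))"
      using FD(4)[OF _ base[OF w], of "inv x \<otimes> j \<otimes> x"] j x by (simp add: conj_rep_def del: ract_V)
  next
    fix w w' assume "w \<in> rspace (subrep \<sigma> W)" "w' \<in> rspace (subrep \<sigma> W)"
    then show "F (point x (w + w')) = F (point x w) + F (point x w')"
      using FD(2) base point_add Wr by simp
  next
    fix c w assume "w \<in> rspace (subrep \<sigma> W)"
    then show "F (point x (rscale (subrep \<sigma> W) c w)) =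
        rscale (conj_rep G x (subrep V (component y W'))) c (F (point x w))"
      using FD(3)[OF base, of w c] point_scale[of w x c] Wr by (simp add: conj_rep_def del: rscale_V)
  qed (use FD(1) base in \<open>auto simp: conj_rep_def\<close>)
  obtain w where w: "w \<in> W" "w \<noteq> 0" using SJ.irred_nonzero[OF irred_member[OF W]] .
  have "F (point x w) \<noteq> 0"
  proof
    assume 0: "F (point x w) = 0"
    have C0: "0 \<in> component x W"
      using V.subspace_0 component_invariant[OF x family_member(1)[OF W]] by (simp add: invariant_subspace_def)
    then have "F 0 = 0"
      using FD(2)[OF C0 C0] by simp
    then have "point x w = 0"
      using 0 bij C0 base[OF w(1)] by (metis bij_betw_imp_inj_on inj_onD)
    then show False using point_self[OF x Wr[OF w(1)]] w(2) by simp
  qed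
  then obtain z where z: "F (point x w) z \<noteq> 0" by (auto simp: fun_eq_iff)
  have "F (point x w) \<in> component y W'" using FD(1)[OF base[OF w(1)]] .
  then obtain g where g: "g \<in> N" "F (point x w) (g \<otimes> y) \<noteq> 0"
    using component_nonzero_value[of "F (point x w)" y W' z] y z by blast
  note intw = evaluation_intertwines[OF x y g(1) s]
  have h: "g \<otimes> y \<otimes> inv x \<in> Jt"
    using cuspidal[OF W W' _ intw w(1) g(2)] g x y by simp
  with g show "\<exists>g\<in>N. g \<otimes> y \<otimes> inv x \<in> Jt" by blast
  show "rep_iso J (subrep \<sigma> W) (subrep \<sigma> W')" if xy: "x = y"
  proof -
    have gJ: "g \<in> J" using h g x xy by (simp add: m_assoc)
    define \<mu> where "\<mu> w = F (point x w) (g \<otimes> y)" for w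
    have \<mu>: "intertwines g W W' \<mu>"
      using intw x g xy unfolding \<mu>_def by (simp add: m_assoc)
    then have \<mu>h: "\<mu> \<in> rep_hom {} (subrep \<sigma> W) (subrep \<sigma> W')"
      and \<mu>e: "\<And>j w. j \<in> J \<Longrightarrow> w \<in> W \<Longrightarrow> \<mu> (ract \<sigma> j w) = ract \<sigma> (g \<otimes> j \<otimes> inv g) (\<mu> w)"
      using gJ by (auto simp: intertwines_def)
    note \<mu>D = rep_homD[OF \<mu>h, unfolded rspace_subrep rscale_subrep]
    have gi: "inv g \<in> J" using gJ by auto
    note W'r = subsetD[OF family_member(3)[OF W']]
    have hom: "(\<lambda>w. ract \<sigma> (inv g) (\<mu> w)) \<in> rep_hom J (subrep \<sigma> W) (subrep \<sigma> W')"
    proof (rule rep_homI)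
      fix j v assume "j \<in> J" "v \<in> rspace (subrep \<sigma> W)"
      then have j: "j \<in> J" and v: "v \<in> W" by auto
      have "ract \<sigma> (inv g) (\<mu> (ract \<sigma> j v)) = ract \<sigma> (inv g \<otimes> (g \<otimes> j \<otimes> inv g)) (\<mu> v)"
        using \<mu>e[OF j v] S.act_mult[of "inv g" "g \<otimes> j \<otimes> inv g" "\<mu> v"] gJ j \<mu>D(1)[OF v] W'r by simp
      also have "inv g \<otimes> (g \<otimes> j \<otimes> inv g) = j \<otimes> inv g"
        using gJ j by (simp add: m_assoc)
      also have "ract \<sigma> (j \<otimes> inv g) (\<mu> v) = ract \<sigma> j (ract \<sigma> (inv g) (\<mu> v))"
        using S.act_mult[of j "inv g" "\<mu> v"] gJ j \<mu>D(1)[OF v] W'r by simp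
      finally show "ract \<sigma> (inv g) (\<mu> (ract (subrep \<sigma> W) j v)) =
          ract (subrep \<sigma> W') j (ract \<sigma> (inv g) (\<mu> v))" by simp
    qed (use gi gJ \<mu>D family_member(4)[OF W' gi] W'r in \<open>auto simp: S.act_add S.act_scale\<close>)
    have "ract \<sigma> (inv g) (\<mu> w) \<noteq> 0"
    proof
      assume "ract \<sigma> (inv g) (\<mu> w) = 0"
      moreover have "ract \<sigma> g (ract \<sigma> (inv g) (\<mu> w)) = \<mu> w"
        using S.act_mult[of g "inv g" "\<mu> w"] S.act_one gJ W'r[OF \<mu>D(1)[OF w(1)]] by simp
      ultimately show False
        using S.act_zero[of g] gJ g(2) by (simp add: \<mu>_def)
    qed
    then show ?thesis
      using rep_iso_of_nonzero_hom[OF _ _ hom, of G T w] irred_member[OF W] irred_member[OF W'] w(1)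
      by (simp add: SJ.irred_def)
  qed
qed

text \<open>
  If \<open>\<theta>\<close> is an isomorphism between distinct members \<open>W\<close> and \<open>W'\<close>, the graph \<open>D = {w + \<theta> w}\<close>
  is a common complement of \<open>W\<close> and \<open>W'\<close> in their sum. The component of \<open>D\<close> is then a common
  complement of their components, which makes these isomorphic.
\<close>
lemma rep_iso_components:
  assumes x: "x \<in> K" and W: "W \<in> \<W>" and W': "W' \<in> \<W>"
    and iso: "rep_iso J (subrep \<sigma> W) (subrep \<sigma> W')"
  shows "rep_iso N (subrep V (component x W)) (subrep V (component x W'))"
proof (cases "W = W'")
  case False
  obtain \<theta> where \<theta>: "\<theta> \<in> rep_hom J (subrep \<sigma> W) (subrep \<sigma> W')" "bij_betw \<theta> W W'"
    using iso by (auto simp: rep_iso_def)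
  note \<theta>D = rep_homD[OF \<theta>(1), unfolded rspace_subrep rscale_subrep ract_subrep]
  note Wr = subsetD[OF family_member(3)[OF W]] and W'r = subsetD[OF family_member(3)[OF W']]
  have W0: "0 \<in> W" "0 \<in> W'" using S.subspace_0 family_member(2) W W' by auto
  have \<theta>0: "\<theta> 0 = 0" using \<theta>D(3)[OF W0(1), of 0] by simp
  have disj: "W \<inter> W' = {0}"
  proof -
    have "W' \<subseteq> S.span (\<Union>(\<W> - {W}))"
      using W' False S.span_superset[of "\<Union>(\<W> - {W})"] by blast
    moreover have "\<not> W \<subseteq> S.span (\<Union>(\<W> - {W}))"
      using independent_family W by (simp add: SJ.independent_family_def)
    ultimately show ?thesis
      using SJ.irred_dichotomy[OF irred_member[OF W] family_member(1)[OF W']] by blast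
  qed
  define D where "D = (\<lambda>w. w + \<theta> w) ` W"
  have D: "invariant_subspace J \<sigma> D"
    unfolding invariant_subspace_def
  proof (intro conjI ballI)
    show "S.subspace D"
      unfolding S.subspace_def
    proof (intro conjI ballI allI)
      show "0 \<in> D" using W0 \<theta>0 by (auto simp: D_def intro!: image_eqI[of _ _ 0])
      fix a b assume "a \<in> D" "b \<in> D"
      then obtain u w where uw: "u \<in> W" "w \<in> W" "a = u + \<theta> u" "b = w + \<theta> w" by (auto simp: D_def)
      then show "a + b \<in> D"
        using S.subspace_add[OF family_member(2)[OF W] uw(1,2)] \<theta>D(2)[OF uw(1,2)]
        by (auto simp: D_def intro!: image_eqI[of _ _ "u + w"])
    next
      fix c a assume "a \<in> D"
      then obtain u where u: "u \<in> W" "a = u + \<theta> u" by (auto simp: D_def)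
      then show "rscale \<sigma> c a \<in> D"
        using S.subspace_scale[OF family_member(2)[OF W] u(1)] \<theta>D(3)[OF u(1)]
        by (auto simp: D_def S.scale_right_distrib intro!: image_eqI[of _ _ "rscale \<sigma> c u"])
    qed
    show "D \<subseteq> rspace \<sigma>"
      using Wr W'r \<theta>D(1) S.subspace_add[OF S.subspace_rspace] by (auto simp: D_def)
    fix j a assume j: "j \<in> J" and "a \<in> D"
    then obtain u where u: "u \<in> W" "a = u + \<theta> u" by (auto simp: D_def)
    then show "ract \<sigma> j a \<in> D"
      using family_member(4)[OF W j u(1)] \<theta>D(4)[OF j u(1)] SJ.act_add[OF j Wr W'r, of u "\<theta> u"] \<theta>D(1)
      by (auto simp: D_def intro!: image_eqI[of _ _ "ract \<sigma> j u"])
  qed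
  have WD: "W \<inter> D \<subseteq> {0}"
  proof
    fix a assume "a \<in> W \<inter> D"
    then obtain u where u: "a \<in> W" "u \<in> W" "a = u + \<theta> u" by (auto simp: D_def)
    then have "\<theta> u \<in> W" using S.subspace_diff[OF family_member(2)[OF W] u(1,2)] by simp
    then have "\<theta> u = \<theta> 0" using disj \<theta>D(1)[OF u(2)] \<theta>0 by auto
    then have "u = 0" using inj_onD[OF bij_betw_imp_inj_on[OF \<theta>(2)]] u(2) W0(1) by blast
    with u \<theta>0 show "a \<in> {0}" by simp
  qed
  have W'D: "W' \<inter> D \<subseteq> {0}"
  proof
    fix a assume "a \<in> W' \<inter> D"
    then obtain u where u: "a \<in> W'" "u \<in> W" "a = u + \<theta> u" by (auto simp: D_def)
    then have "u \<in> W'" using S.subspace_diff[OF family_member(2)[OF W'] u(1) \<theta>D(1)[OF u(2)]] by simp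
    then have "u \<in> W \<inter> W'" using u(2) by (rule IntI[rotated])
    then have "u = 0" unfolding disj by (rule singletonD)
    with u(3) \<theta>0 show "a \<in> {0}" by simp
  qed
  have inter: "component x A \<inter> component x D = {0}" if "A \<inter> D \<subseteq> {0}" "invariant_subspace J \<sigma> A" for A
  proof -
    have "f = 0" if f: "f \<in> component x A" "f \<in> component x D" for f
    proof (rule ccontr)
      assume "f \<noteq> 0"
      then obtain z where "f z \<noteq> 0" by (auto simp: fun_eq_iff)
      then obtain g where "g \<in> N" "f (g \<otimes> x) \<noteq> 0"
        using component_nonzero_value[OF f(1) x] by blast
      then show False
        using componentD(2)[OF f(1)] componentD(2)[OF f(2)] \<open>A \<inter> D \<subseteq> {0}\<close> by blast
    qed
    moreover have "0 \<in> component x A" "0 \<in> component x D"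
      using component_invariant[OF x that(2)] component_invariant[OF x D] V.subspace_0
      by (auto simp: invariant_subspace_def)
    ultimately show ?thesis by blast
  qed
  have "component x W \<subseteq> V.span (component x W' \<union> component x D)"
  proof (rule component_subset_of_points[OF x])
    fix g w assume g: "g \<in> N" and w: "w \<in> W"
    have "point (g \<otimes> x) (w + \<theta> w) = point (g \<otimes> x) w + point (g \<otimes> x) (\<theta> w)"
      using w Wr W'r \<theta>D(1) by (intro point_add) auto
    then have eq: "point (g \<otimes> x) w = point (g \<otimes> x) (w + \<theta> w) - point (g \<otimes> x) (\<theta> w)"
      by simp
    have "point (g \<otimes> x) (w + \<theta> w) \<in> component x D" "point (g \<otimes> x) (\<theta> w) \<in> component x W'"
      using point_in_component[OF x g D, of "w + \<theta> w"]
        point_in_component[OF x g family_member(1)[OF W'] \<theta>D(1)[OF w]] w by (auto simp: D_def)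
    then show "point (g \<otimes> x) w \<in> V.span (component x W' \<union> component x D)"
      unfolding eq by (intro V.span_diff V.span_base) auto
  qed (rule V.subspace_span)
  then show ?thesis
    using V.rep_iso_of_common_complement[OF irreducible_component[OF x W] irreducible_component[OF x W']
      component_invariant[OF x D] inter[OF WD family_member(1)[OF W]] inter[OF W'D family_member(1)[OF W']]] by blast
qed (simp add: rep_iso_refl)

lemma component_eq_imp:
  assumes x: "x \<in> K" and W: "W \<in> \<W>" "W' \<in> \<W>" and eq: "component x W = component x W'"
  shows "W = W'"
proof -
  have "A \<subseteq> B" if "A \<in> \<W>" "component x A = component x B" for A B
  proof
    fix w assume w: "w \<in> A"
    then have "point x w \<in> component x B"
      using point_in_base_component[OF x that(1)] that(2) by blast
    then have "point x w x \<in> B"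
      using componentD(2)[of "point x w" x B \<one>] x by simp
    then show "w \<in> B"
      using point_self[OF x] family_member(3)[OF that(1)] w by auto
  qed
  with W eq show ?thesis by blast
qed

text \<open>
  A set of representatives in \<open>K\<close> of the cosets of the subgroup \<open>Jt N = N Jt\<close>.
\<close>
definition transversal :: "'a set \<Rightarrow> bool" where
  "transversal A \<longleftrightarrow> A \<subseteq> K \<and>
     (\<forall>y\<in>K. \<exists>x\<in>A. \<exists>h\<in>Jt. \<exists>g\<in>N. y = h \<otimes> (g \<otimes> x)) \<and>
     (\<forall>x\<in>A. \<forall>y\<in>A. \<forall>h\<in>Jt. \<forall>g\<in>N. y = h \<otimes> (g \<otimes> x) \<longrightarrow> x = y)"

lemma transversal_exists: obtains A where "transversal A"
proof -
  let ?D = "N <#> Jt"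
  have D: "subgroup ?D G" using mult_norm_subgroup[OF N(1) Jt(1)] .
  have mem: "h \<otimes> (g \<otimes> x) \<in> ?D #> x" if "h \<in> Jt" "g \<in> N" "x \<in> K" for h g x
  proof -
    have "h \<otimes> (g \<otimes> x) = (h \<otimes> g \<otimes> inv h) \<otimes> h \<otimes> x" using that by (simp add: m_assoc)
    moreover have "(h \<otimes> g \<otimes> inv h) \<otimes> h \<in> ?D" using that by (auto simp: set_mult_def)
    ultimately show ?thesis by (auto simp: r_coset_def)
  qed
  have memD: "\<exists>h\<in>Jt. \<exists>g\<in>N. y = h \<otimes> (g \<otimes> x)" if y: "y \<in> ?D #> x" and x: "x \<in> K" for x y
  proof -
    obtain n h where nh: "n \<in> N" "h \<in> Jt" "y = n \<otimes> h \<otimes> x"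
      using y unfolding r_coset_def set_mult_def by blast
    then have "y = h \<otimes> ((inv h \<otimes> n \<otimes> h) \<otimes> x)" using x by (simp add: m_assoc)
    moreover have "inv h \<otimes> n \<otimes> h \<in> N" using nh by simp
    ultimately show ?thesis using nh(2) by blast
  qed
  obtain A where A: "A \<subseteq> K" "inj_on (\<lambda>x. ?D #> x) A" "(\<lambda>x. ?D #> x) ` K = (\<lambda>x. ?D #> x) ` A"
    using subset_image_inj[of "(\<lambda>x. ?D #> x) ` K" "\<lambda>x. ?D #> x" K]
    by (simp only: order_refl simp_thms) (elim exE conjE)
  have "\<exists>x\<in>A. \<exists>h\<in>Jt. \<exists>g\<in>N. y = h \<otimes> (g \<otimes> x)" if y: "y \<in> K" for y
  proof -
    obtain x where x: "x \<in> A" "?D #> y = ?D #> x" using A(3) y by blast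
    then have "y \<in> ?D #> x" using rcos_self[of y ?D] y D by simp
    then show ?thesis using memD[of y x] x(1) A(1) by blast
  qed
  moreover have "x = y" if "x \<in> A" "y \<in> A" "h \<in> Jt" "g \<in> N" "y = h \<otimes> (g \<otimes> x)" for x y h g
  proof -
    have "x \<in> K" using that A(1) by blast
    then have "?D #> x = ?D #> y"
      using repr_independence[OF mem[OF that(3,4)] _ D, of x] that(5) by simp
    then show ?thesis using inj_onD[OF A(2)] that by blast
  qed
  ultimately have "transversal A"
    unfolding transversal_def using A(1) by blast
  then show ?thesis by (rule that)
qed

lemma point_in_span_components:
  assumes A: "transversal A" and y: "y \<in> K" and u: "u \<in> rspace \<sigma>"
  shows "point y u \<in> V.span (\<Union>x\<in>A. \<Union>W\<in>\<W>. component x W)"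
    (is "_ \<in> ?P")
proof -
  obtain x h g where x: "x \<in> A" and hg: "h \<in> Jt" "g \<in> N" "y = h \<otimes> (g \<otimes> x)"
    using A y unfolding transversal_def by blast
  have xK: "x \<in> K" using x A by (auto simp: transversal_def)
  let ?u = "ract \<sigma> (inv h) u"
  have u': "?u \<in> rspace \<sigma>" using hg u S.act_closed by simp
  have "u = ract \<sigma> h ?u"
    using S.act_mult[of h "inv h" u] S.act_one[OF u] hg u by simp
  then have eq: "point y u = point (g \<otimes> x) ?u"
    using point_shift[OF hg(1), of "g \<otimes> x" ?u] hg xK u' by simp
  have "S.subspace {w \<in> rspace \<sigma>. point (g \<otimes> x) w \<in> ?P}"
    unfolding S.subspace_def
    using S.subspace_rspace
    by (auto simp: S.subspace_def point_0 point_add point_scale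
        V.span_zero V.span_add V.span_scale simp del: rscale_V)
  moreover have "\<Union>\<W> \<subseteq> {w \<in> rspace \<sigma>. point (g \<otimes> x) w \<in> ?P}"
  proof
    fix w assume "w \<in> \<Union>\<W>"
    then obtain W where W: "W \<in> \<W>" "w \<in> W" by blast
    then have "point (g \<otimes> x) w \<in> (\<Union>x\<in>A. \<Union>W\<in>\<W>. component x W)"
      using point_in_component[OF xK hg(2) family_member(1)[OF W(1)] W(2)] x by blast
    then have "point (g \<otimes> x) w \<in> ?P" by (rule V.span_base)
    then show "w \<in> {w \<in> rspace \<sigma>. point (g \<otimes> x) w \<in> ?P}"
      using family_member(3)[OF W(1)] W(2) by blast
  qed
  ultimately have "S.span (\<Union>\<W>) \<subseteq> {w \<in> rspace \<sigma>. point (g \<otimes> x) w \<in> ?P}"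
    by (intro S.span_minimal)
  then show ?thesis
    using u' span_family eq by auto
qed

text \<open>
  Restricting functions to \<open>N x\<close> kills the components at other double cosets, and sends those
  at \<open>x\<close> to functions with values in the corresponding members of \<open>\<W>\<close>. So the independence of the
  components follows from that of \<open>\<W>\<close>.
\<close>
lemma decomposition_V:
  assumes A: "transversal A"
  shows "irreducible_decomposition G T N V ((\<lambda>(x, W). component x W) ` (A \<times> \<W>))"
    (is "irreducible_decomposition G T N V ?M")
proof -
  have AK: "A \<subseteq> K" using A by (simp add: transversal_def)
  have UM: "\<Union>?M = (\<Union>x\<in>A. \<Union>W\<in>\<W>. component x W)" by auto
  have irr: "\<forall>C\<in>?M. V.irred C"
    using irreducible_component AK by auto
  moreover have "V.span (\<Union>?M) = rspace V"
  proof
    show "V.span (\<Union>?M) \<subseteq> rspace V"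
      by (intro V.span_minimal V.subspace_rspace) (auto simp: component_def)
    show "rspace V \<subseteq> V.span (\<Union>?M)"
      unfolding UM
    proof
      fix f assume f: "f \<in> rspace V"
      show "f \<in> V.span (\<Union>x\<in>A. \<Union>W\<in>\<W>. component x W)"
        by (rule mem_subspace_of_points[OF f V.subspace_span
              point_in_span_components[OF A _ value_in_rspace[OF f]]])
    qed
  qed
  moreover have "V.independent_family ?M"
    unfolding V.independent_family_def
  proof (intro ballI notI)
    fix C assume "C \<in> ?M" and sub: "C \<subseteq> V.span (\<Union>(?M - {C}))"
    then obtain x W where x: "x \<in> A" and W: "W \<in> \<W>" and C: "C = component x W" by auto
    have xK: "x \<in> K" using x AK by blast
    let ?L = "S.span (\<Union>(\<W> - {W}))"
    let ?Q = "{f. \<forall>g\<in>N. f (g \<otimes> x) \<in> ?L}"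
    have "V.subspace ?Q"
      unfolding V.subspace_def by (auto simp: S.span_zero S.span_add S.span_scale)
    moreover have "\<Union>(?M - {C}) \<subseteq> ?Q"
    proof
      fix f assume "f \<in> \<Union>(?M - {C})"
      then obtain y W' where y: "y \<in> A" and W': "W' \<in> \<W>" and f: "f \<in> component y W'"
        and ne: "component y W' \<noteq> component x W"
        unfolding C by auto
      have "f (g \<otimes> x) \<in> ?L" if g: "g \<in> N" for g
      proof (cases "f (g \<otimes> x) = 0")
        case False
        then obtain h g' where hg: "h \<in> Jt" "g' \<in> N" "g \<otimes> x = h \<otimes> (g' \<otimes> y)"
          using component_nonzero_value[OF f] y AK by blast
        have yK: "y \<in> K" using y AK by blast
        have "x = inv g \<otimes> (g \<otimes> x)" using g xK by simp
        also have "\<dots> = h \<otimes> ((inv h \<otimes> inv g \<otimes> h \<otimes> g') \<otimes> y)"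
          unfolding hg(3) using g hg yK by (simp add: m_assoc)
        finally have "x = h \<otimes> ((inv h \<otimes> inv g \<otimes> h \<otimes> g') \<otimes> y)" .
        moreover have "inv h \<otimes> inv g \<otimes> h \<otimes> g' \<in> N" using g hg by simp
        ultimately have "y = x"
          using A x y hg(1) unfolding transversal_def by blast
        then have "f (g \<otimes> x) \<in> W'" "W' \<noteq> W"
          using componentD(2)[OF f, of g] g ne by auto
        then show ?thesis using W' by (intro S.span_base) auto
      qed (simp add: S.span_zero)
      then show "f \<in> ?Q" by blast
    qed
    ultimately have "C \<subseteq> ?Q"
      using sub V.span_minimal[of "\<Union>(?M - {C})" ?Q] by blast
    have "W \<subseteq> ?L"
    proof
      fix w assume w: "w \<in> W"
      then have "point x w \<in> ?Q"
        using \<open>C \<subseteq> ?Q\<close> point_in_base_component[OF xK W] unfolding C by blast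
      then have "point x w (\<one> \<otimes> x) \<in> ?L"
        using membership_closed(2) by blast
      then show "w \<in> ?L"
        using point_self[OF xK, of w] family_member(3)[OF W] w xK by auto
    qed
    then show False
      using independent_family W by (simp add: SJ.independent_family_def)
  qed
  ultimately show ?thesis
    by (simp add: V.irreducible_decomposition_iff)
qed

lemma constituent_class_component:
  assumes A: "transversal A" and x: "x \<in> A" and W: "W \<in> \<W>"
  shows "constituent_class N V ((\<lambda>(x, W). component x W) ` (A \<times> \<W>)) (component x W) =
    component x ` constituent_class J \<sigma> \<W> W"
proof -
  have AK: "A \<subseteq> K" using A by (simp add: transversal_def)
  have xK: "x \<in> K" using x AK by blast
  have "y = x \<and> rep_iso J (subrep \<sigma> W') (subrep \<sigma> W)"
    if y: "y \<in> A" and W': "W' \<in> \<W>"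
      and iso: "rep_iso N (subrep V (component y W')) (subrep V (component x W))" for y W'
  proof -
    have yK: "y \<in> K" using y AK by blast
    obtain g where g: "g \<in> N" "g \<otimes> x \<otimes> inv y \<in> Jt"
      using rep_iso_components_imp(1)[OF yK xK W' W iso] by blast
    let ?h = "g \<otimes> x \<otimes> inv y"
    have "x = inv g \<otimes> (?h \<otimes> y)" using g xK yK by (simp add: m_assoc)
    also have "\<dots> = ?h \<otimes> ((inv ?h \<otimes> inv g \<otimes> ?h) \<otimes> y)"
      using g xK yK by (simp add: m_assoc inv_mult_group)
    finally have "x = ?h \<otimes> ((inv ?h \<otimes> inv g \<otimes> ?h) \<otimes> y)" .
    moreover have "inv ?h \<otimes> inv g \<otimes> ?h \<in> N" using g xK yK by simp
    ultimately have "y = x"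
      using A x y g(2) unfolding transversal_def by blast
    with rep_iso_components_imp(2)[OF yK xK W' W iso] show ?thesis by blast
  qed
  then show ?thesis
    using rep_iso_components[OF xK _ W] x unfolding constituent_class_def by auto
qed

theorem multiplicity_on_V: "multiplicity_on G T N V = multiplicity_on G T J \<sigma>"
proof -
  obtain A where A: "transversal A" using transversal_exists .
  let ?M = "(\<lambda>(x, W). component x W) ` (A \<times> \<W>)"
  have inj: "inj_on (component x) \<W>" if "x \<in> A" for x
  proof -
    have "x \<in> K" using A that by (auto simp: transversal_def)
    then show ?thesis by (intro inj_onI) (rule component_eq_imp)
  qed
  have class_card: "finite (constituent_class N V ?M (component x W)) = finite (constituent_class J \<sigma> \<W> W)"
    "card (constituent_class N V ?M (component x W)) = card (constituent_class J \<sigma> \<W> W)"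
    if "x \<in> A" "W \<in> \<W>" for x W
  proof -
    have "inj_on (component x) (constituent_class J \<sigma> \<W> W)"
      by (rule inj_on_subset[OF inj[OF that(1)]]) (auto simp: constituent_class_def)
    then show "finite (constituent_class N V ?M (component x W)) = finite (constituent_class J \<sigma> \<W> W)"
      "card (constituent_class N V ?M (component x W)) = card (constituent_class J \<sigma> \<W> W)"
      unfolding constituent_class_component[OF A that] by (auto simp: finite_image_iff card_image)
  qed
  have "A \<noteq> {}" using A membership_closed(3) unfolding transversal_def by blast
  then have "uniform_multiplicity N V ?M m \<longleftrightarrow> uniform_multiplicity J \<sigma> \<W> m" for m
    unfolding uniform_multiplicity_def using class_card by auto
  then show ?thesis
    using V.multiplicity_on_eq[OF decomposition_V[OF A]] SJ.multiplicity_on_eq[OF decomposition] by simp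
qed

end

section \<open>Conjugates of a weakly cuspidal representation\<close>

context mackey_setting
begin

lemma act_inv_cancel:
  assumes "a \<in> Jt" "w \<in> rspace \<sigma>"
  shows "ract \<sigma> a (ract \<sigma> (inv a) w) = w" "ract \<sigma> (inv a) (ract \<sigma> a w) = w"
  using S.act_mult[of a "inv a" w] S.act_mult[of "inv a" a w] S.act_one assms by simp_all

lemma translate_invariant:
  assumes a: "a \<in> Jt" and W: "invariant_subspace J \<sigma> W"
  shows "invariant_subspace J \<sigma> (ract \<sigma> a ` W)"
  unfolding invariant_subspace_def
proof (intro conjI ballI)
  note iW = SJ.invariantD[OF W]
  note Wr = subsetD[OF iW(2)]
  show "S.subspace (ract \<sigma> a ` W)"
    unfolding S.subspace_def
  proof (intro conjI ballI allI)
    show "0 \<in> ract \<sigma> a ` W"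
      using S.act_zero[OF a] S.subspace_0[OF iW(1)] by (metis image_eqI)
    fix u w assume "u \<in> ract \<sigma> a ` W" "w \<in> ract \<sigma> a ` W"
    then show "u + w \<in> ract \<sigma> a ` W"
      using S.act_add[OF a Wr Wr] S.subspace_add[OF iW(1)] by (auto simp: image_iff) metis
  next
    fix c w assume "w \<in> ract \<sigma> a ` W"
    then show "rscale \<sigma> c w \<in> ract \<sigma> a ` W"
      using S.act_scale[OF a Wr] S.subspace_scale[OF iW(1)] by (auto simp: image_iff) metis
  qed
  show "ract \<sigma> a ` W \<subseteq> rspace \<sigma>"
    using S.act_closed[OF a] Wr by auto
  fix j v assume j: "j \<in> J" and "v \<in> ract \<sigma> a ` W"
  then obtain w where w: "w \<in> W" "v = ract \<sigma> a w" by blast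
  let ?k = "inv a \<otimes> j \<otimes> a"
  have k: "?k \<in> J" using a j by simp
  have "ract \<sigma> j v = ract \<sigma> (j \<otimes> a) w"
    using w a j Wr by (simp add: S.act_mult)
  also have "j \<otimes> a = a \<otimes> ?k" using a j by (simp add: m_assoc)
  also have "ract \<sigma> (a \<otimes> ?k) w = ract \<sigma> a (ract \<sigma> ?k w)"
    using S.act_mult[OF a, of ?k w] k w(1) Wr by blast
  finally show "ract \<sigma> j v \<in> ract \<sigma> a ` W"
    using iW(3)[OF k w(1)] by simp
qed

lemma translate_irred:
  assumes a: "a \<in> Jt" and W: "SJ.irred W"
  shows "SJ.irred (ract \<sigma> a ` W)"
  unfolding SJ.irred_iff
proof (intro conjI allI impI)
  note iW = SJ.invariantD[OF SJ.irredD(1)[OF W]]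
  note Wr = subsetD[OF iW(2)]
  show "invariant_subspace J \<sigma> (ract \<sigma> a ` W)"
    using translate_invariant[OF a SJ.irredD(1)[OF W]] .
  obtain w where w: "w \<in> W" "w \<noteq> 0" using SJ.irred_nonzero[OF W] .
  have "ract \<sigma> a w \<noteq> 0"
  proof
    assume "ract \<sigma> a w = 0"
    then have "w = ract \<sigma> (inv a) 0" using act_inv_cancel(2)[OF a Wr[OF w(1)]] by simp
    then show False using w(2) S.act_zero a by simp
  qed
  then show "ract \<sigma> a ` W \<noteq> {0}" using w(1) by blast
  fix U assume U: "invariant_subspace J \<sigma> U" and sub: "U \<subseteq> ract \<sigma> a ` W"
  have Ur: "U \<subseteq> rspace \<sigma>" using SJ.invariantD(2)[OF U] .
  have "ract \<sigma> (inv a) ` U \<subseteq> W"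
    using sub act_inv_cancel(2)[OF a Wr] by fastforce
  then have "ract \<sigma> (inv a) ` U = {0} \<or> ract \<sigma> (inv a) ` U = W"
    using W translate_invariant[OF membership_closed(5)[OF a] U] unfolding SJ.irred_iff by blast
  moreover have "ract \<sigma> a ` (ract \<sigma> (inv a) ` U) = U"
    using act_inv_cancel(1)[OF a subsetD[OF Ur]] by (simp add: image_image)
  ultimately show "U = {0} \<or> U = ract \<sigma> a ` W"
    using S.act_zero[OF a] by auto
qed

text \<open>
  The sum of all translates is invariant under \<open>Jt\<close>, so it exhausts the irreducible \<open>\<sigma>\<close>. This is
  why \<open>\<sigma>\<close> is semisimple over \<open>J\<close>.
\<close>
lemma span_translates:
  assumes \<sigma>: "irreducible_rep G T Jt \<sigma>" and W: "W \<subseteq> rspace \<sigma>" "w \<in> W" "w \<noteq> 0"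
  shows "S.span (\<Union>a\<in>Jt. ract \<sigma> a ` W) = rspace \<sigma>" (is "S.span ?U = _")
proof -
  have U: "?U \<subseteq> rspace \<sigma>" using S.act_closed W(1) by auto
  then have sub: "S.span ?U \<subseteq> rspace \<sigma>" by (intro S.span_minimal S.subspace_rspace)
  have "ract \<sigma> h x \<in> S.span ?U" if h: "h \<in> Jt" and x: "x \<in> S.span ?U" for h x
  proof -
    let ?P = "{x \<in> rspace \<sigma>. ract \<sigma> h x \<in> S.span ?U}"
    have "S.subspace ?P"
      using S.subspace_rspace h
      by (auto simp: S.subspace_def S.act_zero S.act_add S.act_scale S.span_zero S.span_add S.span_scale)
    moreover have "?U \<subseteq> ?P"
    proof
      fix y assume y: "y \<in> ?U"
      then obtain a v where v: "a \<in> Jt" "v \<in> W" "y = ract \<sigma> a v" by blast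
      then have "ract \<sigma> h y = ract \<sigma> (h \<otimes> a) v"
        using S.act_mult[of h a v] h W(1) by auto
      moreover have "h \<otimes> a \<in> Jt" using h v by simp
      ultimately have "ract \<sigma> h y \<in> ?U" using v(2) by blast
      then have "ract \<sigma> h y \<in> S.span ?U" by (rule S.span_base)
      then show "y \<in> ?P" using y U by blast
    qed
    ultimately have "S.span ?U \<subseteq> ?P" by (intro S.span_minimal)
    with x show ?thesis by blast
  qed
  then have "invariant_subspace Jt \<sigma> (S.span ?U)"
    using sub by (simp add: invariant_subspace_def)
  moreover have "w \<in> S.span ?U"
  proof (rule S.span_base)
    have "w = ract \<sigma> \<one> w" using S.act_one W by auto
    then show "w \<in> ?U" using W(2) membership_closed(1) by blast
  qed
  ultimately show ?thesis
    using \<sigma> W(3) unfolding irreducible_rep_def by blast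
qed

text \<open>
  If \<open>h\<close> intertwines the translates of \<open>W\<close> by \<open>a\<close> and \<open>b\<close>, then \<open>k = b\<inverse> h a\<close> intertwines \<open>W\<close>, hence
  \<open>\<rho>\<close>, with itself. So \<open>k\<close>, and with it \<open>h = b k a\<inverse>\<close>, lies in \<open>Jt\<close>.
\<close>
lemma translates_cuspidal:
  assumes \<rho>: "smooth_rep G T J \<rho>" and int: "intertwining_set G J \<rho> \<subseteq> Jt"
    and W: "invariant_subspace J \<sigma> W" and iso: "rep_iso J \<rho> (subrep \<sigma> W)"
    and a: "a \<in> Jt" and b: "b \<in> Jt" and h: "h \<in> carrier G"
    and \<mu>: "intertwines h (ract \<sigma> a ` W) (ract \<sigma> b ` W) \<mu>"
    and w: "w \<in> ract \<sigma> a ` W" "\<mu> w \<noteq> 0"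
  shows "h \<in> Jt"
proof -
  interpret \<rho>: smooth_representation G T J \<rho> by unfold_locales (rule \<rho>)
  note iW = SJ.invariantD[OF W]
  note Wr = subsetD[OF iW(2)]
  obtain \<theta> where \<theta>: "\<theta> \<in> rep_hom J \<rho> (subrep \<sigma> W)" "bij_betw \<theta> (rspace \<rho>) W"
    using iso by (auto simp: rep_iso_def)
  obtain \<eta> where \<eta>: "\<eta> \<in> rep_hom J (subrep \<sigma> W) \<rho>" "bij_betw \<eta> W (rspace \<rho>)"
    using \<rho>.rep_iso_sym[OF iso] by (auto simp: rep_iso_def)
  note \<theta>D = rep_homD[OF \<theta>(1), unfolded rspace_subrep rscale_subrep ract_subrep]
    and \<eta>D = rep_homD[OF \<eta>(1), unfolded rspace_subrep rscale_subrep ract_subrep]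
  have \<mu>h: "\<mu> \<in> rep_hom {} (subrep \<sigma> (ract \<sigma> a ` W)) (subrep \<sigma> (ract \<sigma> b ` W))"
    and \<mu>e: "\<And>j w. j \<in> J \<Longrightarrow> h \<otimes> j \<otimes> inv h \<in> J \<Longrightarrow> w \<in> ract \<sigma> a ` W \<Longrightarrow>
      \<mu> (ract \<sigma> j w) = ract \<sigma> (h \<otimes> j \<otimes> inv h) (\<mu> w)"
    using \<mu> by (auto simp: intertwines_def)
  note \<mu>D = rep_homD[OF \<mu>h, unfolded rspace_subrep rscale_subrep]
  define \<beta> where "\<beta> = ract \<sigma> (inv b)"
  have \<beta>: "\<beta> u \<in> W" if "u \<in> ract \<sigma> b ` W" for u
    using that act_inv_cancel(2)[OF b Wr] by (auto simp: \<beta>_def)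
  have bW: "ract \<sigma> b ` W \<subseteq> rspace \<sigma>" using S.act_closed[OF b] Wr by blast
  have a\<theta>: "ract \<sigma> a (\<theta> x) \<in> ract \<sigma> a ` W" if "x \<in> rspace \<rho>" for x
    using \<theta>D(1)[OF that] by blast
  define k where "k = inv b \<otimes> h \<otimes> a"
  have k: "k \<in> carrier G" using a b h by (simp add: k_def)
  define f where "f x = \<eta> (\<beta> (\<mu> (ract \<sigma> a (\<theta> x))))" for x
  \<comment> \<open>Transporting \<open>\<mu>\<close> back to \<open>\<rho>\<close> gives an operator intertwining \<open>\<rho>\<close> through \<open>inv k\<close>.\<close>
  have "f \<in> rep_hom (J \<inter> conj_set G (inv k) J) \<rho> (conj_rep G (inv k) \<rho>)"
  proof (rule rep_homI)
    fix x assume x: "x \<in> rspace \<rho>"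
    then show "f x \<in> rspace (conj_rep G (inv k) \<rho>)"
      using \<eta>D(1) \<beta> \<mu>D(1) a\<theta> by (simp add: f_def conj_rep_def)
  next
    fix x y assume x: "x \<in> rspace \<rho>" and y: "y \<in> rspace \<rho>"
    have "ract \<sigma> a (\<theta> (x + y)) = ract \<sigma> a (\<theta> x) + ract \<sigma> a (\<theta> y)"
      using \<theta>D(1,2) x y Wr a by (simp add: S.act_add)
    then have "\<mu> (ract \<sigma> a (\<theta> (x + y))) = \<mu> (ract \<sigma> a (\<theta> x)) + \<mu> (ract \<sigma> a (\<theta> y))"
      using \<mu>D(2) a\<theta> x y by simp
    moreover have "\<beta> (\<mu> (ract \<sigma> a (\<theta> x)) + \<mu> (ract \<sigma> a (\<theta> y))) =
        \<beta> (\<mu> (ract \<sigma> a (\<theta> x))) + \<beta> (\<mu> (ract \<sigma> a (\<theta> y)))"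
      using \<mu>D(1) a\<theta> x y bW b unfolding \<beta>_def by (intro S.act_add) auto
    ultimately show "f (x + y) = f x + f y"
      using \<eta>D(2) \<beta> \<mu>D(1) a\<theta> x y by (simp add: f_def)
  next
    fix c x assume x: "x \<in> rspace \<rho>"
    have "ract \<sigma> a (\<theta> (rscale \<rho> c x)) = rscale \<sigma> c (ract \<sigma> a (\<theta> x))"
      using \<theta>D(1,3) x Wr a by (simp add: S.act_scale)
    then have "\<mu> (ract \<sigma> a (\<theta> (rscale \<rho> c x))) = rscale \<sigma> c (\<mu> (ract \<sigma> a (\<theta> x)))"
      using \<mu>D(3) a\<theta> x by simp
    moreover have "\<beta> (rscale \<sigma> c (\<mu> (ract \<sigma> a (\<theta> x)))) = rscale \<sigma> c (\<beta> (\<mu> (ract \<sigma> a (\<theta> x))))"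
      using \<mu>D(1) a\<theta> x bW b unfolding \<beta>_def by (intro S.act_scale) auto
    ultimately show "f (rscale \<rho> c x) = rscale (conj_rep G (inv k) \<rho>) c (f x)"
      using \<eta>D(3) \<beta> \<mu>D(1) a\<theta> x by (simp add: f_def conj_rep_def)
  next
    fix j x assume "j \<in> J \<inter> conj_set G (inv k) J" and x: "x \<in> rspace \<rho>"
    then obtain i where j: "j \<in> J" and i: "i \<in> J" and ji: "j = inv k \<otimes> i \<otimes> k"
      using k by (auto simp: conj_set_def)
    have kj: "k \<otimes> j \<otimes> inv k = i" using i k by (simp add: ji m_assoc)
    have aj: "a \<otimes> j \<otimes> inv a \<in> J" and bi: "b \<otimes> i \<otimes> inv b \<in> J" using a b i j by simp_all
    have "a \<otimes> j \<otimes> inv a = inv h \<otimes> (b \<otimes> i \<otimes> inv b) \<otimes> h"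
      using a b h i by (simp add: ji k_def m_assoc inv_mult_group)
    then have hj: "h \<otimes> (a \<otimes> j \<otimes> inv a) \<otimes> inv h = b \<otimes> i \<otimes> inv b"
      using b h i by (simp add: m_assoc)
    let ?v = "\<mu> (ract \<sigma> a (\<theta> x))"
    have v: "?v \<in> ract \<sigma> b ` W" "?v \<in> rspace \<sigma>" using \<mu>D(1)[OF a\<theta>[OF x]] bW by auto
    have \<theta>x: "\<theta> x \<in> rspace \<sigma>" using \<theta>D(1)[OF x] Wr by blast
    have "ract \<sigma> a (\<theta> (ract \<rho> j x)) = ract \<sigma> (a \<otimes> j) (\<theta> x)"
      using \<theta>D(4)[OF j x] S.act_mult[of a j "\<theta> x"] a j \<theta>x by simp
    also have "a \<otimes> j = (a \<otimes> j \<otimes> inv a) \<otimes> a" using a j by (simp add: m_assoc)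
    also have "ract \<sigma> ((a \<otimes> j \<otimes> inv a) \<otimes> a) (\<theta> x) = ract \<sigma> (a \<otimes> j \<otimes> inv a) (ract \<sigma> a (\<theta> x))"
      using aj a \<theta>x by (intro S.act_mult) auto
    finally have "\<mu> (ract \<sigma> a (\<theta> (ract \<rho> j x))) = ract \<sigma> (b \<otimes> i \<otimes> inv b) ?v"
      using \<mu>e[OF aj _ a\<theta>[OF x]] bi by (simp only: hj)
    then have "\<beta> (\<mu> (ract \<sigma> a (\<theta> (ract \<rho> j x)))) = ract \<sigma> (inv b \<otimes> (b \<otimes> i \<otimes> inv b)) ?v"
      using S.act_mult[of "inv b" "b \<otimes> i \<otimes> inv b" ?v] bi b v by (simp add: \<beta>_def)
    also have "inv b \<otimes> (b \<otimes> i \<otimes> inv b) = i \<otimes> inv b" using b i by (simp add: m_assoc)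
    also have "ract \<sigma> (i \<otimes> inv b) ?v = ract \<sigma> i (\<beta> ?v)"
      using S.act_mult[of i "inv b" ?v] b i v by (simp add: \<beta>_def)
    finally show "f (ract \<rho> j x) = ract (conj_rep G (inv k) \<rho>) j (f x)"
      using \<eta>D(4)[OF i \<beta>[OF v(1)]] kj k by (simp add: f_def conj_rep_def)
  qed
  moreover obtain x where x: "x \<in> rspace \<rho>" "w = ract \<sigma> a (\<theta> x)"
    using w(1) bij_betw_imp_surj_on[OF \<theta>(2)] by blast
  have "f x \<noteq> 0"
  proof
    assume "f x = 0"
    have v: "\<mu> w \<in> ract \<sigma> b ` W" using \<mu>D(1)[OF w(1)] .
    have "0 \<in> W" using S.subspace_0[OF iW(1)] .
    moreover have "\<eta> 0 = 0" using \<eta>D(2)[of 0 0] \<open>0 \<in> W\<close> by simp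
    ultimately have "\<beta> (\<mu> w) = 0"
      using inj_onD[OF bij_betw_imp_inj_on[OF \<eta>(2)], of "\<beta> (\<mu> w)" 0] \<beta>[OF v] \<open>f x = 0\<close> x
      by (simp add: f_def)
    then have "\<mu> w = ract \<sigma> b 0"
      using act_inv_cancel(1)[OF b, of "\<mu> w"] v bW by (auto simp: \<beta>_def)
    then show False using w(2) S.act_zero[OF b] by simp
  qed
  ultimately have "inv k \<in> intertwining_set G J \<rho>"
    using x(1) k by (auto simp: intertwining_set_def)
  then have "inv k \<in> Jt" using int by blast
  then have "k \<in> Jt" using membership_closed(5)[of "inv k"] k by simp
  moreover have "h = b \<otimes> k \<otimes> inv a" using a b h by (simp add: k_def m_assoc)
  ultimately show ?thesis using a b by simp
qed

text \<open>
  The hypotheses on \<open>\<rho>\<close> supply a cuspidal family for \<open>\<sigma>\<close>: a decomposition chosen among the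
  translates of a copy of \<open>\<rho>\<close>, which span \<open>\<sigma>\<close>.
\<close>
theorem multiplicity_on_compact_ind:
  assumes \<sigma>_irr: "irreducible_rep G T Jt \<sigma>" and \<rho>: "irreducible_rep G T J \<rho>"
    and contains: "rep_contains J \<sigma> \<rho>" and int: "intertwining_set G J \<rho> \<subseteq> Jt"
  shows "multiplicity_on G T N V = multiplicity_on G T J \<sigma>"
proof -
  obtain W where W: "invariant_subspace J \<sigma> W" and iso: "rep_iso J \<rho> (subrep \<sigma> W)"
    using contains by (auto simp: rep_contains_def)
  have \<rho>_smooth: "smooth_rep G T J \<rho>" using \<rho> by (simp add: irreducible_rep_def)
  interpret \<rho>: smooth_representation G T J \<rho> by unfold_locales (rule \<rho>_smooth)
  have irr: "SJ.irred W"
    using irreducible_rep_iso[OF \<rho> SJ.smooth_rep_subrep[OF W] iso] W by (simp add: SJ.irred_def)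
  obtain w where w: "w \<in> W" "w \<noteq> 0" using SJ.irred_nonzero[OF irr] .
  let ?S = "(\<lambda>a. ract \<sigma> a ` W) ` Jt"
  have "S.span (\<Union>?S) = rspace \<sigma>"
    using span_translates[OF \<sigma>_irr SJ.invariantD(2)[OF W] w] by simp
  then obtain \<W> where \<W>: "\<W> \<subseteq> ?S" "irreducible_decomposition G T J \<sigma> \<W>"
    using SJ.irreducible_decomposition_exists[of ?S] translate_irred[OF _ irr] by blast
  interpret cuspidal_family G T N Jt K \<sigma> \<W>
  proof
    show "h \<in> Jt" if "A \<in> \<W>" "B \<in> \<W>" "h \<in> carrier G" "intertwines h A B \<mu>" "u \<in> A" "\<mu> u \<noteq> 0"
      for A B h \<mu> u
    proof -
      have "A \<in> ?S" "B \<in> ?S" using that(1,2) \<W>(1) by blast+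
      then obtain a b where ab: "a \<in> Jt" "b \<in> Jt" "A = ract \<sigma> a ` W" "B = ract \<sigma> b ` W"
        by blast
      show ?thesis
        using translates_cuspidal[OF \<rho>_smooth int W iso ab(1,2) that(3), of \<mu> u] that(4-6) ab(3,4)
        by simp
    qed
  qed (rule \<W>(2))
  show ?thesis by (rule multiplicity_on_V)
qed

end

section \<open>The multiplicity formula\<close>

theorem theorem3p11:
  fixes v :: "'f::field \<Rightarrow> real"
    and \<G> :: "('f alg_closure ^ 'n ^ 'n) set"
    and G :: "('f ^ 'n ^ 'n) monoid" and T :: "('f ^ 'n ^ 'n) topology"
    and Z Gb J Jt :: "('f ^ 'n ^ 'n) set"
    and \<rho> :: "('f ^ 'n ^ 'n, 'v::ab_group_add) rep"
    and \<rho>t :: "('f ^ 'n ^ 'n, 'w::ab_group_add) rep"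
    and \<pi> \<pi>b :: "('f ^ 'n ^ 'n, 'f ^ 'n ^ 'n \<Rightarrow> 'w) rep"
  assumes "nonarch_local_field v"
    and "connected_reductive_group \<G>"
    and "G = rational_group \<G>"
    and "T = rational_topology v \<G>"
    and "Z = rational_points (algebraic_center \<G>)"
    and "flat_subgroup G T (zero_subgroup v \<G>) Gb"
    and "weakly_cuspidal_datum G T Z Gb J \<rho> Jt \<rho>t"
    and "\<pi> = compact_ind G T Jt (carrier G) \<rho>t"
    and "\<pi>b = compact_ind G T Jt (Gb <#>\<^bsub>G\<^esub> Jt) \<rho>t"
  shows "multiplicity_on G T Gb \<pi> = multiplicity_on G T Gb \<pi>b \<and>
         multiplicity_on G T Gb \<pi>b = multiplicity_on G T J \<rho>t"
proof -
  have "closed_subgroup \<G>"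
    using assms(2) by (simp add: connected_reductive_group_def)
  then interpret translation_group G T
    unfolding assms(3,4) by (rule nonarch_local_field.translation_group_rational_group[OF assms(1)])
  have Gb: "Gb \<lhd> G" "openin T Gb"
    using assms(6) by (auto simp: flat_subgroup_def)
  have datum: "open_compact_subgroup G T J" "irreducible_rep G T J \<rho>" "subgroup Jt G" "openin T Jt"
    "irreducible_rep G T Jt \<rho>t" "rep_contains J \<rho>t \<rho>" "intertwining_set G J \<rho> \<subseteq> Jt"
    and J: "J = Jt \<inter> Gb"
    using assms(7)
    by (auto simp: weakly_cuspidal_datum_def cuspidal_datum_def open_compact_mod_subgroup_def)
  have smooth: "smooth_rep G T Jt \<rho>t" and compact: "compactin T (Jt \<inter> Gb)"
    using datum(1,5) J by (auto simp: irreducible_rep_def open_compact_subgroup_def)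
  have "multiplicity_on G T Gb (compact_ind G T Jt K \<rho>t) = multiplicity_on G T J \<rho>t"
    if "subgroup K G" "Gb \<subseteq> K" "Jt \<subseteq> K" for K
  proof -
    interpret mackey_setting G T Gb Jt K \<rho>t
      using Gb datum(3,4) that compact smooth
      by (intro mackey_setting.intro mackey_setting_axioms.intro translation_group_axioms)
    show ?thesis
      using multiplicity_on_compact_ind datum(2,5-7) unfolding J by blast
  qed
  moreover have "subgroup (carrier G) G" by (rule subgroup_self)
  moreover have "subgroup (Gb <#>\<^bsub>G\<^esub> Jt) G" using mult_norm_subgroup[OF Gb(1) datum(3)] .
  moreover have sub: "Gb \<subseteq> carrier G" "Jt \<subseteq> carrier G"
    using open_subset_carrier Gb(2) datum(4) by auto
  moreover have "Gb \<subseteq> Gb <#>\<^bsub>G\<^esub> Jt"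
  proof
    fix g assume g: "g \<in> Gb"
    then have "g \<otimes>\<^bsub>G\<^esub> \<one>\<^bsub>G\<^esub> \<in> Gb <#>\<^bsub>G\<^esub> Jt"
      using subgroup.one_closed[OF datum(3)] unfolding set_mult_def by blast
    then show "g \<in> Gb <#>\<^bsub>G\<^esub> Jt"
      using g sub by (simp add: subset_iff)
  qed
  moreover have "Jt \<subseteq> Gb <#>\<^bsub>G\<^esub> Jt"
  proof
    fix h assume h: "h \<in> Jt"
    then have "\<one>\<^bsub>G\<^esub> \<otimes>\<^bsub>G\<^esub> h \<in> Gb <#>\<^bsub>G\<^esub> Jt"
      using subgroup.one_closed[OF normal_imp_subgroup[OF Gb(1)]] unfolding set_mult_def by blast
    then show "h \<in> Gb <#>\<^bsub>G\<^esub> Jt"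
      using h sub by (simp add: subset_iff)
  qed
  ultimately show ?thesis
    unfolding assms(8,9) by simp
qed

end
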